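(* Let $J\subseteq I$, let $\mathsf v$ be a $J$-parameter system, and let $w\in\widetilde W$. The matrix entries of $\pi_{J,\mathsf v}(T_w)$ with respect to the basis $\{\mathbf m_u\mid u\in W^J\}$ of $M_{J,\mathsf v}$ are $$[\pi_{J,\mathsf v}(T_w)]_{u,v}=\sum_{\{p\in\mathcal P_J(\vec w,u)\,\mid\,\theta^J(p)=v\}}\mathcal Q_{J,\mathsf v}(p)\,\zeta_J^{\mathrm{wt}(p)}\qquad\text{for }u,v\in W^J,$$ where $\vec w$ is any choice of reduced expression for $w$.
   Context: Root system and groups. $\Phi$ is an irreducible, not necessarily reduced, crystallographic root system of rank $n$ in an $n$-dimensional Euclidean space $(V,\langle\cdot,\cdot\rangle)$, with simple roots $\alpha_i$, $i\in I=\{1,\dots,n\}$ (Bourbaki labelling), positive roots $\Phi^+$, highest root $\varphi$, and $\alpha^\vee=2\alpha/\langle\alpha,\alpha\rangle$. If $\Phi$ is not reduced it is of type $BC_n$: $V=\mathbb R^n$, $\alpha_j=e_j-e_{j+1}$ ($j<n$), $\alpha_n=e_n$, $\Phi^+=\{e_i\pm e_j\ (i<j),\ e_k,\ 2e_k\}$. Let $\omega_i\in V$ satisfy $\langle\omega_i,\alpha_j\rangle=\delta_{ij}$, $P=\bigoplus_i\mathbb Z\omega_i$, $Q=\mathbb Z\Phi^\vee\subseteq P$. For $\alpha\in\Phi$, $k\in\mathbb Z$: $H_{\alpha,k}=\{x\in V:\langle x,\alpha\rangle=k\}$, $s_{\alpha,k}(x)=x-(\langle x,\alpha\rangle-k)\alpha^\vee$,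 $s_\alpha=s_{\alpha,0}$, $s_i=s_{\alpha_i}$, $s_0=s_{\varphi,1}$. $W_0=\langle s_1,\dots,s_n\rangle$; $W=Q\rtimes W_0$ is a Coxeter group with generators $s_0,\dots,s_n$ and length $\ell$; $\widetilde W=P\rtimes W_0$, $\lambda\in P$ acting as the translation $t_\lambda$. Each $w\in\widetilde W$ is uniquely $w=t_{\mathrm{wt}(w)}\theta(w)$ with $\mathrm{wt}(w)\in P$, $\theta(w)\in W_0$. $A_0=\{x\in V:0\le\langle x,\alpha\rangle\le1\ \forall\alpha\in\Phi^+\}$; $\Sigma$ is the stabiliser of $A_0$ in $\widetilde W$; $\widetilde W=W\rtimes\Sigma$, $\ell(w\sigma)=\ell(w)$, $\sigma s_i\sigma^{-1}=s_{\sigma(i)}$. A reduced expression of $w$ is $w=s_{i_1}\cdots s_{i_\ell}\sigma$ with $\ell=\ell(w)$, $\sigma\in\Sigma$. The crossing $w\to ws_i$ is positive (resp. negative) if $ws_iA_0$ lies in $\{\langle x,\alpha\rangle\ge k\}$ (resp. $\{\langle x,\alpha\rangle\le k\}$), where $H_{\alpha,k}$ with $\alpha\in\Phi^+$ separates $wA_0$ and $ws_iA_0$. Affine roots are expressions $\alpha+k\delta$ ($\alpha\in\Phi,k\in\mathbb Z$), $\alpha_0=-\varphi+\delta$, $u(\alpha+k\delta)=u\alpha+k\delta$ for $u\in W_0$. Objects attached to $J\subseteq I$. $W_J=\langle s_j:j\in J\rangle$; $W^J$ is the set of minimal length representatives of cosets $W_Jw$, $w\in W_0$; $\Phi_J$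 is the set of roots in the span of $\{\alpha_j\}_{j\in J}$, $\Phi_J^+=\Phi_J\cap\Phi^+$; $Q_J=\sum_{\alpha\in\Phi_J}\mathbb Z\alpha^\vee$. Write $\theta(w)=\theta_J(w)\theta^J(w)$ with $\theta_J(w)\in W_J$, $\theta^J(w)\in W^J$. $\mathcal A_J=\{x\in V:0\le\langle x,\alpha\rangle\le1\ \forall\alpha\in\Phi_J^+\}$, $\mathbb W^J=\{w\in\widetilde W:wA_0\subseteq\mathcal A_J\}$. Hecke algebra. $\mathsf q_0,\dots,\mathsf q_n$ are commuting invertible indeterminates with $\mathsf q_i=\mathsf q_j$ whenever $s_i,s_j$ are conjugate in $\widetilde W$ (so $\mathsf q_0=\mathsf q_1$ if $\Phi=A_1$, $\mathsf q_0=\mathsf q_n$ if $\Phi=C_n$), $\mathsf R=\mathbb Z[\mathsf q_0^{\pm1},\dots,\mathsf q_n^{\pm1}]$. $\widetilde{\mathcal H}$ is the $\mathsf R$-algebra with basis $\{T_w:w\in\widetilde W\}$, $T_wT_v=T_{wv}$ if $\ell(wv)=\ell(w)+\ell(v)$, $T_wT_{s_i}=T_{ws_i}+(\mathsf q_i-\mathsf q_i^{-1})T_w$ if $\ell(ws_i)=\ell(w)-1$; $T_i=T_{s_i}$. $J$-parameter system: a family $\mathsf v=(\mathsf v_\alpha)_{\alpha\in\Phi_J}$ in $\mathsf R^\times$ with (1) $\mathsf v_\alpha=\mathsf v_\beta$ if $\beta\in W_J\alpha$; (2) $\mathsf v_{\alpha_j}\in\{\mathsf q_j,-\mathsf q_j^{-1}\}$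 for $j\in J$ with $2\alpha_j\notin\Phi_J$; (3) if $\Phi_J$ is not reduced, $\mathsf v_{2\alpha_n}\in\{\mathsf q_0,-\mathsf q_0^{-1}\}$ and $\mathsf v_{\alpha_n}\mathsf v_{2\alpha_n}\in\{\mathsf q_n,-\mathsf q_n^{-1}\}$. Set $\mathsf v_{\alpha+k\delta}=\mathsf v_\alpha$ for $\alpha\in\Phi_J$ and $\mathsf v_\beta=1$ for $\beta\notin\Phi_J+\mathbb Z\delta$. Ring. $\zeta^\lambda=\prod_i\zeta_i^{a_i}$ for $\lambda=\sum a_i\omega_i$; $\mathsf R[\zeta_J]$ is the quotient of $\mathsf R[\zeta_i^{\pm1}:i\in I]$ by the ideal generated by $\zeta^\gamma-1$, $\gamma\in Q_J$; $\zeta_J^\lambda$ is the image of $\zeta^\lambda$. Module. $(\pi_{J,\mathsf v},M_{J,\mathsf v})$ is the right $\widetilde{\mathcal H}$-module, free over $\mathsf R[\zeta_J]$ with basis $\{\mathbf m_u:u\in W^J\}$, with $\mathbf m_u\cdot T_\sigma=\zeta_J^{\mathrm{wt}(u\sigma)}\mathbf m_{\theta^J(u\sigma)}$ ($\sigma\in\Sigma$) and, for $i\in\{0\}\cup I$: $\mathbf m_u\cdot T_i=\zeta_J^{\mathrm{wt}(us_i)}\mathbf m_{\theta^J(us_i)}$ if $u\to us_i$ is positive and $us_i\in\mathbb W^J$; $\mathbf m_u\cdot T_i=\zeta_J^{\mathrm{wt}(us_i)}\mathbf m_{\theta^J(us_i)}+(\mathsf q_i-\mathsf q_i^{-1})\mathbf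 m_u$ if $u\to us_i$ is negative and $us_i\in\mathbb W^J$; $\mathbf m_u\cdot T_i=\mathsf v_{u\alpha_i}\mathsf v_{2u\alpha_i}\mathbf m_u$ if $us_i\notin\mathbb W^J$. Matrix entries: $\mathbf m_u\cdot h=\sum_v[\pi_{J,\mathsf v}(h)]_{u,v}\mathbf m_v$. Paths. Let $\vec w=s_{i_1}\cdots s_{i_\ell}\sigma$ and $v\in\mathbb W^J$. $\mathcal P_J(\vec w,v)$ is the set of positively $J$-folded alcove paths of type $\vec w$ starting at $v$: sequences $p=(v_0,\dots,v_\ell,v_\ell\sigma)$ with all $v_k\in\mathbb W^J$, $v_0=v$, $v_k\in\{v_{k-1},v_{k-1}s_{i_k}\}$, and such that if $v_{k-1}=v_k$ and $v_{k-1}s_{i_k}\in\mathbb W^J$ then $v_{k-1}\to v_{k-1}s_{i_k}$ is negative. Step $k$ with $v_k=v_{k-1}$ is an $i_k$-fold if $v_{k-1}s_{i_k}\in\mathbb W^J$, and a bounce otherwise; a bounce is positive (resp. negative) if $v_{k-1}A_0$ is on the positive (resp. negative) side of the hyperplane separating $v_{k-1}A_0$ and $v_{k-1}s_{i_k}A_0$, and it occurs on that hyperplane, which is of the form $H_{\alpha,0}$ (resp. $H_{\alpha,1}$) with $\alpha\in\Phi_J^+$. $f_i(p)$ is the number of $i$-folds; for $\alpha\in\Phi_J^+$, $b_\alpha(p)$ is the number of positive bounces occurring on $H_{\alpha,0}$ plus the number of negative bounces occurring on $H_{\alpha,1}$. The $\mathsf v$-mass is $\mathcal Q_{J,\mathsf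 v}(p)=\prod_{\alpha\in\Phi_J^+}\mathsf v_\alpha^{b_\alpha(p)}\prod_{i\in\{0\}\cup I}(\mathsf q_i-\mathsf q_i^{-1})^{f_i(p)}$. With $\mathrm{end}(p)=v_\ell\sigma$, set $\mathrm{wt}(p)=\mathrm{wt}(\mathrm{end}(p))$ and $\theta^J(p)=\theta^J(\mathrm{end}(p))$. *)

theory Defs
  imports
    "HOL-Analysis.Analysis"
    "HOL-Algebra.Module"
    "HOL-Algebra.QuotRing"
    "HOL-Library.Poly_Mapping"
    "HOL-Computational_Algebra.Group_Closure"
begin

section \<open>Root systems\<close>

text \<open>The Euclidean space \<open>V\<close> is a type \<open>'a :: euclidean_space\<close>, so the rank is \<open>n = DIM('a)\<close>
  and the index set is \<open>I = {1..n}\<close>.\<close>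

record 'a root_datum =
  roots :: "'a set"
  simple :: "nat \<Rightarrow> 'a"

definition coroot :: "'a::euclidean_space \<Rightarrow> 'a" where
  "coroot \<alpha> = (2 / (\<alpha> \<bullet> \<alpha>)) *\<^sub>R \<alpha>"

text \<open>The two closed half spaces bounded by \<open>H\<^bsub>\<alpha>,k\<^esub> = {x. x \<bullet> \<alpha> = k}\<close>.\<close>

definition upper_side :: "'a::euclidean_space \<Rightarrow> int \<Rightarrow> 'a set" where
  "upper_side \<alpha> k = {x. x \<bullet> \<alpha> \<ge> of_int k}"

definition lower_side :: "'a::euclidean_space \<Rightarrow> int \<Rightarrow> 'a set" where
  "lower_side \<alpha> k = {x. x \<bullet> \<alpha> \<le> of_int k}"

definition aff_refl :: "'a::euclidean_space \<Rightarrow> int \<Rightarrow> 'a \<Rightarrow> 'a" where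
  "aff_refl \<alpha> k x = x - (x \<bullet> \<alpha> - of_int k) *\<^sub>R coroot \<alpha>"

definition reduced_roots :: "'a::euclidean_space set \<Rightarrow> bool" where
  "reduced_roots \<Phi> \<longleftrightarrow> (\<forall>\<alpha>\<in>\<Phi>. \<forall>c. c *\<^sub>R \<alpha> \<in> \<Phi> \<longrightarrow> c = 1 \<or> c = -1)"

definition crystallographic_root_system :: "'a::euclidean_space set \<Rightarrow> bool" where
  "crystallographic_root_system \<Phi> \<longleftrightarrow>
     finite \<Phi> \<and> 0 \<notin> \<Phi> \<and> span \<Phi> = UNIV \<and>
     (\<forall>\<alpha>\<in>\<Phi>. aff_refl \<alpha> 0 ` \<Phi> = \<Phi>) \<and>
     (\<forall>\<alpha>\<in>\<Phi>. \<forall>\<beta>\<in>\<Phi>. \<beta> \<bullet> coroot \<alpha> \<in> \<int>)"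

definition irreducible_roots :: "'a::euclidean_space set \<Rightarrow> bool" where
  "irreducible_roots \<Phi> \<longleftrightarrow> \<Phi> \<noteq> {} \<and>
     \<not> (\<exists>A B. A \<noteq> {} \<and> B \<noteq> {} \<and> A \<inter> B = {} \<and> A \<union> B = \<Phi> \<and> (\<forall>a\<in>A. \<forall>b\<in>B. a \<bullet> b = 0))"

definition simple_cone :: "'a::euclidean_space root_datum \<Rightarrow> 'a set" where
  "simple_cone D = {\<Sum>i\<in>{1..DIM('a)}. of_nat (c i) *\<^sub>R simple D i | c :: nat \<Rightarrow> nat. True}"

definition pos_roots :: "'a::euclidean_space root_datum \<Rightarrow> 'a set" where
  "pos_roots D = roots D \<inter> simple_cone D"

definition simple_system :: "'a::euclidean_space root_datum \<Rightarrow> bool" where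
  "simple_system D \<longleftrightarrow>
     inj_on (simple D) {1..DIM('a)} \<and> independent (simple D ` {1..DIM('a)}) \<and>
     simple D ` {1..DIM('a)} \<subseteq> roots D \<and>
     (\<forall>\<beta>\<in>roots D. \<beta> \<in> simple_cone D \<or> - \<beta> \<in> simple_cone D)"

text \<open>The standard coordinates of type \<open>BC\<^sub>n\<close>; the identification of \<open>V\<close> with \<open>\<real>\<^sup>n\<close> is the
  choice of an orthonormal basis \<open>e 1, \<dots>, e n\<close>.\<close>

definition standard_BC :: "'a::euclidean_space root_datum \<Rightarrow> bool" where
  "standard_BC D \<longleftrightarrow>
     (\<exists>e :: nat \<Rightarrow> 'a.
        (\<forall>i\<in>{1..DIM('a)}. \<forall>j\<in>{1..DIM('a)}. e i \<bullet> e j = (if i = j then 1 else 0)) \<and>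
        (\<forall>j\<in>{1..<DIM('a)}. simple D j = e j - e (Suc j)) \<and>
        simple D (DIM('a)) = e (DIM('a)) \<and>
        pos_roots D =
          {e i + e j | i j. 1 \<le> i \<and> i < j \<and> j \<le> DIM('a)} \<union>
          {e i - e j | i j. 1 \<le> i \<and> i < j \<and> j \<le> DIM('a)} \<union>
          {e k | k. k \<in> {1..DIM('a)}} \<union>
          {2 *\<^sub>R e k | k. k \<in> {1..DIM('a)}})"

text \<open>In the reduced case no labelling of the simple roots is singled out: all notions below are
  insensitive to it. In the non-reduced case the label \<open>n\<close> does matter, and \<open>standard_BC\<close> fixes it.\<close>

definition irreducible_root_datum :: "'a::euclidean_space root_datum \<Rightarrow> bool" where
  "irreducible_root_datum D \<longleftrightarrow>
     crystallographic_root_system (roots D) \<and> irreducible_roots (roots D) \<and> simple_system D \<and>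
     (\<not> reduced_roots (roots D) \<longrightarrow> standard_BC D)"

definition highest_root :: "'a::euclidean_space root_datum \<Rightarrow> 'a" where
  "highest_root D = (THE \<phi>. \<phi> \<in> roots D \<and> (\<forall>\<beta>\<in>roots D. \<phi> - \<beta> \<in> simple_cone D))"

section \<open>The extended affine Weyl group\<close>

text \<open>Elements of \<open>P \<rtimes> W\<^sub>0\<close> are affine maps of \<open>V\<close>, and the product is composition.\<close>

definition fund_coweight :: "'a::euclidean_space root_datum \<Rightarrow> nat \<Rightarrow> 'a" where
  "fund_coweight D i =
     (THE \<omega>. \<forall>j\<in>{1..DIM('a)}. \<omega> \<bullet> simple D j = (if i = j then 1 else 0))"

definition coweights :: "'a::euclidean_space root_datum \<Rightarrow> 'a set" where
  "coweights D = group_closure (fund_coweight D ` {1..DIM('a)})"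

definition srefl :: "'a::euclidean_space root_datum \<Rightarrow> nat \<Rightarrow> 'a \<Rightarrow> 'a" where
  "srefl D i = (if i = 0 then aff_refl (highest_root D) 1 else aff_refl (simple D i) 0)"

definition word_prod :: "'a::euclidean_space root_datum \<Rightarrow> nat list \<Rightarrow> 'a \<Rightarrow> 'a" where
  "word_prod D js = foldr (\<lambda>i f. srefl D i \<circ> f) js id"

text \<open>The generators are involutions, so the group they generate consists of the products of words.
  For \<open>K = {0..n}\<close> this is the affine Weyl group \<open>Q \<rtimes> W\<^sub>0\<close>.\<close>

definition gen_group :: "'a::euclidean_space root_datum \<Rightarrow> nat set \<Rightarrow> ('a \<Rightarrow> 'a) set" where
  "gen_group D K = word_prod D ` lists K"

abbreviation weyl :: "'a::euclidean_space root_datum \<Rightarrow> ('a \<Rightarrow> 'a) set" where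
  "weyl D \<equiv> gen_group D {1..DIM('a)}"

abbreviation affine_weyl :: "'a::euclidean_space root_datum \<Rightarrow> ('a \<Rightarrow> 'a) set" where
  "affine_weyl D \<equiv> gen_group D {0..DIM('a)}"

definition ext_weyl :: "'a::euclidean_space root_datum \<Rightarrow> ('a \<Rightarrow> 'a) set" where
  "ext_weyl D = {(+) \<mu> \<circ> u | \<mu> u. \<mu> \<in> coweights D \<and> u \<in> weyl D}"

definition wt :: "'a::euclidean_space root_datum \<Rightarrow> ('a \<Rightarrow> 'a) \<Rightarrow> 'a" where
  "wt D w = (THE \<mu>. \<mu> \<in> coweights D \<and> (\<exists>u\<in>weyl D. w = (+) \<mu> \<circ> u))"

definition lin :: "'a::euclidean_space root_datum \<Rightarrow> ('a \<Rightarrow> 'a) \<Rightarrow> 'a \<Rightarrow> 'a" where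
  "lin D w = (THE u. u \<in> weyl D \<and> (\<exists>\<mu>\<in>coweights D. w = (+) \<mu> \<circ> u))"

definition fund_alcove :: "'a::euclidean_space root_datum \<Rightarrow> 'a set" where
  "fund_alcove D = {x. \<forall>\<alpha>\<in>pos_roots D. 0 \<le> x \<bullet> \<alpha> \<and> x \<bullet> \<alpha> \<le> 1}"

definition alcove_stab :: "'a::euclidean_space root_datum \<Rightarrow> ('a \<Rightarrow> 'a) set" where
  "alcove_stab D = {\<sigma> \<in> ext_weyl D. \<sigma> ` fund_alcove D = fund_alcove D}"

definition coxeter_length :: "'a::euclidean_space root_datum \<Rightarrow> ('a \<Rightarrow> 'a) \<Rightarrow> nat" where
  "coxeter_length D x = (LEAST k. \<exists>js\<in>lists {0..DIM('a)}. word_prod D js = x \<and> length js = k)"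

text \<open>Every element of the extended group factors uniquely as \<open>x\<sigma>\<close> with \<open>x\<close> in the affine Weyl group
  and \<open>\<sigma>\<close> stabilising the fundamental alcove; its length is that of \<open>x\<close>.\<close>

definition ext_length :: "'a::euclidean_space root_datum \<Rightarrow> ('a \<Rightarrow> 'a) \<Rightarrow> nat" where
  "ext_length D w =
     coxeter_length D (THE x. x \<in> affine_weyl D \<and> (\<exists>\<sigma>\<in>alcove_stab D. w = x \<circ> \<sigma>))"

definition reduced_expression ::
  "'a::euclidean_space root_datum \<Rightarrow> ('a \<Rightarrow> 'a) \<Rightarrow> nat list \<Rightarrow> ('a \<Rightarrow> 'a) \<Rightarrow> bool" where
  "reduced_expression D w js \<sigma> \<longleftrightarrow>
     js \<in> lists {0..DIM('a)} \<and> \<sigma> \<in> alcove_stab D \<and>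
     w = word_prod D js \<circ> \<sigma> \<and> length js = ext_length D w"

definition separates ::
  "'a::euclidean_space \<Rightarrow> int \<Rightarrow> 'a set \<Rightarrow> 'a set \<Rightarrow> bool" where
  "separates \<alpha> k A B \<longleftrightarrow>
     A \<subseteq> lower_side \<alpha> k \<and> B \<subseteq> upper_side \<alpha> k \<or> A \<subseteq> upper_side \<alpha> k \<and> B \<subseteq> lower_side \<alpha> k"

text \<open>\<open>sep_wall D w i \<alpha> k\<close>: \<open>H\<^bsub>\<alpha>,k\<^esub>\<close> is the hyperplane between \<open>w A\<^sub>0\<close> and \<open>w s\<^sub>i A\<^sub>0\<close>. In type \<open>BC\<^sub>n\<close>
  the pairs \<open>(\<alpha>, k)\<close> and \<open>(2\<alpha>, 2k)\<close> may describe the same hyperplane.\<close>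

definition sep_wall ::
  "'a::euclidean_space root_datum \<Rightarrow> ('a \<Rightarrow> 'a) \<Rightarrow> nat \<Rightarrow> 'a \<Rightarrow> int \<Rightarrow> bool" where
  "sep_wall D w i \<alpha> k \<longleftrightarrow>
     \<alpha> \<in> pos_roots D \<and> separates \<alpha> k (w ` fund_alcove D) ((w \<circ> srefl D i) ` fund_alcove D)"

definition pos_crossing :: "'a::euclidean_space root_datum \<Rightarrow> ('a \<Rightarrow> 'a) \<Rightarrow> nat \<Rightarrow> bool" where
  "pos_crossing D w i \<longleftrightarrow>
     (\<exists>\<alpha> k. sep_wall D w i \<alpha> k \<and> (w \<circ> srefl D i) ` fund_alcove D \<subseteq> upper_side \<alpha> k)"

definition neg_crossing :: "'a::euclidean_space root_datum \<Rightarrow> ('a \<Rightarrow> 'a) \<Rightarrow> nat \<Rightarrow> bool" where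
  "neg_crossing D w i \<longleftrightarrow>
     (\<exists>\<alpha> k. sep_wall D w i \<alpha> k \<and> (w \<circ> srefl D i) ` fund_alcove D \<subseteq> lower_side \<alpha> k)"

section \<open>Objects attached to a subset \<open>J\<close> of \<open>I\<close>\<close>

definition parab_roots :: "'a::euclidean_space root_datum \<Rightarrow> nat set \<Rightarrow> 'a set" where
  "parab_roots D J = roots D \<inter> span (simple D ` J)"

definition parab_pos_roots :: "'a::euclidean_space root_datum \<Rightarrow> nat set \<Rightarrow> 'a set" where
  "parab_pos_roots D J = parab_roots D J \<inter> pos_roots D"

definition parab_coroot_lattice :: "'a::euclidean_space root_datum \<Rightarrow> nat set \<Rightarrow> 'a set" where
  "parab_coroot_lattice D J = group_closure (coroot ` parab_roots D J)"

text \<open>On \<open>W\<^sub>0\<close> the length of the affine Weyl group restricts to the usual one.\<close>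

definition min_reps :: "'a::euclidean_space root_datum \<Rightarrow> nat set \<Rightarrow> ('a \<Rightarrow> 'a) set" where
  "min_reps D J = {u \<in> weyl D. \<forall>y\<in>gen_group D J. ext_length D u \<le> ext_length D (y \<circ> u)}"

definition theta_up ::
  "'a::euclidean_space root_datum \<Rightarrow> nat set \<Rightarrow> ('a \<Rightarrow> 'a) \<Rightarrow> 'a \<Rightarrow> 'a" where
  "theta_up D J w = (THE x. x \<in> min_reps D J \<and> (\<exists>y\<in>gen_group D J. lin D w = y \<circ> x))"

definition J_alcove :: "'a::euclidean_space root_datum \<Rightarrow> nat set \<Rightarrow> 'a set" where
  "J_alcove D J = {x. \<forall>\<alpha>\<in>parab_pos_roots D J. 0 \<le> x \<bullet> \<alpha> \<and> x \<bullet> \<alpha> \<le> 1}"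

definition alcoves_in :: "'a::euclidean_space root_datum \<Rightarrow> nat set \<Rightarrow> ('a \<Rightarrow> 'a) set" where
  "alcoves_in D J = {w \<in> ext_weyl D. w ` fund_alcove D \<subseteq> J_alcove D J}"

section \<open>The coefficient rings\<close>

text \<open>Laurent polynomials are finitely supported functions on exponent vectors, multiplied by
  convolution. \<open>laurent_ring A X\<close> has coefficients in \<open>A\<close> and variables indexed by \<open>X\<close>.\<close>

type_synonym 'r laurent = "(nat \<Rightarrow>\<^sub>0 int) \<Rightarrow>\<^sub>0 'r"

definition laurent_ring :: "'r::comm_ring_1 set \<Rightarrow> nat set \<Rightarrow> 'r laurent ring" where
  "laurent_ring A X =
     \<lparr>carrier = {p. range (Poly_Mapping.lookup p) \<subseteq> A \<and> (\<forall>a\<in>Poly_Mapping.keys p. Poly_Mapping.keys a \<subseteq> X)},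
      mult = (*), one = 1, zero = 0, add = (+)\<rparr>"

text \<open>Parameters of conjugate generators coincide, so there is one variable for each conjugacy
  class, named by the least index occurring in it.\<close>

definition class_rep :: "'a::euclidean_space root_datum \<Rightarrow> nat \<Rightarrow> nat" where
  "class_rep D i =
     (LEAST j. j \<le> DIM('a) \<and> (\<exists>x\<in>ext_weyl D. x \<circ> srefl D i = srefl D j \<circ> x))"

definition R_ring :: "'a::euclidean_space root_datum \<Rightarrow> int laurent ring" where
  "R_ring D = laurent_ring UNIV (class_rep D ` {0..DIM('a)})"

definition qvar :: "'a::euclidean_space root_datum \<Rightarrow> nat \<Rightarrow> int laurent" where
  "qvar D i = Poly_Mapping.single (Poly_Mapping.single (class_rep D i) 1) 1"

definition qdiff :: "'a::euclidean_space root_datum \<Rightarrow> nat \<Rightarrow> int laurent" where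
  "qdiff D i = qvar D i \<ominus>\<^bsub>R_ring D\<^esub> (inv\<^bsub>R_ring D\<^esub> qvar D i)"

definition zeta_ring :: "'a::euclidean_space root_datum \<Rightarrow> int laurent laurent ring" where
  "zeta_ring D = laurent_ring (carrier (R_ring D)) {1..DIM('a)}"

definition zeta :: "'a::euclidean_space root_datum \<Rightarrow> 'a \<Rightarrow> int laurent laurent" where
  "zeta D \<mu> = Poly_Mapping.single
     (THE a. Poly_Mapping.keys a \<subseteq> {1..DIM('a)} \<and>
        \<mu> = (\<Sum>i\<in>{1..DIM('a)}. of_int (Poly_Mapping.lookup a i) *\<^sub>R fund_coweight D i)) 1"

definition zeta_ideal ::
  "'a::euclidean_space root_datum \<Rightarrow> nat set \<Rightarrow> int laurent laurent set" where
  "zeta_ideal D J =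
     Idl\<^bsub>zeta_ring D\<^esub> ((\<lambda>\<gamma>. zeta D \<gamma> \<ominus>\<^bsub>zeta_ring D\<^esub> \<one>\<^bsub>zeta_ring D\<^esub>) ` parab_coroot_lattice D J)"

definition zetaJ_ring ::
  "'a::euclidean_space root_datum \<Rightarrow> nat set \<Rightarrow> int laurent laurent set ring" where
  "zetaJ_ring D J = zeta_ring D Quot zeta_ideal D J"

definition zetaJ ::
  "'a::euclidean_space root_datum \<Rightarrow> nat set \<Rightarrow> 'a \<Rightarrow> int laurent laurent set" where
  "zetaJ D J \<mu> = zeta_ideal D J +>\<^bsub>zeta_ring D\<^esub> zeta D \<mu>"

text \<open>The structure map of the \<open>R\<close>-algebra \<open>R[\<zeta>\<^sub>J]\<close>.\<close>

definition R_to_zetaJ ::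
  "'a::euclidean_space root_datum \<Rightarrow> nat set \<Rightarrow> int laurent \<Rightarrow> int laurent laurent set" where
  "R_to_zetaJ D J r = zeta_ideal D J +>\<^bsub>zeta_ring D\<^esub> Poly_Mapping.single 0 r"

section \<open>Parameter systems, the Hecke algebra and its modules\<close>

definition parameter_system ::
  "'a::euclidean_space root_datum \<Rightarrow> nat set \<Rightarrow> ('a \<Rightarrow> int laurent) \<Rightarrow> bool" where
  "parameter_system D J v \<longleftrightarrow>
     (\<forall>\<alpha>\<in>parab_roots D J. v \<alpha> \<in> Units (R_ring D)) \<and>
     (\<forall>\<alpha>\<in>parab_roots D J. \<forall>y\<in>gen_group D J. v (y \<alpha>) = v \<alpha>) \<and>
     (\<forall>j\<in>J. 2 *\<^sub>R simple D j \<notin> parab_roots D J \<longrightarrow>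
        v (simple D j) \<in> {qvar D j, \<ominus>\<^bsub>R_ring D\<^esub> (inv\<^bsub>R_ring D\<^esub> qvar D j)}) \<and>
     (\<not> reduced_roots (parab_roots D J) \<longrightarrow>
        v (2 *\<^sub>R simple D (DIM('a))) \<in> {qvar D 0, \<ominus>\<^bsub>R_ring D\<^esub> (inv\<^bsub>R_ring D\<^esub> qvar D 0)} \<and>
        v (simple D (DIM('a))) \<otimes>\<^bsub>R_ring D\<^esub> v (2 *\<^sub>R simple D (DIM('a)))
          \<in> {qvar D (DIM('a)), \<ominus>\<^bsub>R_ring D\<^esub> (inv\<^bsub>R_ring D\<^esub> qvar D (DIM('a)))})"

text \<open>The affine root \<open>\<alpha> + k\<delta>\<close> is the pair \<open>(\<alpha>, k)\<close>.\<close>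

definition affine_simple :: "'a::euclidean_space root_datum \<Rightarrow> nat \<Rightarrow> 'a \<times> int" where
  "affine_simple D i = (if i = 0 then (- highest_root D, 1) else (simple D i, 0))"

definition affine_param ::
  "'a::euclidean_space root_datum \<Rightarrow> nat set \<Rightarrow> ('a \<Rightarrow> int laurent) \<Rightarrow> 'a \<times> int \<Rightarrow> int laurent" where
  "affine_param D J v = (\<lambda>(\<beta>, k). if \<beta> \<in> parab_roots D J then v \<beta> else \<one>\<^bsub>R_ring D\<^esub>)"

text \<open>The scalar \<open>v\<^bsub>u\<alpha>\<^sub>i\<^esub> v\<^bsub>2u\<alpha>\<^sub>i\<^esub>\<close>.\<close>

definition bounce_scalar ::
  "'a::euclidean_space root_datum \<Rightarrow> nat set \<Rightarrow> ('a \<Rightarrow> int laurent) \<Rightarrow> ('a \<Rightarrow> 'a) \<Rightarrow> nat \<Rightarrow> int laurent"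
  where
  "bounce_scalar D J v u i =
     (let (\<beta>, k) = affine_simple D i in
        affine_param D J v (u \<beta>, k) \<otimes>\<^bsub>R_ring D\<^esub> affine_param D J v (2 *\<^sub>R u \<beta>, 2 * k))"

text \<open>\<open>H\<close> is the Hecke algebra with basis \<open>T\<close>. The locale \<open>algebra\<close> of HOL-Algebra is not
  applicable since it demands a commutative multiplication.\<close>

definition hecke_algebra ::
  "'a::euclidean_space root_datum \<Rightarrow> (int laurent, 'h) module \<Rightarrow> (('a \<Rightarrow> 'a) \<Rightarrow> 'h) \<Rightarrow> bool" where
  "hecke_algebra D H T \<longleftrightarrow>
     ring H \<and> module (R_ring D) H \<and>
     (\<forall>r\<in>carrier (R_ring D). \<forall>x\<in>carrier H. \<forall>y\<in>carrier H.
        (r \<odot>\<^bsub>H\<^esub> x) \<otimes>\<^bsub>H\<^esub> y = r \<odot>\<^bsub>H\<^esub> (x \<otimes>\<^bsub>H\<^esub> y) \<and>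
        x \<otimes>\<^bsub>H\<^esub> (r \<odot>\<^bsub>H\<^esub> y) = r \<odot>\<^bsub>H\<^esub> (x \<otimes>\<^bsub>H\<^esub> y)) \<and>
     T \<in> ext_weyl D \<rightarrow> carrier H \<and>
     (\<forall>h\<in>carrier H. \<exists>!c. c \<in> ext_weyl D \<rightarrow>\<^sub>E carrier (R_ring D) \<and>
        finite {w \<in> ext_weyl D. c w \<noteq> \<zero>\<^bsub>R_ring D\<^esub>} \<and>
        h = (\<Oplus>\<^bsub>H\<^esub>w\<in>{w \<in> ext_weyl D. c w \<noteq> \<zero>\<^bsub>R_ring D\<^esub>}. c w \<odot>\<^bsub>H\<^esub> T w)) \<and>
     (\<forall>w\<in>ext_weyl D. \<forall>x\<in>ext_weyl D.
        ext_length D (w \<circ> x) = ext_length D w + ext_length D x \<longrightarrow>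
        T w \<otimes>\<^bsub>H\<^esub> T x = T (w \<circ> x)) \<and>
     (\<forall>w\<in>ext_weyl D. \<forall>i\<in>{0..DIM('a)}.
        ext_length D (w \<circ> srefl D i) + 1 = ext_length D w \<longrightarrow>
        T w \<otimes>\<^bsub>H\<^esub> T (srefl D i) = T (w \<circ> srefl D i) \<oplus>\<^bsub>H\<^esub> qdiff D i \<odot>\<^bsub>H\<^esub> T w)"

text \<open>A right \<open>H\<close>-module over \<open>R[\<zeta>\<^sub>J]\<close>: an \<open>R[\<zeta>\<^sub>J]\<close>-module \<open>M\<close> on which \<open>H\<close> acts from the right by
  \<open>R[\<zeta>\<^sub>J]\<close>-linear maps, compatibly with the \<open>R\<close>-algebra structures.\<close>

definition right_hecke_module ::
  "'a::euclidean_space root_datum \<Rightarrow> nat set \<Rightarrow> (int laurent, 'h) module \<Rightarrow>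
   (int laurent laurent set, 'm) module \<Rightarrow> ('m \<Rightarrow> 'h \<Rightarrow> 'm) \<Rightarrow> bool" where
  "right_hecke_module D J H M act \<longleftrightarrow>
     module (zetaJ_ring D J) M \<and>
     (\<forall>x\<in>carrier M. \<forall>h\<in>carrier H. act x h \<in> carrier M) \<and>
     (\<forall>x\<in>carrier M. \<forall>y\<in>carrier M. \<forall>h\<in>carrier H.
        act (x \<oplus>\<^bsub>M\<^esub> y) h = act x h \<oplus>\<^bsub>M\<^esub> act y h) \<and>
     (\<forall>c\<in>carrier (zetaJ_ring D J). \<forall>x\<in>carrier M. \<forall>h\<in>carrier H.
        act (c \<odot>\<^bsub>M\<^esub> x) h = c \<odot>\<^bsub>M\<^esub> act x h) \<and>
     (\<forall>x\<in>carrier M. \<forall>g\<in>carrier H. \<forall>h\<in>carrier H.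
        act x (g \<oplus>\<^bsub>H\<^esub> h) = act x g \<oplus>\<^bsub>M\<^esub> act x h) \<and>
     (\<forall>x\<in>carrier M. \<forall>r\<in>carrier (R_ring D). \<forall>h\<in>carrier H.
        act x (r \<odot>\<^bsub>H\<^esub> h) = R_to_zetaJ D J r \<odot>\<^bsub>M\<^esub> act x h) \<and>
     (\<forall>x\<in>carrier M. \<forall>g\<in>carrier H. \<forall>h\<in>carrier H. act x (g \<otimes>\<^bsub>H\<^esub> h) = act (act x g) h) \<and>
     (\<forall>x\<in>carrier M. act x \<one>\<^bsub>H\<^esub> = x)"

definition lin_comb ::
  "'a::euclidean_space root_datum \<Rightarrow> nat set \<Rightarrow> ('s, 'm) module \<Rightarrow> (('a \<Rightarrow> 'a) \<Rightarrow> 'm) \<Rightarrow>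
   (('a \<Rightarrow> 'a) \<Rightarrow> 's) \<Rightarrow> 'm" where
  "lin_comb D J M m c = (\<Oplus>\<^bsub>M\<^esub>u\<in>min_reps D J. c u \<odot>\<^bsub>M\<^esub> m u)"

definition standard_module ::
  "'a::euclidean_space root_datum \<Rightarrow> nat set \<Rightarrow> ('a \<Rightarrow> int laurent) \<Rightarrow>
   (int laurent, 'h) module \<Rightarrow> (('a \<Rightarrow> 'a) \<Rightarrow> 'h) \<Rightarrow>
   (int laurent laurent set, 'm) module \<Rightarrow> ('m \<Rightarrow> 'h \<Rightarrow> 'm) \<Rightarrow> (('a \<Rightarrow> 'a) \<Rightarrow> 'm) \<Rightarrow> bool" where
  "standard_module D J v H T M act m \<longleftrightarrow>
     right_hecke_module D J H M act \<and>
     m \<in> min_reps D J \<rightarrow> carrier M \<and>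
     (\<forall>x\<in>carrier M. \<exists>!c. c \<in> min_reps D J \<rightarrow>\<^sub>E carrier (zetaJ_ring D J) \<and> x = lin_comb D J M m c) \<and>
     (\<forall>u\<in>min_reps D J. \<forall>\<sigma>\<in>alcove_stab D.
        act (m u) (T \<sigma>) = zetaJ D J (wt D (u \<circ> \<sigma>)) \<odot>\<^bsub>M\<^esub> m (theta_up D J (u \<circ> \<sigma>))) \<and>
     (\<forall>u\<in>min_reps D J. \<forall>i\<in>{0..DIM('a)}.
        (pos_crossing D u i \<and> u \<circ> srefl D i \<in> alcoves_in D J \<longrightarrow>
           act (m u) (T (srefl D i)) =
             zetaJ D J (wt D (u \<circ> srefl D i)) \<odot>\<^bsub>M\<^esub> m (theta_up D J (u \<circ> srefl D i))) \<and>
        (neg_crossing D u i \<and> u \<circ> srefl D i \<in> alcoves_in D J \<longrightarrow>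
           act (m u) (T (srefl D i)) =
             zetaJ D J (wt D (u \<circ> srefl D i)) \<odot>\<^bsub>M\<^esub> m (theta_up D J (u \<circ> srefl D i))
             \<oplus>\<^bsub>M\<^esub> R_to_zetaJ D J (qdiff D i) \<odot>\<^bsub>M\<^esub> m u) \<and>
        (u \<circ> srefl D i \<notin> alcoves_in D J \<longrightarrow>
           act (m u) (T (srefl D i)) = R_to_zetaJ D J (bounce_scalar D J v u i) \<odot>\<^bsub>M\<^esub> m u))"

definition matrix_entry ::
  "'a::euclidean_space root_datum \<Rightarrow> nat set \<Rightarrow> (int laurent laurent set, 'm) module \<Rightarrow>
   ('m \<Rightarrow> 'h \<Rightarrow> 'm) \<Rightarrow> (('a \<Rightarrow> 'a) \<Rightarrow> 'm) \<Rightarrow> 'h \<Rightarrow> ('a \<Rightarrow> 'a) \<Rightarrow> ('a \<Rightarrow> 'a) \<Rightarrow>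
   int laurent laurent set" where
  "matrix_entry D J M act m h u x =
     (THE c. c \<in> min_reps D J \<rightarrow>\<^sub>E carrier (zetaJ_ring D J) \<and> act (m u) h = lin_comb D J M m c) x"

section \<open>Folded alcove paths\<close>

text \<open>A path \<open>(v\<^sub>0, \<dots>, v\<^sub>l, v\<^sub>l\<sigma>)\<close> is a list of length \<open>l + 2\<close>. Positions in \<open>js\<close> are counted from \<open>0\<close>,
  so the step from \<open>p ! k\<close> to \<open>p ! Suc k\<close> has type \<open>js ! k\<close>.\<close>

definition folded_paths ::
  "'a::euclidean_space root_datum \<Rightarrow> nat set \<Rightarrow> nat list \<Rightarrow> ('a \<Rightarrow> 'a) \<Rightarrow> ('a \<Rightarrow> 'a) \<Rightarrow>
   ('a \<Rightarrow> 'a) list set" where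
  "folded_paths D J js \<sigma> x =
     {p. length p = length js + 2 \<and>
         p ! 0 = x \<and>
         p ! (length js + 1) = p ! length js \<circ> \<sigma> \<and>
         (\<forall>k \<le> length js + 1. p ! k \<in> alcoves_in D J) \<and>
         (\<forall>k < length js. p ! Suc k \<in> {p ! k, p ! k \<circ> srefl D (js ! k)}) \<and>
         (\<forall>k < length js. p ! Suc k = p ! k \<and> p ! k \<circ> srefl D (js ! k) \<in> alcoves_in D J \<longrightarrow>
            neg_crossing D (p ! k) (js ! k))}"

definition fold_count ::
  "'a::euclidean_space root_datum \<Rightarrow> nat set \<Rightarrow> nat list \<Rightarrow> ('a \<Rightarrow> 'a) list \<Rightarrow> nat \<Rightarrow> nat" where
  "fold_count D J js p i =
     card {k. k < length js \<and> js ! k = i \<and> p ! Suc k = p ! k \<and>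
              p ! k \<circ> srefl D i \<in> alcoves_in D J}"

definition bounce_at ::
  "'a::euclidean_space root_datum \<Rightarrow> nat set \<Rightarrow> nat list \<Rightarrow> ('a \<Rightarrow> 'a) list \<Rightarrow> nat \<Rightarrow> bool" where
  "bounce_at D J js p k \<longleftrightarrow>
     k < length js \<and> p ! Suc k = p ! k \<and> p ! k \<circ> srefl D (js ! k) \<notin> alcoves_in D J"

definition pos_bounce_on ::
  "'a::euclidean_space root_datum \<Rightarrow> nat set \<Rightarrow> nat list \<Rightarrow> ('a \<Rightarrow> 'a) list \<Rightarrow> nat \<Rightarrow> 'a \<Rightarrow> int \<Rightarrow> bool"
  where
  "pos_bounce_on D J js p k \<alpha> c \<longleftrightarrow>
     bounce_at D J js p k \<and> sep_wall D (p ! k) (js ! k) \<alpha> c \<and>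
     (p ! k) ` fund_alcove D \<subseteq> upper_side \<alpha> c"

definition neg_bounce_on ::
  "'a::euclidean_space root_datum \<Rightarrow> nat set \<Rightarrow> nat list \<Rightarrow> ('a \<Rightarrow> 'a) list \<Rightarrow> nat \<Rightarrow> 'a \<Rightarrow> int \<Rightarrow> bool"
  where
  "neg_bounce_on D J js p k \<alpha> c \<longleftrightarrow>
     bounce_at D J js p k \<and> sep_wall D (p ! k) (js ! k) \<alpha> c \<and>
     (p ! k) ` fund_alcove D \<subseteq> lower_side \<alpha> c"

text \<open>If \<open>\<alpha>\<close> and \<open>2\<alpha>\<close> are both roots, a bounce on \<open>H\<^bsub>\<alpha>,0\<^esub> = H\<^bsub>2\<alpha>,0\<^esub>\<close> is counted for both of them.\<close>

definition bounce_count ::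
  "'a::euclidean_space root_datum \<Rightarrow> nat set \<Rightarrow> nat list \<Rightarrow> ('a \<Rightarrow> 'a) list \<Rightarrow> 'a \<Rightarrow> nat" where
  "bounce_count D J js p \<alpha> =
     card {k. pos_bounce_on D J js p k \<alpha> 0} + card {k. neg_bounce_on D J js p k \<alpha> 1}"

definition mass ::
  "'a::euclidean_space root_datum \<Rightarrow> nat set \<Rightarrow> ('a \<Rightarrow> int laurent) \<Rightarrow> nat list \<Rightarrow>
   ('a \<Rightarrow> 'a) list \<Rightarrow> int laurent" where
  "mass D J v js p =
     (\<Otimes>\<^bsub>R_ring D\<^esub>\<alpha>\<in>parab_pos_roots D J. v \<alpha> [^]\<^bsub>R_ring D\<^esub> bounce_count D J js p \<alpha>) \<otimes>\<^bsub>R_ring D\<^esub>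
     (\<Otimes>\<^bsub>R_ring D\<^esub>i\<in>{0..DIM('a)}. qdiff D i [^]\<^bsub>R_ring D\<^esub> fold_count D J js p i)"

end

theory Submission
  imports Defs
begin

text \<open>For an alcove \<open>v\<close> of the strip \<open>\<A>\<^sub>J\<close> put \<open>m\<^sub>v = \<zeta>\<^sub>J\<^bsup>wt(v)\<^esup> m\<^bsub>\<theta>\<^sup>J(v)\<^esub>\<close>. The theorem rests on one fact,
  \<open>act_T_srefl\<close>: the formulas that define the action of \<open>T\<^sub>i\<close> on the basis vectors \<open>m\<^sub>u\<close>, \<open>u \<in> W\<^sup>J\<close>, hold
  verbatim for all these vectors \<open>m\<^sub>v\<close>. Each \<open>T\<^sub>i\<close> then either moves \<open>m\<^sub>v\<close> to the neighbour \<open>m\<^bsub>vs\<^sub>i\<^esub>\<close>, or keeps it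
  and multiplies it by a scalar, and these alternatives are exactly the steps allowed in a positively folded
  path. Reading \<open>T\<^sub>w = T\<^bsub>i\<^sub>1\<^esub> \<cdots> T\<^bsub>i\<^sub>l\<^esub> T\<^sub>\<sigma>\<close> from the left, \<open>m\<^sub>u \<cdot> T\<^sub>w\<close> becomes the sum of \<open>\<Q>(p) m\<^bsub>end(p)\<^esub>\<close> over the
  paths from \<open>u\<close> (\<open>act_path_sum\<close>), and the matrix entries result from grouping the paths by \<open>\<theta>\<^sup>J(p)\<close>.

  The formulas propagate from \<open>u = \<theta>\<^sup>J(v)\<close> to \<open>v\<close> because the linear part of \<open>v\<close> is \<open>yu\<close> with \<open>y \<in> W\<^sub>J\<close>. The
  element \<open>y\<close> permutes \<open>\<Phi>\<^sub>J\<close> and permutes the positive roots outside \<open>\<Phi>\<^sub>J\<close>, so the crossings at \<open>u\<close> and at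
  \<open>v\<close> leave the strip simultaneously and otherwise have the same sign (\<open>theta_step\<close>). It moves weights by elements
  of \<open>Q\<^sub>J\<close>, on which \<open>\<zeta>\<^sub>J\<close> is trivial (\<open>theta_up_comp\<close>, \<open>zetaJ_cong\<close>), and it leaves the parameters unchanged. That the
  scalar \<open>v\<^bsub>u\<alpha>\<^sub>i\<^esub>v\<^bsub>2u\<alpha>\<^sub>i\<^esub>\<close> of a bounce is what the exponents \<open>b\<^sub>\<alpha>(p)\<close> record is \<open>bounce_product\<close>; in type \<open>BC\<close> this
  depends on which of the parallel roots \<open>\<alpha>\<close>, \<open>2\<alpha>\<close> describe the wall at level \<open>0\<close> or \<open>1\<close>.

  All positions relative to hyperplanes are read off at one interior point \<open>x0\<close> of \<open>A\<^sub>0\<close>. Up to positive scalars,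
  the \<open>i\<close>-th simple affine root is the only affine root that is positive on \<open>A\<^sub>0\<close> and negative on \<open>s\<^sub>iA\<^sub>0\<close>
  (\<open>simple_wall\<close>); for \<open>i = 0\<close> this needs the highest root, whose existence follows from irreducibility. The
  exchange condition follows, and with it the facts about lengths in use: the affine Weyl group acts freely on the
  alcoves, so that lengths in the extended group are well defined and \<open>T\<^sub>w\<close> factors along a reduced expression,
  and every coset of \<open>W\<^sub>J\<close> has exactly one minimal representative.\<close>

section \<open>Reflections\<close>

lemma aff_refl_self: "\<beta> \<noteq> 0 \<Longrightarrow> aff_refl \<beta> 0 \<beta> = - \<beta>"
  by (simp add: aff_refl_def coroot_def scaleR_2)

lemma aff_refl_0: "aff_refl \<beta> 0 x = x - (x \<bullet> coroot \<beta>) *\<^sub>R \<beta>"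
  by (simp add: aff_refl_def coroot_def mult.commute)

lemma coroot_sign:
  assumes "\<beta> \<noteq> 0"
  shows "x \<bullet> coroot \<beta> > 0 \<longleftrightarrow> x \<bullet> \<beta> > 0" "x \<bullet> coroot \<beta> \<ge> 0 \<longleftrightarrow> x \<bullet> \<beta> \<ge> 0"
    "x \<bullet> coroot \<beta> < 0 \<longleftrightarrow> x \<bullet> \<beta> < 0" "x \<bullet> coroot \<beta> \<le> 0 \<longleftrightarrow> x \<bullet> \<beta> \<le> 0"
proof -
  have "2 / (\<beta> \<bullet> \<beta>) > 0" "x \<bullet> coroot \<beta> = 2 / (\<beta> \<bullet> \<beta>) * (x \<bullet> \<beta>)"
    using assms by (auto simp: coroot_def)
  moreover have "c > 0 \<Longrightarrow> (c * y > 0 \<longleftrightarrow> y > 0) \<and> (c * y \<ge> 0 \<longleftrightarrow> y \<ge> 0) \<and> (c * y < 0 \<longleftrightarrow> y < 0)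
      \<and> (c * y \<le> 0 \<longleftrightarrow> y \<le> 0)" for c y :: real
    by (auto simp: zero_less_mult_iff zero_le_mult_iff mult_less_0_iff mult_le_0_iff)
  ultimately show "x \<bullet> coroot \<beta> > 0 \<longleftrightarrow> x \<bullet> \<beta> > 0" "x \<bullet> coroot \<beta> \<ge> 0 \<longleftrightarrow> x \<bullet> \<beta> \<ge> 0"
    "x \<bullet> coroot \<beta> < 0 \<longleftrightarrow> x \<bullet> \<beta> < 0" "x \<bullet> coroot \<beta> \<le> 0 \<longleftrightarrow> x \<bullet> \<beta> \<le> 0" by metis+
qed

lemma coroot_scale: "c \<noteq> 0 \<Longrightarrow> coroot (c *\<^sub>R x) = (1 / c) *\<^sub>R coroot x"
  by (simp add: coroot_def divide_simps)

lemma coroot_minus: "coroot (- x) = - coroot x"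
  by (simp add: coroot_def)

lemma aff_refl_invol: "\<beta> \<noteq> 0 \<Longrightarrow> aff_refl \<beta> k (aff_refl \<beta> k x) = x"
proof -
  assume "\<beta> \<noteq> 0"
  then have "coroot \<beta> \<bullet> \<beta> = 2" by (simp add: coroot_def)
  then have "aff_refl \<beta> k (aff_refl \<beta> k x)
      = x - ((x \<bullet> \<beta> - k) + (x \<bullet> \<beta> - (x \<bullet> \<beta> - k) * 2 - k)) *\<^sub>R coroot \<beta>"
    unfolding scaleR_add_left by (simp add: aff_refl_def inner_diff_left)
  then show ?thesis by simp
qed

section \<open>Simple roots and the dual basis\<close>

locale irr_root_datum =
  fixes D :: "'a::euclidean_space root_datum"
  assumes irr: "irreducible_root_datum D"
begin

abbreviation \<Phi> :: "'a set" where "\<Phi> \<equiv> roots D"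
abbreviation \<alpha> :: "nat \<Rightarrow> 'a" where "\<alpha> \<equiv> simple D"
abbreviation \<omega> :: "nat \<Rightarrow> 'a" where "\<omega> \<equiv> fund_coweight D"
abbreviation cone :: "'a set" where "cone \<equiv> simple_cone D"
abbreviation \<Phi>p :: "'a set" where "\<Phi>p \<equiv> pos_roots D"

(* keeps the index set in the form {1..n} *)
declare One_nat_def [simp del]

lemma crystallographic: "crystallographic_root_system \<Phi>" and irreducible: "irreducible_roots \<Phi>"
  and simple_sys: "simple_system D"
  using irr by (auto simp: irreducible_root_datum_def)

lemma finite_roots: "finite \<Phi>" and zero_notin_roots: "0 \<notin> \<Phi>"
  and span_roots: "span \<Phi> = UNIV"
  using crystallographic by (auto simp: crystallographic_root_system_def)

lemma refl_roots_image: "\<beta> \<in> \<Phi> \<Longrightarrow> aff_refl \<beta> 0 ` \<Phi> = \<Phi>"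
  using crystallographic by (auto simp: crystallographic_root_system_def)

lemma refl_root: "\<beta> \<in> \<Phi> \<Longrightarrow> \<gamma> \<in> \<Phi> \<Longrightarrow> aff_refl \<beta> 0 \<gamma> \<in> \<Phi>"
  using refl_roots_image by blast

lemma coroot_integral: "\<beta> \<in> \<Phi> \<Longrightarrow> \<gamma> \<in> \<Phi> \<Longrightarrow> \<gamma> \<bullet> coroot \<beta> \<in> \<int>"
  using crystallographic by (auto simp: crystallographic_root_system_def)

lemma simple_root: "i \<in> {1..DIM('a)} \<Longrightarrow> \<alpha> i \<in> \<Phi>"
  using simple_sys by (auto simp: simple_system_def)

lemma inj_simple: "inj_on \<alpha> {1..DIM('a)}" and indep_simple: "independent (\<alpha> ` {1..DIM('a)})"
  using simple_sys by (auto simp: simple_system_def)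

lemma root_cases: "\<beta> \<in> \<Phi> \<Longrightarrow> \<beta> \<in> cone \<or> - \<beta> \<in> cone"
  using simple_sys by (auto simp: simple_system_def)

lemma span_simple: "span (\<alpha> ` {1..DIM('a)}) = UNIV"
proof -
  have "card (\<alpha> ` {1..DIM('a)}) = DIM('a)" using inj_simple by (simp add: card_image)
  then have "dim (UNIV :: 'a set) \<le> card (\<alpha> ` {1..DIM('a)})" by simp
  then have "UNIV \<subseteq> span (\<alpha> ` {1..DIM('a)})"
    using card_ge_dim_independent[OF subset_UNIV indep_simple] by blast
  then show ?thesis by blast
qed

lemma orth_simple_zero:
  assumes "\<And>j. j \<in> {1..DIM('a)} \<Longrightarrow> x \<bullet> \<alpha> j = 0"
  shows "x = 0"
proof -
  have "orthogonal x x"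
    by (rule orthogonal_to_span[of x "\<alpha> ` {1..DIM('a)}"])
      (use span_simple assms in \<open>auto simp: orthogonal_def\<close>)
  then show ?thesis by (simp add: orthogonal_def)
qed

lemma fund_coweight_simple:
  assumes "i \<in> {1..DIM('a)}" "j \<in> {1..DIM('a)}"
  shows "\<omega> i \<bullet> \<alpha> j = (if i = j then 1 else 0)"
proof -
  let ?P = "\<lambda>w. \<forall>j\<in>{1..DIM('a)}. w \<bullet> \<alpha> j = (if i = j then 1 else 0)"
  define f where "f = (\<lambda>b. if b = \<alpha> i then 1 else (0::real))"
  obtain g where g: "linear g" "\<And>b. b \<in> \<alpha> ` {1..DIM('a)} \<Longrightarrow> g b = f b"
    using linear_independent_extend[OF indep_simple, of f] by blast
  have P: "?P (adjoint g 1)"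
  proof
    fix j assume j: "j \<in> {1..DIM('a)}"
    have "\<alpha> j \<bullet> adjoint g 1 = g (\<alpha> j)" using adjoint_works[OF g(1), of "\<alpha> j" 1] by simp
    then show "adjoint g 1 \<bullet> \<alpha> j = (if i = j then 1 else 0)"
      using g(2)[of "\<alpha> j"] j assms(1) inj_simple
      by (auto simp: f_def inj_on_eq_iff inner_commute)
  qed
  have "w = adjoint g 1" if "?P w" for w
    using orth_simple_zero[of "w - adjoint g 1"] that P by (simp add: inner_diff_left)
  with P have "\<exists>!w. ?P w" by blast
  from theI'[OF this] show ?thesis using assms(2) unfolding fund_coweight_def by blast
qed

lemma simple_fund_coweight:
  "i \<in> {1..DIM('a)} \<Longrightarrow> j \<in> {1..DIM('a)} \<Longrightarrow> \<alpha> i \<bullet> \<omega> j = (if i = j then 1 else 0)"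
  using fund_coweight_simple[of j i] by (auto simp: inner_commute[of "\<alpha> i"])

lemma simple_expand: "x = (\<Sum>i\<in>{1..DIM('a)}. (x \<bullet> \<omega> i) *\<^sub>R \<alpha> i)"
proof -
  have "x \<in> span (\<alpha> ` {1..DIM('a)})" using span_simple by simp
  then obtain u where u: "x = (\<Sum>v\<in>\<alpha> ` {1..DIM('a)}. u v *\<^sub>R v)" by (auto simp: span_finite)
  then have x: "x = (\<Sum>i\<in>{1..DIM('a)}. u (\<alpha> i) *\<^sub>R \<alpha> i)"
    using inj_simple by (simp add: sum.reindex)
  have "x \<bullet> \<omega> j = u (\<alpha> j)" if "j \<in> {1..DIM('a)}" for j
    using that by (subst x) (simp add: inner_sum_left simple_fund_coweight if_distrib cong: if_cong)
  then show ?thesis using x by simp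
qed

lemma coweight_expand: "x = (\<Sum>i\<in>{1..DIM('a)}. (x \<bullet> \<alpha> i) *\<^sub>R \<omega> i)"
proof -
  have "x - (\<Sum>i\<in>{1..DIM('a)}. (x \<bullet> \<alpha> i) *\<^sub>R \<omega> i) = 0"
    by (rule orth_simple_zero)
      (simp add: inner_diff_left inner_sum_left fund_coweight_simple if_distrib cong: if_cong)
  then show ?thesis by simp
qed

lemma inner_simple_expand: "x \<bullet> y = (\<Sum>i\<in>{1..DIM('a)}. (x \<bullet> \<omega> i) * (\<alpha> i \<bullet> y))"
proof -
  have "x \<bullet> y = (\<Sum>i\<in>{1..DIM('a)}. (x \<bullet> \<omega> i) *\<^sub>R \<alpha> i) \<bullet> y" using simple_expand[of x] by simp
  then show ?thesis by (simp add: inner_sum_left)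
qed

lemma cone_iff: "x \<in> cone \<longleftrightarrow> (\<forall>i\<in>{1..DIM('a)}. x \<bullet> \<omega> i \<in> \<nat>)"
proof
  assume "x \<in> cone"
  then obtain c where x: "x = (\<Sum>i\<in>{1..DIM('a)}. of_nat (c i) *\<^sub>R \<alpha> i)" unfolding simple_cone_def by blast
  have "x \<bullet> \<omega> j = of_nat (c j)" if "j \<in> {1..DIM('a)}" for j
    using that by (subst x) (simp add: inner_sum_left simple_fund_coweight if_distrib cong: if_cong)
  then show "\<forall>i\<in>{1..DIM('a)}. x \<bullet> \<omega> i \<in> \<nat>" by simp
next
  assume *: "\<forall>i\<in>{1..DIM('a)}. x \<bullet> \<omega> i \<in> \<nat>"
  define c where "c i = nat \<lfloor>x \<bullet> \<omega> i\<rfloor>" for i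
  have "x \<bullet> \<omega> i = of_nat (c i)" if "i \<in> {1..DIM('a)}" for i
  proof -
    have "x \<bullet> \<omega> i \<in> \<nat>" using * that by blast
    then show ?thesis by (auto simp: c_def elim!: Nats_cases)
  qed
  then have "x = (\<Sum>i\<in>{1..DIM('a)}. of_nat (c i) *\<^sub>R \<alpha> i)" using simple_expand[of x] by simp
  then show "x \<in> cone" unfolding simple_cone_def by blast
qed

lemma cone_add: "x \<in> cone \<Longrightarrow> y \<in> cone \<Longrightarrow> x + y \<in> cone"
  by (auto simp: cone_iff inner_add_left)

lemma cone_coord_nonneg: "x \<in> cone \<Longrightarrow> i \<in> {1..DIM('a)} \<Longrightarrow> x \<bullet> \<omega> i \<ge> 0"
  unfolding cone_iff by (metis Nats_cases of_nat_0_le_iff)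

lemma cone_antisym: "x \<in> cone \<Longrightarrow> - x \<in> cone \<Longrightarrow> x = 0"
proof -
  assume "x \<in> cone" "- x \<in> cone"
  then have "x \<bullet> \<omega> i = 0" if "i \<in> {1..DIM('a)}" for i
    using that cone_coord_nonneg[of x i] cone_coord_nonneg[of "- x" i] by simp
  then show "x = 0" using simple_expand[of x] by simp
qed

lemma root_coord_Ints: "\<beta> \<in> \<Phi> \<Longrightarrow> i \<in> {1..DIM('a)} \<Longrightarrow> \<beta> \<bullet> \<omega> i \<in> \<int>"
  using root_cases[of \<beta>] unfolding cone_iff
  by (metis Ints_minus Nats_subset_Ints inner_minus_left minus_minus subsetD)

lemma pos_rootD: "\<beta> \<in> \<Phi>p \<Longrightarrow> \<beta> \<in> \<Phi>" "\<beta> \<in> \<Phi>p \<Longrightarrow> \<beta> \<in> cone"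
  by (auto simp: pos_roots_def)

lemma root_ne0: "\<beta> \<in> \<Phi> \<Longrightarrow> \<beta> \<noteq> 0"
  using zero_notin_roots by blast

lemma neg_root: "\<beta> \<in> \<Phi> \<Longrightarrow> - \<beta> \<in> \<Phi>"
  using refl_root[of \<beta> \<beta>] aff_refl_self root_ne0 by metis

lemma not_both_pos: "\<beta> \<in> \<Phi>p \<Longrightarrow> - \<beta> \<notin> \<Phi>p"
  using cone_antisym[of \<beta>] root_ne0 pos_rootD by blast

lemma pos_or_neg: "\<beta> \<in> \<Phi> \<Longrightarrow> \<beta> \<in> \<Phi>p \<or> - \<beta> \<in> \<Phi>p"
  using root_cases neg_root by (auto simp: pos_roots_def)

lemma simple_cone_mem: "i \<in> {1..DIM('a)} \<Longrightarrow> \<alpha> i \<in> cone"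
  by (auto simp: cone_iff simple_fund_coweight)

lemma simple_pos: "i \<in> {1..DIM('a)} \<Longrightarrow> \<alpha> i \<in> \<Phi>p"
  using simple_root simple_cone_mem by (auto simp: pos_roots_def)

text \<open>The Cartan integers \<open>2c\<close> and \<open>2/c\<close> of the two roots have product \<open>4\<close>.\<close>

lemma root_multiple:
  assumes "\<beta> \<in> \<Phi>" "c *\<^sub>R \<beta> \<in> \<Phi>" "c > 0"
  shows "c = 1/2 \<or> c = 1 \<or> c = 2"
proof -
  have b: "\<beta> \<noteq> 0" using assms(1) root_ne0 by blast
  have "(c *\<^sub>R \<beta>) \<bullet> coroot \<beta> = 2 * c" using b by (simp add: coroot_def)
  then have "2 * c \<in> \<int>" using coroot_integral[OF assms(1,2)] by metis
  moreover have "\<beta> \<bullet> coroot (c *\<^sub>R \<beta>) = 2 / c"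
    using b assms(3) by (simp add: coroot_def power2_eq_square divide_simps)
  then have "2 / c \<in> \<int>" using coroot_integral[OF assms(2,1)] by metis
  ultimately obtain m k :: int where mk: "2 * c = m" "2 / c = k" by (auto elim!: Ints_cases)
  then have "real_of_int (m * k) = 4" using assms(3) by (simp add: field_simps flip: mk)
  then have mk4: "m * k = 4" by (metis of_int_eq_iff of_int_numeral)
  have "m > 0" using mk(1) assms(3) by (metis mult_pos_pos of_int_0_less_iff zero_less_numeral)
  moreover have "m dvd 4" using mk4 by (metis dvd_triv_left)
  ultimately have "m \<in> {1,2,3,4}" using zdvd_imp_le[of m 4] by auto
  moreover have "m \<noteq> 3" using mk4 by (auto; presburger)
  ultimately show ?thesis using mk(1) by auto
qed

section \<open>Simple reflections, heights and the induction on positive roots\<close>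

definition ht :: "'a \<Rightarrow> real" where "ht x = (\<Sum>i\<in>{1..DIM('a)}. x \<bullet> \<omega> i)"

lemma ht_diff_scale: "ht (x - c *\<^sub>R y) = ht x - c * ht y"
  by (simp add: ht_def inner_diff_left sum_subtractf sum_distrib_left)

lemma ht_simple: "i \<in> {1..DIM('a)} \<Longrightarrow> ht (\<alpha> i) = 1"
  by (simp add: ht_def simple_fund_coweight cong: if_cong)

lemma ht_cone: assumes "x \<in> cone" shows "ht x \<in> \<nat>"
proof -
  have sum_Nats: "(\<Sum>i\<in>A. f i) \<in> \<nat>" if "\<And>i. i \<in> A \<Longrightarrow> f i \<in> \<nat>" for A :: "nat set" and f :: "nat \<Rightarrow> real"
    using that by (induction A rule: infinite_finite_induct) (auto intro: Nats_add)
  show ?thesis unfolding ht_def by (rule sum_Nats) (use assms cone_iff in blast)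
qed

lemma ht_pos_root: assumes "\<beta> \<in> \<Phi>p" shows "ht \<beta> \<ge> 1"
proof -
  have c: "\<beta> \<in> cone" using assms pos_rootD by blast
  have "ht \<beta> \<noteq> 0"
  proof
    assume "ht \<beta> = 0"
    then have "\<forall>i\<in>{1..DIM('a)}. \<beta> \<bullet> \<omega> i = 0"
      unfolding ht_def using cone_coord_nonneg[OF c] by (subst (asm) sum_nonneg_eq_0_iff) auto
    then have "\<beta> = 0" using simple_expand[of \<beta>] by simp
    then show False using assms pos_rootD root_ne0 by blast
  qed
  moreover obtain k where "ht \<beta> = real k" using ht_cone[OF c] by (rule Nats_cases)
  ultimately show ?thesis by simp
qed

lemma span_simple_iff:
  assumes "J \<subseteq> {1..DIM('a)}"
  shows "x \<in> span (\<alpha> ` J) \<longleftrightarrow> (\<forall>i\<in>{1..DIM('a)} - J. x \<bullet> \<omega> i = 0)"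
proof
  assume "x \<in> span (\<alpha> ` J)"
  then show "\<forall>i\<in>{1..DIM('a)} - J. x \<bullet> \<omega> i = 0"
  proof (intro ballI)
    fix i assume i: "i \<in> {1..DIM('a)} - J"
    have "orthogonal (\<omega> i) x"
      using \<open>x \<in> span (\<alpha> ` J)\<close> i assms
      by (rule_tac orthogonal_to_span[of x "\<alpha> ` J"])
        (auto simp: orthogonal_def fund_coweight_simple subset_iff)
    then show "x \<bullet> \<omega> i = 0" by (simp add: orthogonal_def inner_commute)
  qed
next
  assume *: "\<forall>i\<in>{1..DIM('a)} - J. x \<bullet> \<omega> i = 0"
  have "x = (\<Sum>i\<in>{1..DIM('a)}. (x \<bullet> \<omega> i) *\<^sub>R \<alpha> i)" by (rule simple_expand)
  also have "\<dots> = (\<Sum>i\<in>J. (x \<bullet> \<omega> i) *\<^sub>R \<alpha> i)"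
    using * assms by (intro sum.mono_neutral_right) auto
  also have "\<dots> \<in> span (\<alpha> ` J)" by (intro span_sum span_scale span_base) auto
  finally show "x \<in> span (\<alpha> ` J)" .
qed

text \<open>The reflection changes only the \<open>i\<close>-th coordinate. Some other coordinate of \<open>\<beta>\<close> is positive and stays so, and
  the coordinates of a root all have the same sign.\<close>

lemma refl_simple_pos:
  assumes "\<beta> \<in> \<Phi>p" "i \<in> {1..DIM('a)}" "\<And>t. t > 0 \<Longrightarrow> \<beta> \<noteq> t *\<^sub>R \<alpha> i"
  shows "aff_refl (\<alpha> i) 0 \<beta> \<in> \<Phi>p"
proof -
  have b: "\<beta> \<in> \<Phi>" "\<beta> \<in> cone" using assms pos_rootD by auto
  have "\<exists>j\<in>{1..DIM('a)} - {i}. \<beta> \<bullet> \<omega> j \<noteq> 0"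
  proof (rule ccontr)
    assume "\<not> (\<exists>j\<in>{1..DIM('a)} - {i}. \<beta> \<bullet> \<omega> j \<noteq> 0)"
    then have "(\<Sum>j\<in>{1..DIM('a)}. (\<beta> \<bullet> \<omega> j) *\<^sub>R \<alpha> j) = (\<beta> \<bullet> \<omega> i) *\<^sub>R \<alpha> i"
      using assms(2) by (subst sum.remove[of _ i]) auto
    then have e: "\<beta> = (\<beta> \<bullet> \<omega> i) *\<^sub>R \<alpha> i" using simple_expand[of \<beta>] by simp
    then have "\<beta> \<bullet> \<omega> i \<noteq> 0" using b root_ne0 by force
    then have "\<beta> \<bullet> \<omega> i > 0" using cone_coord_nonneg[OF b(2) assms(2)] by simp
    then show False using assms(3) e by metis
  qed
  then obtain j where j: "j \<in> {1..DIM('a)}" "j \<noteq> i" "\<beta> \<bullet> \<omega> j > 0"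
    using cone_coord_nonneg[OF b(2)] by force
  have r: "aff_refl (\<alpha> i) 0 \<beta> \<in> \<Phi>" using refl_root[OF simple_root[OF assms(2)] b(1)] .
  have "aff_refl (\<alpha> i) 0 \<beta> \<bullet> \<omega> j = \<beta> \<bullet> \<omega> j"
    using j assms(2) by (simp add: aff_refl_0 inner_diff_left simple_fund_coweight)
  then have "- aff_refl (\<alpha> i) 0 \<beta> \<notin> cone"
    using j cone_coord_nonneg[of "- aff_refl (\<alpha> i) 0 \<beta>" j] by auto
  then show ?thesis using r root_cases by (auto simp: pos_roots_def)
qed

text \<open>In \<open>\<langle>\<beta>, \<beta>\<rangle> = \<Sum> c\<^sub>j \<langle>\<beta>, \<alpha>\<^sub>j\<rangle>\<close> all \<open>c\<^sub>j\<close> are nonnegative, and they vanish outside \<open>J\<close>.\<close>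

lemma pos_root_descent:
  assumes "J \<subseteq> {1..DIM('a)}" "\<beta> \<in> \<Phi>p" "\<beta> \<in> span (\<alpha> ` J)"
  obtains j where "j \<in> J" "\<beta> \<bullet> \<alpha> j > 0"
proof -
  have "\<beta> \<bullet> \<beta> > 0" using assms root_ne0 pos_rootD(1) by simp
  then have "(\<Sum>i\<in>{1..DIM('a)}. (\<beta> \<bullet> \<omega> i) * (\<alpha> i \<bullet> \<beta>)) > 0" using inner_simple_expand[of \<beta> \<beta>] by simp
  then have "\<exists>i\<in>{1..DIM('a)}. (\<beta> \<bullet> \<omega> i) * (\<alpha> i \<bullet> \<beta>) > 0"
    by (meson linorder_not_le sum_nonpos)
  then obtain i where i: "i \<in> {1..DIM('a)}" "(\<beta> \<bullet> \<omega> i) * (\<alpha> i \<bullet> \<beta>) > 0" by blast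
  have "i \<in> J" using i assms(3) span_simple_iff[OF assms(1)] by force
  moreover have "\<beta> \<bullet> \<alpha> i > 0"
    using i cone_coord_nonneg[OF pos_rootD(2)[OF assms(2)] i(1)]
    by (simp add: zero_less_mult_iff inner_commute)
  ultimately show thesis using that by blast
qed

text \<open>Reflecting in a simple root of positive pairing lowers the height, so every positive root of \<open>\<Phi>\<^sub>J\<close> arises from a
  multiple of some \<open>\<alpha>\<^sub>j\<close> by reflections in simple roots of \<open>J\<close>. Multiples occur because \<open>\<Phi>\<close> may be non-reduced.\<close>

lemma pos_root_induct [consumes 3, case_names multiple reflect]:
  assumes "J \<subseteq> {1..DIM('a)}" "\<beta> \<in> \<Phi>p" "\<beta> \<in> span (\<alpha> ` J)"
    and mult: "\<And>j t. j \<in> J \<Longrightarrow> t > 0 \<Longrightarrow> t *\<^sub>R \<alpha> j \<in> \<Phi> \<Longrightarrow> P (t *\<^sub>R \<alpha> j)"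
    and refl: "\<And>j \<gamma>. j \<in> J \<Longrightarrow> \<gamma> \<in> \<Phi>p \<Longrightarrow> \<gamma> \<in> span (\<alpha> ` J) \<Longrightarrow> P \<gamma> \<Longrightarrow> P (aff_refl (\<alpha> j) 0 \<gamma>)"
  shows "P \<beta>"
proof -
  obtain k where "ht \<beta> \<le> real k" using real_arch_simple by blast
  then show ?thesis using assms(2,3)
  proof (induction k arbitrary: \<beta>)
    case 0
    then show ?case using ht_pos_root[of \<beta>] by simp
  next
    case (Suc k)
    obtain j where j: "j \<in> J" "\<beta> \<bullet> \<alpha> j > 0" using pos_root_descent[OF assms(1) Suc.prems(2,3)] .
    then have jI: "j \<in> {1..DIM('a)}" using assms(1) by blast
    note aj = simple_root[OF jI] root_ne0[OF simple_root[OF jI]]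
    show ?case
    proof (cases "\<exists>t>0. \<beta> = t *\<^sub>R \<alpha> j")
      case True
      then show ?thesis using mult j pos_rootD(1)[OF Suc.prems(2)] by blast
    next
      case False
      let ?g = "aff_refl (\<alpha> j) 0 \<beta>"
      have g: "?g \<in> \<Phi>p" using refl_simple_pos[OF Suc.prems(2) jI] False by blast
      have ge: "?g = \<beta> - (\<beta> \<bullet> coroot (\<alpha> j)) *\<^sub>R \<alpha> j"
        by (simp add: aff_refl_0)
      have "\<beta> \<bullet> coroot (\<alpha> j) > 0" using j aj(2) by (simp add: coroot_sign)
      moreover have "\<beta> \<bullet> coroot (\<alpha> j) \<in> \<int>" using coroot_integral aj(1) pos_rootD(1)[OF Suc.prems(2)] by blast
      then obtain N where "\<beta> \<bullet> coroot (\<alpha> j) = of_int N" by (rule Ints_cases)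
      ultimately have "\<beta> \<bullet> coroot (\<alpha> j) \<ge> 1" by simp
      then have "ht ?g \<le> real k" using Suc.prems(1) jI unfolding ge by (simp add: ht_diff_scale ht_simple)
      moreover have "?g \<in> span (\<alpha> ` J)" unfolding ge using Suc.prems(3) j(1)
        by (intro span_diff span_scale) (auto intro: span_base)
      ultimately have "P ?g" using Suc.IH g by blast
      then have "P (aff_refl (\<alpha> j) 0 ?g)" using refl j(1) g \<open>?g \<in> span (\<alpha> ` J)\<close> by blast
      then show ?thesis using aff_refl_invol[OF aj(2)] by simp
    qed
  qed
qed

section \<open>The highest root\<close>

text \<open>Two orthogonal sets of simple roots would split \<open>\<Phi>\<close>: induction along simple reflections keeps each root in one
  of the two orthogonal spans.\<close>

lemma simple_connected:
  assumes "K \<subseteq> {1..DIM('a)}" "K \<noteq> {}" "K \<noteq> {1..DIM('a)}"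
  shows "\<exists>i\<in>K. \<exists>j\<in>{1..DIM('a)} - K. \<alpha> i \<bullet> \<alpha> j \<noteq> 0"
proof (rule ccontr)
  assume "\<not> ?thesis"
  then have orth: "\<And>i j. i \<in> K \<Longrightarrow> j \<in> {1..DIM('a)} - K \<Longrightarrow> \<alpha> i \<bullet> \<alpha> j = 0" by blast
  let ?A = "span (\<alpha> ` K)" and ?B = "span (\<alpha> ` ({1..DIM('a)} - K))"
  have AB: "a \<bullet> b = 0" if "a \<in> ?A" "b \<in> ?B" for a b
  proof -
    have "orthogonal a' b" if "a' \<in> \<alpha> ` K" for a'
      using that orth by (intro orthogonal_to_span[OF \<open>b \<in> ?B\<close>]) (auto simp: orthogonal_def)
    then have "orthogonal b a"
      by (intro orthogonal_to_span[OF \<open>a \<in> ?A\<close>]) (auto simp: orthogonal_commute)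
    then show ?thesis by (simp add: orthogonal_def inner_commute)
  qed
  have split: "\<beta> \<in> ?A \<union> ?B" if "\<beta> \<in> \<Phi>p" for \<beta>
  proof -
    have "\<beta> \<in> span (\<alpha> ` {1..DIM('a)})" using span_simple by simp
    with subset_refl that show ?thesis
    proof (induction rule: pos_root_induct)
      case (multiple j t)
      then have "\<alpha> j \<in> ?A \<or> \<alpha> j \<in> ?B" by (cases "j \<in> K") (auto intro: span_base)
      then show ?case by (auto intro: span_scale)
    next
      case (reflect j \<gamma>)
      have e: "aff_refl (\<alpha> j) 0 \<gamma> = \<gamma> - (\<gamma> \<bullet> coroot (\<alpha> j)) *\<^sub>R \<alpha> j"
        by (simp add: aff_refl_0)
      have aj: "\<alpha> j \<in> ?A \<or> \<alpha> j \<in> ?B"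
        using reflect.hyps(1) by (cases "j \<in> K") (auto intro: span_base)
      show ?case
      proof (cases "\<gamma> \<bullet> \<alpha> j = 0")
        case True
        then show ?thesis using reflect.IH by (simp add: aff_refl_def)
      next
        case False
        then have "\<gamma> \<in> ?A \<and> \<alpha> j \<in> ?A \<or> \<gamma> \<in> ?B \<and> \<alpha> j \<in> ?B"
          using reflect.IH aj AB[of \<gamma> "\<alpha> j"] AB[of "\<alpha> j" \<gamma>] by (auto simp: inner_commute)
        then show ?thesis unfolding e by (auto intro!: span_diff span_scale)
      qed
    qed
  qed
  have split': "\<beta> \<in> ?A \<union> ?B" if "\<beta> \<in> \<Phi>" for \<beta>
    using pos_or_neg[OF that] split[of \<beta>] split[of "- \<beta>"] span_neg[of "- \<beta>"] by auto
  have disj: "\<beta> \<notin> ?A \<inter> ?B" if "\<beta> \<in> \<Phi>" for \<beta>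
    using AB[of \<beta> \<beta>] root_ne0[OF that] by auto
  obtain i j where ij: "i \<in> K" "j \<in> {1..DIM('a)} - K" using assms by blast
  have "\<alpha> i \<in> \<Phi> \<inter> ?A" "\<alpha> j \<in> \<Phi> \<inter> ?B"
    using simple_root ij assms(1) by (auto intro: span_base)
  moreover have "(\<Phi> \<inter> ?A) \<inter> (\<Phi> \<inter> ?B) = {}" "(\<Phi> \<inter> ?A) \<union> (\<Phi> \<inter> ?B) = \<Phi>"
    using disj split' by blast+
  moreover have "\<forall>a\<in>\<Phi> \<inter> ?A. \<forall>b\<in>\<Phi> \<inter> ?B. a \<bullet> b = 0" using AB by blast
  ultimately have "\<exists>A B. A \<noteq> {} \<and> B \<noteq> {} \<and> A \<inter> B = {} \<and> A \<union> B = \<Phi> \<and> (\<forall>a\<in>A. \<forall>b\<in>B. a \<bullet> b = 0)"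
    by (intro exI[of _ "\<Phi> \<inter> ?A"] exI[of _ "\<Phi> \<inter> ?B"] conjI) auto
  then show False using irreducible unfolding irreducible_roots_def by (elim conjE notE) assumption
qed

definition maximal_root :: "'a \<Rightarrow> bool" where
  "maximal_root \<phi> \<longleftrightarrow> \<phi> \<in> \<Phi>p \<and> (\<forall>\<beta>\<in>\<Phi>. \<beta> - \<phi> \<in> cone \<longrightarrow> \<beta> = \<phi>)"

text \<open>Among the roots above \<open>\<beta>\<close> one of largest height is maximal.\<close>

lemma maximal_root_above:
  assumes "\<beta> \<in> \<Phi>p"
  obtains \<phi> where "maximal_root \<phi>" "\<phi> - \<beta> \<in> cone"
proof -
  let ?S = "{\<gamma> \<in> \<Phi>. \<gamma> - \<beta> \<in> cone}"
  have b: "\<beta> \<in> ?S" using assms pos_rootD by (auto simp: cone_iff)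
  have fin: "finite ?S" using finite_roots by simp
  obtain \<phi> where \<phi>: "\<phi> \<in> ?S" "\<And>\<gamma>. \<gamma> \<in> ?S \<Longrightarrow> ht \<gamma> \<le> ht \<phi>"
  proof -
    have "finite (ht ` ?S)" "ht ` ?S \<noteq> {}" using fin b by auto
    then have "Max (ht ` ?S) \<in> ht ` ?S" by (rule Max_in)
    then obtain p where "p \<in> ?S" "ht p = Max (ht ` ?S)" by auto
    then show thesis using that[of p] fin by auto
  qed
  have "\<phi> \<in> cone" using cone_add[of "\<phi> - \<beta>" \<beta>] \<phi>(1) assms pos_rootD by auto
  then have "\<phi> \<in> \<Phi>p" using \<phi>(1) by (auto simp: pos_roots_def)
  moreover have "\<gamma> = \<phi>" if g: "\<gamma> \<in> \<Phi>" "\<gamma> - \<phi> \<in> cone" for \<gamma>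
  proof -
    have "\<gamma> - \<beta> \<in> cone" using cone_add[OF g(2), of "\<phi> - \<beta>"] \<phi>(1) by simp
    then have "ht \<gamma> \<le> ht \<phi>" using \<phi>(2) g by blast
    then have "ht (\<gamma> - \<phi>) \<le> 0" using ht_diff_scale[of \<gamma> 1 \<phi>] by simp
    moreover have "\<forall>i\<in>{1..DIM('a)}. (\<gamma> - \<phi>) \<bullet> \<omega> i \<ge> 0" using cone_coord_nonneg g(2) by blast
    ultimately have "\<forall>i\<in>{1..DIM('a)}. (\<gamma> - \<phi>) \<bullet> \<omega> i = 0"
      unfolding ht_def by (metis (no_types, lifting) finite_atLeastAtMost order_antisym sum_nonneg sum_nonneg_eq_0_iff)
    then have "\<gamma> - \<phi> = 0" using simple_expand[of "\<gamma> - \<phi>"] by simp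
    then show ?thesis by simp
  qed
  ultimately have "maximal_root \<phi>" by (auto simp: maximal_root_def)
  then show thesis using that \<phi>(1) by blast
qed

text \<open>A negative pairing with \<open>\<alpha>\<^sub>i\<close> would make the reflected root larger.\<close>

lemma maximal_root_dominant:
  assumes "maximal_root \<phi>" "i \<in> {1..DIM('a)}"
  shows "\<phi> \<bullet> \<alpha> i \<ge> 0"
proof (rule ccontr)
  assume n: "\<not> \<phi> \<bullet> \<alpha> i \<ge> 0"
  have p: "\<phi> \<in> \<Phi>" using assms(1) pos_rootD by (auto simp: maximal_root_def)
  let ?N = "\<phi> \<bullet> coroot (\<alpha> i)"
  note ai = simple_root[OF assms(2)] root_ne0[OF simple_root[OF assms(2)]]
  have r: "aff_refl (\<alpha> i) 0 \<phi> \<in> \<Phi>" using refl_root ai p by blast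
  have e: "aff_refl (\<alpha> i) 0 \<phi> - \<phi> = (- ?N) *\<^sub>R \<alpha> i" by (simp add: aff_refl_0)
  have N: "?N < 0" using n ai by (simp add: coroot_sign)
  have "?N \<in> \<int>" using coroot_integral ai p by blast
  then obtain M where M: "?N = of_int M" by (rule Ints_cases)
  have "(- ?N) *\<^sub>R \<alpha> i \<bullet> \<omega> j \<in> \<nat>" if "j \<in> {1..DIM('a)}" for j
  proof -
    have "(- ?N) *\<^sub>R \<alpha> i \<bullet> \<omega> j = of_nat (if i = j then nat (- M) else 0)"
      using N that assms(2) by (simp add: simple_fund_coweight M)
    then show ?thesis by (metis of_nat_in_Nats)
  qed
  then have "(- ?N) *\<^sub>R \<alpha> i \<in> cone" unfolding cone_iff by blast
  then have "aff_refl (\<alpha> i) 0 \<phi> = \<phi>" using assms(1) r e unfolding maximal_root_def by metis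
  then show False using e N ai by simp
qed

text \<open>If the support were proper, connectedness would give an index outside it that is linked to it, and there \<open>\<phi>\<close> would
  have a negative pairing.\<close>

lemma maximal_root_full_support:
  assumes "maximal_root \<phi>" "i \<in> {1..DIM('a)}"
  shows "\<phi> \<bullet> \<omega> i > 0"
proof -
  have p: "\<phi> \<in> \<Phi>" "\<phi> \<in> cone" using assms(1) pos_rootD by (auto simp: maximal_root_def)
  let ?K = "{i \<in> {1..DIM('a)}. \<phi> \<bullet> \<omega> i \<noteq> 0}"
  have "?K \<noteq> {}"
  proof
    assume "?K = {}"
    then have "\<phi> = 0" using simple_expand[of \<phi>] by simp
    then show False using p root_ne0 by blast
  qed
  have "?K = {1..DIM('a)}"
  proof (rule ccontr)
    assume "?K \<noteq> {1..DIM('a)}"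
    then obtain i j where ij: "i \<in> ?K" "j \<in> {1..DIM('a)} - ?K" "\<alpha> i \<bullet> \<alpha> j \<noteq> 0"
      using simple_connected[of ?K] \<open>?K \<noteq> {}\<close> by blast
    \<comment> \<open>distinct simple roots pair nonpositively, so \<open>\<phi>\<close> fails to be dominant at \<open>j\<close>\<close>
    have np: "\<alpha> k \<bullet> \<alpha> j \<le> 0" if k: "k \<in> ?K" for k
    proof -
      have kj: "k \<in> {1..DIM('a)}" "j \<in> {1..DIM('a)}" "k \<noteq> j" using k ij by auto
      have "aff_refl (\<alpha> j) 0 (\<alpha> k) \<in> \<Phi>p"
      proof (rule refl_simple_pos[OF simple_pos[OF kj(1)] kj(2)])
        fix t :: real assume "t > 0"
        show "\<alpha> k \<noteq> t *\<^sub>R \<alpha> j"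
        proof
          assume "\<alpha> k = t *\<^sub>R \<alpha> j"
          then have "\<omega> k \<bullet> \<alpha> k = t * (\<omega> k \<bullet> \<alpha> j)" by simp
          then show False using kj by (simp add: fund_coweight_simple)
        qed
      qed
      then have "aff_refl (\<alpha> j) 0 (\<alpha> k) \<bullet> \<omega> j \<ge> 0"
        using cone_coord_nonneg pos_rootD kj by blast
      then have "\<alpha> k \<bullet> coroot (\<alpha> j) \<le> 0"
        using kj by (simp add: aff_refl_0 inner_diff_left simple_fund_coweight)
      then show ?thesis using root_ne0[OF simple_root[OF kj(2)]]
        by (simp add: coroot_sign)
    qed
    have "\<phi> \<bullet> \<alpha> j = (\<Sum>k\<in>{1..DIM('a)}. (\<phi> \<bullet> \<omega> k) * (\<alpha> k \<bullet> \<alpha> j))" by (rule inner_simple_expand)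
    also have "\<dots> < 0"
    proof -
      have "(\<phi> \<bullet> \<omega> k) * (\<alpha> k \<bullet> \<alpha> j) \<le> 0" if "k \<in> {1..DIM('a)}" for k
        using np[of k] that cone_coord_nonneg[OF p(2) that]
        by (cases "\<phi> \<bullet> \<omega> k = 0") (auto simp: mult_nonneg_nonpos)
      moreover have "(\<phi> \<bullet> \<omega> i) * (\<alpha> i \<bullet> \<alpha> j) < 0"
        using np[of i] ij cone_coord_nonneg[OF p(2), of i] by (simp add: mult_pos_neg less_le mult_nonneg_nonpos)
      ultimately have "(\<Sum>k\<in>{1..DIM('a)}. (\<phi> \<bullet> \<omega> k) * (\<alpha> k \<bullet> \<alpha> j)) < (\<Sum>k\<in>{1..DIM('a)}. 0)"
        using ij by (intro sum_strict_mono_ex1) auto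
      then show ?thesis by simp
    qed
    finally show False using maximal_root_dominant[OF assms(1)] ij by force
  qed
  then have "i \<in> ?K" using assms(2) by simp
  then show ?thesis using cone_coord_nonneg[OF p(2) assms(2)] by simp
qed


text \<open>Dominance and full support make the inner product of two maximal roots positive. Unless the roots agree, one
  Cartan integer is then \<open>1\<close>, so their difference is a root and they are comparable.\<close>

lemma maximal_root_unique:
  assumes "maximal_root \<phi>" "maximal_root \<psi>"
  shows "\<phi> = \<psi>"
proof -
  have p: "\<phi> \<in> \<Phi>" "\<phi> \<in> cone" "\<phi> \<noteq> 0" and q: "\<psi> \<in> \<Phi>" "\<psi> \<in> cone" "\<psi> \<noteq> 0"
    using assms pos_rootD root_ne0 by (auto simp: maximal_root_def)
  have cmp: "\<phi> = \<psi>" if "\<phi> - \<psi> \<in> cone \<or> \<psi> - \<phi> \<in> cone"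
    using that assms p q unfolding maximal_root_def by blast
  have pos: "\<phi> \<bullet> \<psi> > 0"
  proof -
    have "\<exists>i\<in>{1..DIM('a)}. \<psi> \<bullet> \<alpha> i \<noteq> 0" using orth_simple_zero[of \<psi>] q by blast
    then obtain i where i: "i \<in> {1..DIM('a)}" "\<psi> \<bullet> \<alpha> i \<noteq> 0" by blast
    have "0 < (\<Sum>i\<in>{1..DIM('a)}. (\<phi> \<bullet> \<omega> i) * (\<alpha> i \<bullet> \<psi>))"
    proof (rule sum_pos2[of _ i])
      show "0 < (\<phi> \<bullet> \<omega> i) * (\<alpha> i \<bullet> \<psi>)"
        using maximal_root_full_support[OF assms(1) i(1)] maximal_root_dominant[OF assms(2) i(1)] i(2)
        by (simp add: inner_commute)
      show "0 \<le> (\<phi> \<bullet> \<omega> j) * (\<alpha> j \<bullet> \<psi>)" if "j \<in> {1..DIM('a)}" for j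
        using maximal_root_full_support[OF assms(1) that] maximal_root_dominant[OF assms(2) that]
        by (simp add: inner_commute)
    qed (use i in auto)
    then show ?thesis using inner_simple_expand[of \<phi> \<psi>] by simp
  qed
  obtain N where N: "\<phi> \<bullet> coroot \<psi> = of_int N" using coroot_integral[OF q(1) p(1)] by (rule Ints_cases)
  obtain M where M: "\<psi> \<bullet> coroot \<phi> = of_int M" using coroot_integral[OF p(1) q(1)] by (rule Ints_cases)
  have NM0: "N > 0" "M > 0"
    using pos N M coroot_sign(1)[OF q(3), of \<phi>] coroot_sign(1)[OF p(3), of \<psi>] by (auto simp: inner_commute)
  have prod: "(\<phi> \<bullet> coroot \<psi>) * (\<psi> \<bullet> coroot \<phi>) = 4 * (\<phi> \<bullet> \<psi>)\<^sup>2 / ((\<phi> \<bullet> \<phi>) * (\<psi> \<bullet> \<psi>))"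
    by (simp add: coroot_def power2_eq_square inner_commute)
  show ?thesis
  proof (cases "N = 1 \<or> M = 1")
    case True
    have "\<phi> - \<psi> \<in> \<Phi> \<or> \<psi> - \<phi> \<in> \<Phi>"
      using True refl_root[OF q(1) p(1)] refl_root[OF p(1) q(1)] N M
      by (auto simp: aff_refl_0)
    then have "\<phi> - \<psi> \<in> \<Phi>" using neg_root by (metis minus_diff_eq)
    then show ?thesis using cmp root_cases[of "\<phi> - \<psi>"] by auto
  next
    case False
    \<comment> \<open>both Cartan integers are at least \<open>2\<close>, which is the equality case of Cauchy--Schwarz\<close>
    then have NM2: "N \<ge> 2" "M \<ge> 2" using NM0 by auto
    then have "of_int N * of_int M \<ge> (2::real) * 2" by (intro mult_mono) auto
    then have "4 * (\<phi> \<bullet> \<psi>)\<^sup>2 / ((\<phi> \<bullet> \<phi>) * (\<psi> \<bullet> \<psi>)) \<ge> 4" using prod N M by simp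
    moreover have pq: "(\<phi> \<bullet> \<phi>) * (\<psi> \<bullet> \<psi>) > 0" using p q by simp
    ultimately have "(\<phi> \<bullet> \<psi>)\<^sup>2 \<ge> (\<phi> \<bullet> \<phi>) * (\<psi> \<bullet> \<psi>)" by (simp add: pos_le_divide_eq)
    then have eq: "(\<phi> \<bullet> \<psi>)\<^sup>2 = (\<phi> \<bullet> \<phi>) * (\<psi> \<bullet> \<psi>)" using Cauchy_Schwarz_ineq[of \<phi> \<psi>] by linarith
    then have "of_int N * of_int M = (4::real)" using prod N M pq p q by simp
    then have "real_of_int (N * M) = real_of_int 4" by simp
    then have "N * M = 4" by (simp only: of_int_eq_iff)
    then have "M = 2"
    proof -
      have "2 * M \<le> N * M" "N * 2 \<le> N * M" using NM2 by (simp_all add: mult_right_mono mult_left_mono)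
      then show ?thesis using NM2 \<open>N * M = 4\<close> by linarith
    qed
    then have "\<phi> \<bullet> \<psi> = \<phi> \<bullet> \<phi>" using M p(3) by (simp add: coroot_def inner_commute field_simps)
    moreover from this have "\<psi> \<bullet> \<psi> = \<phi> \<bullet> \<phi>" using eq p(3) by (simp add: power2_eq_square)
    ultimately have "(\<phi> - \<psi>) \<bullet> (\<phi> - \<psi>) = 0" by (simp add: inner_diff_left inner_diff_right inner_commute)
    then show ?thesis by simp
  qed
qed

abbreviation \<phi> :: 'a where "\<phi> \<equiv> highest_root D"

lemma highest_root: "\<phi> \<in> \<Phi>" and highest_root_ge: "\<beta> \<in> \<Phi> \<Longrightarrow> \<phi> - \<beta> \<in> cone"
proof -
  have "\<Phi> \<noteq> {}" using irreducible by (simp add: irreducible_roots_def)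
  then obtain \<gamma> where "\<gamma> \<in> \<Phi>p" using pos_or_neg by blast
  then obtain \<psi> where \<psi>: "maximal_root \<psi>" by (rule maximal_root_above)
  have ge: "\<psi> - \<beta> \<in> cone" if b: "\<beta> \<in> \<Phi>" for \<beta>
  proof (cases "\<beta> \<in> \<Phi>p")
    case True
    then show ?thesis using maximal_root_above maximal_root_unique[OF \<psi>] by metis
  next
    case False
    then have "- \<beta> \<in> cone" using pos_or_neg[OF b] pos_rootD by blast
    moreover have "\<psi> \<in> cone" using \<psi> pos_rootD by (auto simp: maximal_root_def)
    ultimately show ?thesis using cone_add by fastforce
  qed
  have "\<psi> \<in> \<Phi>" using \<psi> pos_rootD by (auto simp: maximal_root_def)
  moreover have "\<psi>' = \<psi>" if "\<psi>' \<in> \<Phi>" "\<forall>\<beta>\<in>\<Phi>. \<psi>' - \<beta> \<in> cone" for \<psi>'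
    using that \<open>\<psi> \<in> \<Phi>\<close> \<psi> by (auto simp: maximal_root_def)
  ultimately have "\<exists>!\<psi>'. \<psi>' \<in> \<Phi> \<and> (\<forall>\<beta>\<in>\<Phi>. \<psi>' - \<beta> \<in> cone)" using ge by blast
  from theI'[OF this] show "\<phi> \<in> \<Phi>" "\<beta> \<in> \<Phi> \<Longrightarrow> \<phi> - \<beta> \<in> cone" unfolding highest_root_def by blast+
qed

lemma highest_root_cone: "\<phi> \<in> cone"
proof -
  have "\<phi> - - \<phi> \<in> cone" using highest_root_ge neg_root highest_root by blast
  then have "\<phi> + \<phi> \<in> cone" by simp
  then have "\<not> - \<phi> \<in> cone" using cone_add[of "\<phi> + \<phi>" "- \<phi>"] cone_antisym root_ne0 highest_root by fastforce
  then show ?thesis using root_cases highest_root by blast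
qed

lemma highest_root_pos: "\<phi> \<in> \<Phi>p"
  using highest_root highest_root_cone by (auto simp: pos_roots_def)

lemma maximal_highest: "maximal_root \<phi>"
proof -
  have "\<beta> = \<phi>" if "\<beta> \<in> \<Phi>" "\<beta> - \<phi> \<in> cone" for \<beta>
    using cone_antisym[OF that(2)] highest_root_ge[OF that(1)] by simp
  then show ?thesis using highest_root_pos by (auto simp: maximal_root_def)
qed

lemma highest_coroot_nonneg:
  assumes "\<gamma> \<in> cone" shows "\<gamma> \<bullet> coroot \<phi> \<ge> 0"
proof -
  have "\<gamma> \<bullet> \<phi> = (\<Sum>i\<in>{1..DIM('a)}. (\<gamma> \<bullet> \<omega> i) * (\<alpha> i \<bullet> \<phi>))" by (rule inner_simple_expand)
  also have "\<dots> \<ge> 0"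
    using cone_coord_nonneg[OF assms] maximal_root_dominant[OF maximal_highest]
    by (intro sum_nonneg) (auto simp: inner_commute)
  finally show ?thesis using root_ne0[OF highest_root] by (simp add: coroot_sign)
qed

text \<open>If the pairing were \<open>N \<ge> 2\<close>, the root \<open>N\<phi> - \<gamma>\<close> would lie below \<open>\<phi>\<close>, hence \<open>\<gamma>\<close> above \<open>(N - 1)\<phi>\<close>.\<close>

lemma highest_coroot_pairing:
  assumes "\<gamma> \<in> \<Phi>p" "\<gamma> \<noteq> \<phi>"
  shows "\<gamma> \<bullet> coroot \<phi> = 0 \<or> \<gamma> \<bullet> coroot \<phi> = 1"
proof (rule ccontr)
  assume n: "\<not> ?thesis"
  have g: "\<gamma> \<in> \<Phi>" "\<gamma> \<in> cone" using assms pos_rootD by auto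
  obtain N where N: "\<gamma> \<bullet> coroot \<phi> = of_int N"
    using coroot_integral[OF highest_root g(1)] by (rule Ints_cases)
  have "of_int N \<ge> (0::real)" using highest_coroot_nonneg[OF g(2)] N by simp
  then have N2: "N \<ge> 2" using n N by (auto simp: le_less)
  have "aff_refl \<phi> 0 \<gamma> = \<gamma> - of_int N *\<^sub>R \<phi>" using N by (simp add: aff_refl_0)
  then have "- (\<gamma> - of_int N *\<^sub>R \<phi>) \<in> \<Phi>" using refl_root[OF highest_root g(1)] neg_root by metis
  then have A: "\<phi> + (\<gamma> - of_int N *\<^sub>R \<phi>) \<in> cone" using highest_root_ge[of "- (\<gamma> - of_int N *\<^sub>R \<phi>)"] by (simp only: diff_minus_eq_add)
  have mult: "of_nat k *\<^sub>R \<phi> \<in> cone" for k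
  proof (induction k)
    case 0
    show ?case by (simp add: cone_iff)
  next
    case (Suc k)
    then show ?case using cone_add[OF highest_root_cone Suc] by (simp add: scaleR_add_left)
  qed
  have "\<phi> - \<gamma> \<in> cone" using highest_root_ge[OF g(1)] .
  \<comment> \<open>adding multiples of \<open>\<phi>\<close> shows that \<open>\<gamma>\<close> dominates \<open>\<phi>\<close> as well\<close>
  moreover have "\<gamma> - \<phi> = (\<phi> + (\<gamma> - of_int N *\<^sub>R \<phi>)) + of_nat (nat (N - 2)) *\<^sub>R \<phi>"
    using N2 by (simp add: scaleR_diff_left scaleR_2)
  then have "\<gamma> - \<phi> \<in> cone" using cone_add[OF A mult] by metis
  ultimately have "\<gamma> - \<phi> = 0" using cone_antisym[of "\<gamma> - \<phi>"] by simp
  then show False using assms by simp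
qed

lemma half_not_Ints: "(1/2::real) \<notin> \<int>"
proof
  assume "(1/2::real) \<in> \<int>"
  then obtain k where "(1/2::real) = of_int k" by (rule Ints_cases)
  then have "real_of_int (2 * k) = real_of_int 1" by simp
  then have "2 * k = 1" by (simp only: of_int_eq_iff)
  then show False by presburger
qed

lemma half_simple_not_root:
  assumes "i \<in> {1..DIM('a)}" shows "(1/2) *\<^sub>R \<alpha> i \<notin> \<Phi>"
proof
  assume "(1/2) *\<^sub>R \<alpha> i \<in> \<Phi>"
  then have "(1/2) *\<^sub>R \<alpha> i \<bullet> \<omega> i \<in> \<int>" using root_coord_Ints assms by blast
  then show False using assms half_not_Ints by (simp add: simple_fund_coweight)
qed

end

section \<open>Reflection groups generated by simple and affine simple reflections\<close>

lemma linear_aff_refl_0: "linear (aff_refl \<beta> 0)"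
  by (intro linearI) (simp_all add: aff_refl_def inner_add_left algebra_simps)

lemma inner_aff_refl_0:
  assumes "\<beta> \<noteq> 0" shows "aff_refl \<beta> 0 x \<bullet> aff_refl \<beta> 0 y = x \<bullet> y"
proof -
  have b: "\<beta> \<bullet> \<beta> \<noteq> 0" using assms by simp
  let ?c = "\<lambda>x. 2 * (x \<bullet> \<beta>) / (\<beta> \<bullet> \<beta>)"
  have e: "aff_refl \<beta> 0 x = x - ?c x *\<^sub>R \<beta>" for x
    by (simp add: aff_refl_def coroot_def mult.commute)
  have "aff_refl \<beta> 0 x \<bullet> aff_refl \<beta> 0 y
      = x \<bullet> y - ?c y * (x \<bullet> \<beta>) - ?c x * (y \<bullet> \<beta>) + ?c x * ?c y * (\<beta> \<bullet> \<beta>)"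
    by (simp only: e inner_diff_left inner_diff_right inner_scaleR_left inner_scaleR_right inner_commute[of \<beta> y])
      (simp add: algebra_simps)
  also have "\<dots> = x \<bullet> y" using b by (simp add: field_simps)
  finally show ?thesis .
qed

lemma aff_refl_scale:
  assumes "t \<noteq> 0" shows "aff_refl (t *\<^sub>R \<beta>) 0 = aff_refl \<beta> 0"
  using assms by (simp add: aff_refl_def fun_eq_iff coroot_scale)

lemma aff_refl_minus: "aff_refl (- \<beta>) 0 = aff_refl \<beta> 0"
  using aff_refl_scale[of "- 1" \<beta>] by simp

definition isometry :: "('a::euclidean_space \<Rightarrow> 'a) \<Rightarrow> bool" where
  "isometry u \<longleftrightarrow> linear u \<and> (\<forall>x y. u x \<bullet> u y = x \<bullet> y)"

lemma isometry_linear: "isometry u \<Longrightarrow> linear u"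
  and isometry_inner: "isometry u \<Longrightarrow> u x \<bullet> u y = x \<bullet> y"
  by (auto simp: isometry_def)

lemma isometry_coroot: "isometry u \<Longrightarrow> coroot (u \<beta>) = u (coroot \<beta>)"
  by (simp add: coroot_def isometry_inner linear_scale isometry_linear)

lemma isometry_aff_refl:
  assumes "isometry u"
  shows "aff_refl (u \<beta>) 0 (u x) = u (aff_refl \<beta> 0 x)"
  using assms
  by (simp add: aff_refl_def isometry_coroot isometry_inner linear_diff linear_scale isometry_linear)

lemma isometry_aff_refl_0: "\<beta> \<noteq> 0 \<Longrightarrow> isometry (aff_refl \<beta> 0)"
  by (simp add: isometry_def linear_aff_refl_0 inner_aff_refl_0)

lemma word_prod_Nil [simp]: "word_prod D [] = id"
  by (simp add: word_prod_def)

lemma word_prod_Cons [simp]: "word_prod D (i # js) = srefl D i \<circ> word_prod D js"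
  by (simp add: word_prod_def)

lemma word_prod_append: "word_prod D (as @ bs) = word_prod D as \<circ> word_prod D bs"
  by (induction as) (simp_all add: comp_assoc)

lemma gen_group_id: "id \<in> gen_group D K"
  unfolding gen_group_def by (rule image_eqI[of _ _ "[]"]) simp_all

lemma gen_group_comp: "u \<in> gen_group D K \<Longrightarrow> v \<in> gen_group D K \<Longrightarrow> u \<circ> v \<in> gen_group D K"
  unfolding gen_group_def by (auto simp flip: word_prod_append intro!: imageI)

lemma gen_group_srefl: "i \<in> K \<Longrightarrow> srefl D i \<in> gen_group D K"
  unfolding gen_group_def by (rule image_eqI[of _ _ "[i]"]) simp_all

lemma gen_group_mono: "K \<subseteq> L \<Longrightarrow> gen_group D K \<subseteq> gen_group D L"
  unfolding gen_group_def by auto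

lemma gen_group_word: "js \<in> lists K \<Longrightarrow> word_prod D js \<in> gen_group D K"
  unfolding gen_group_def by blast

lemma gen_group_induct [consumes 1, case_names id step]:
  assumes "u \<in> gen_group D K" "P id"
    "\<And>i u. i \<in> K \<Longrightarrow> u \<in> gen_group D K \<Longrightarrow> P u \<Longrightarrow> P (srefl D i \<circ> u)"
  shows "P u"
proof -
  obtain js where js: "js \<in> lists K" "u = word_prod D js" using assms(1) by (auto simp: gen_group_def)
  have "P (word_prod D js)" using js(1)
  proof (induction js)
    case Nil
    show ?case unfolding word_prod_Nil by (rule assms(2))
  next
    case (Cons i js)
    then show ?case unfolding word_prod_Cons using assms(3) gen_group_word by blast
  qed
  then show ?thesis using js by simp
qed

lemma group_closure_scale_int:
  fixes x :: "'b::real_vector"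
  assumes "x \<in> group_closure S" shows "of_int k *\<^sub>R x \<in> group_closure S"
proof -
  have nat: "of_nat l *\<^sub>R x \<in> group_closure S" for l
    by (induction l) (use assms in \<open>auto simp: scaleR_add_left intro: group_closure_add\<close>)
  show ?thesis using nat[of "nat \<bar>k\<bar>"] by (cases "k \<ge> 0") (auto simp: group_closure_minus_iff)
qed

context irr_root_datum
begin

lemma srefl_simple: "i \<in> {1..DIM('a)} \<Longrightarrow> srefl D i = aff_refl (\<alpha> i) 0"
  by (simp add: srefl_def)

lemma srefl_invol:
  assumes "i \<in> {0..DIM('a)}" shows "srefl D i \<circ> srefl D i = id"
proof (cases "i = 0")
  case True
  then show ?thesis using aff_refl_invol root_ne0[OF highest_root] by (auto simp: srefl_def fun_eq_iff)
next
  case False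
  then have i: "i \<in> {1..DIM('a)}" using assms by auto
  show ?thesis using aff_refl_invol[OF root_ne0[OF simple_root[OF i]]] by (simp add: srefl_simple[OF i] fun_eq_iff)
qed

lemma gen_group_inverse:
  assumes "K \<subseteq> {0..DIM('a)}" "u \<in> gen_group D K"
  obtains v where "v \<in> gen_group D K" "u \<circ> v = id" "v \<circ> u = id"
proof -
  have "\<exists>v\<in>gen_group D K. u \<circ> v = id \<and> v \<circ> u = id" using assms(2)
  proof (induction rule: gen_group_induct)
    case id
    show ?case using gen_group_id by (intro bexI[of _ id]) auto
  next
    case (step i u)
    then obtain v where v: "v \<in> gen_group D K" "u \<circ> v = id" "v \<circ> u = id" by blast
    have i: "srefl D i \<circ> srefl D i = id" using srefl_invol step.hyps assms(1) by blast
    have "(srefl D i \<circ> u) \<circ> (v \<circ> srefl D i) = id" "(v \<circ> srefl D i) \<circ> (srefl D i \<circ> u) = id"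
      using v i by (metis comp_assoc comp_id id_comp)+
    moreover have "v \<circ> srefl D i \<in> gen_group D K"
      using v step.hyps gen_group_comp gen_group_srefl by blast
    ultimately show ?case by blast
  qed
  then show thesis using that by blast
qed

lemma weyl_isometry_roots:
  assumes "J \<subseteq> {1..DIM('a)}" "u \<in> gen_group D J"
  shows "isometry u \<and> u ` \<Phi> = \<Phi> \<and> (\<forall>x. x \<in> span (\<alpha> ` J) \<longrightarrow> u x \<in> span (\<alpha> ` J))"
  using assms(2)
proof (induction rule: gen_group_induct)
  case id
  show ?case by (simp add: isometry_def linear_iff)
next
  case (step i u)
  then have i: "i \<in> {1..DIM('a)}" using assms(1) by auto
  note ai = simple_root[OF i] root_ne0[OF simple_root[OF i]]
  have e: "srefl D i = aff_refl (\<alpha> i) 0" using srefl_simple[OF i] .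
  have "isometry (srefl D i \<circ> u)"
    using step.IH isometry_aff_refl_0[OF ai(2)] linear_compose[of u "srefl D i"]
    unfolding e isometry_def by auto
  moreover have "(srefl D i \<circ> u) ` \<Phi> = \<Phi>"
    using step.IH refl_roots_image[OF ai(1)] by (simp only: image_comp[symmetric] e)
  moreover have "(srefl D i \<circ> u) x \<in> span (\<alpha> ` J)" if "x \<in> span (\<alpha> ` J)" for x
  proof -
    have "u x \<in> span (\<alpha> ` J)" "\<alpha> i \<in> span (\<alpha> ` J)" using that step by (auto intro: span_base)
    then show ?thesis unfolding e by (simp add: aff_refl_0 span_diff span_scale)
  qed
  ultimately show ?case by blast
qed

lemma weyl_sub: "J \<subseteq> {1..DIM('a)} \<Longrightarrow> u \<in> gen_group D J \<Longrightarrow> u \<in> weyl D"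
  using gen_group_mono by blast

lemma weyl_isometry: "u \<in> weyl D \<Longrightarrow> isometry u"
  using weyl_isometry_roots[OF subset_refl] by blast

lemma weyl_root: "u \<in> weyl D \<Longrightarrow> \<beta> \<in> \<Phi> \<Longrightarrow> u \<beta> \<in> \<Phi>"
  using weyl_isometry_roots[OF subset_refl] by blast

lemma weyl_inverse:
  assumes "u \<in> weyl D"
  obtains v where "v \<in> weyl D" "\<And>x. u (v x) = x" "\<And>x. v (u x) = x" "\<And>x y. u x \<bullet> y = x \<bullet> v y"
proof -
  obtain v where v: "v \<in> weyl D" "u \<circ> v = id" "v \<circ> u = id"
    using gen_group_inverse[of "{1..DIM('a)}" u] assms by auto
  then have uv: "u (v x) = x" "v (u x) = x" for x by (metis comp_apply id_apply)+
  have "u x \<bullet> y = x \<bullet> v y" for x y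
    using isometry_inner[OF weyl_isometry[OF assms], of x "v y"] uv by simp
  then show thesis using that v uv by blast
qed

lemma parab_root_iff: "\<beta> \<in> parab_roots D J \<longleftrightarrow> \<beta> \<in> \<Phi> \<and> \<beta> \<in> span (\<alpha> ` J)"
  by (simp add: parab_roots_def)

lemma parab_pos_root_iff: "\<beta> \<in> parab_pos_roots D J \<longleftrightarrow> \<beta> \<in> \<Phi>p \<and> \<beta> \<in> span (\<alpha> ` J)"
  using pos_rootD by (auto simp: parab_roots_def parab_pos_roots_def)

lemma parab_weyl_root:
  "J \<subseteq> {1..DIM('a)} \<Longrightarrow> u \<in> gen_group D J \<Longrightarrow> \<beta> \<in> parab_roots D J \<Longrightarrow> u \<beta> \<in> parab_roots D J"
  using weyl_isometry_roots[of J u] weyl_root[of u \<beta>] weyl_sub[of J u] by (simp add: parab_root_iff)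

lemma parab_root_scale:
  assumes "t \<noteq> 0" "t *\<^sub>R \<beta> \<in> \<Phi>" "\<beta> \<in> parab_roots D J"
  shows "t *\<^sub>R \<beta> \<in> parab_roots D J"
  using assms by (auto simp: parab_root_iff span_scale)

lemma parab_neg_root: "\<beta> \<in> parab_roots D J \<Longrightarrow> - \<beta> \<in> parab_roots D J"
  using neg_root[of \<beta>] span_neg[of \<beta> "\<alpha> ` J"] by (auto simp: parab_root_iff)

lemma parab_pos_or_neg:
  "\<beta> \<in> parab_roots D J \<Longrightarrow> \<beta> \<in> parab_pos_roots D J \<or> - \<beta> \<in> parab_pos_roots D J"
  using pos_or_neg[of \<beta>] span_neg[of \<beta> "\<alpha> ` J"] by (auto simp: parab_pos_root_iff parab_root_iff)

text \<open>Induction on positive roots, with \<open>s\<^bsub>s\<^sub>j\<gamma>\<^esub> = s\<^sub>j s\<^sub>\<gamma> s\<^sub>j\<close>.\<close>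

lemma reflection_in_parab:
  assumes J: "J \<subseteq> {1..DIM('a)}" and b: "\<beta> \<in> parab_roots D J"
  shows "aff_refl \<beta> 0 \<in> gen_group D J"
proof -
  have pos: "aff_refl \<gamma> 0 \<in> gen_group D J" if "\<gamma> \<in> \<Phi>p" "\<gamma> \<in> span (\<alpha> ` J)" for \<gamma>
    using J that
  proof (induction rule: pos_root_induct)
    case (multiple j t)
    then show ?case using J gen_group_srefl[of j J D] srefl_simple[of j] aff_refl_scale[of t "\<alpha> j"] by auto
  next
    case (reflect j \<gamma>)
    then have j: "j \<in> {1..DIM('a)}" using J by blast
    have iso: "isometry (srefl D j)"
      using isometry_aff_refl_0[OF root_ne0[OF simple_root[OF j]]] srefl_simple[OF j] by simp
    have inv: "srefl D j \<circ> srefl D j = id" using srefl_invol j by simp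
    have "aff_refl (srefl D j \<gamma>) 0 = srefl D j \<circ> aff_refl \<gamma> 0 \<circ> srefl D j"
      using isometry_aff_refl[OF iso, of \<gamma> "srefl D j _"] inv by (simp add: fun_eq_iff)
    then show ?case using reflect gen_group_srefl[of j J D] gen_group_comp srefl_simple[OF j] by metis
  qed
  show ?thesis using parab_pos_or_neg[OF b] pos[of \<beta>] pos[of "- \<beta>"] aff_refl_minus[of \<beta>]
    by (auto simp: parab_pos_root_iff)
qed

lemma parab_all: "parab_roots D {1..DIM('a)} = \<Phi>"
  using span_simple by (auto simp: parab_roots_def)

lemma reflection_in_weyl: "\<beta> \<in> \<Phi> \<Longrightarrow> aff_refl \<beta> 0 \<in> weyl D"
  using reflection_in_parab[OF subset_refl] parab_all by simp

text \<open>\<open>W\<^sub>0\<close> acts faithfully on the finite spanning set \<open>\<Phi>\<close>.\<close>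

lemma finite_weyl: "finite (weyl D)"
proof -
  have "inj_on (\<lambda>u. restrict u \<Phi>) (weyl D)"
  proof (rule inj_onI)
    fix u v assume uv: "u \<in> weyl D" "v \<in> weyl D" "restrict u \<Phi> = restrict v \<Phi>"
    have lin: "linear u" "linear v" using uv weyl_isometry isometry_linear by blast+
    have "u b = v b" if "b \<in> \<Phi>" for b using uv(3) that by (metis restrict_apply')
    then have "u x = v x" for x
      using linear_eq_on[OF lin, of x \<Phi>] span_roots by simp
    then show "u = v" by blast
  qed
  moreover have "(\<lambda>u. restrict u \<Phi>) ` weyl D \<subseteq> \<Phi> \<rightarrow>\<^sub>E \<Phi>" by (auto simp: weyl_root)
  then have "finite ((\<lambda>u. restrict u \<Phi>) ` weyl D)"
    using finite_PiE[OF finite_roots, of "\<lambda>_. \<Phi>"] finite_roots finite_subset by blast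
  ultimately show ?thesis using finite_imageD by blast
qed

section \<open>The coweight lattice and the extended affine Weyl group\<close>

lemma coweights_iff: "\<mu> \<in> coweights D \<longleftrightarrow> (\<forall>i\<in>{1..DIM('a)}. \<mu> \<bullet> \<alpha> i \<in> \<int>)"
proof
  assume "\<mu> \<in> coweights D"
  then show "\<forall>i\<in>{1..DIM('a)}. \<mu> \<bullet> \<alpha> i \<in> \<int>" unfolding coweights_def
    by (induction rule: group_closure.induct) (auto simp: fund_coweight_simple inner_diff_left)
next
  assume *: "\<forall>i\<in>{1..DIM('a)}. \<mu> \<bullet> \<alpha> i \<in> \<int>"
  let ?G = "group_closure (\<omega> ` {1..DIM('a)})"
  have sum: "(\<Sum>i\<in>A. (\<mu> \<bullet> \<alpha> i) *\<^sub>R \<omega> i) \<in> ?G" if "A \<subseteq> {1..DIM('a)}" for A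
    using finite_subset[OF that finite_atLeastAtMost] that
  proof (induction rule: finite_induct)
    case (insert i A)
    then obtain k where "\<mu> \<bullet> \<alpha> i = of_int k" using * by (metis Ints_cases insert_subset)
    moreover have "\<omega> i \<in> ?G" using insert.prems by (intro group_closure.base) auto
    ultimately show ?case using insert group_closure_scale_int[of "\<omega> i" _ k] by (auto intro: group_closure_add)
  qed simp
  show "\<mu> \<in> coweights D" unfolding coweights_def using sum[OF subset_refl] coweight_expand[of \<mu>] by simp
qed

lemma coweight_root:
  assumes "\<mu> \<in> coweights D" "\<beta> \<in> \<Phi>" shows "\<mu> \<bullet> \<beta> \<in> \<int>"
proof -
  have "\<beta> \<bullet> \<mu> = (\<Sum>i\<in>{1..DIM('a)}. (\<beta> \<bullet> \<omega> i) * (\<alpha> i \<bullet> \<mu>))" by (rule inner_simple_expand)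
  moreover have "(\<beta> \<bullet> \<omega> i) * (\<alpha> i \<bullet> \<mu>) \<in> \<int>" if "i \<in> {1..DIM('a)}" for i
    using assms root_coord_Ints that coweights_iff[of \<mu>] by (auto simp: inner_commute[of _ \<mu>] intro: Ints_mult)
  ultimately show ?thesis by (metis (no_types, lifting) Ints_sum inner_commute)
qed

lemma coweights_add: "\<mu> \<in> coweights D \<Longrightarrow> \<nu> \<in> coweights D \<Longrightarrow> \<mu> + \<nu> \<in> coweights D"
  by (simp add: coweights_def group_closure_add)

lemma coweights_0: "0 \<in> coweights D"
  by (simp add: coweights_def)

lemma weyl_coweight:
  assumes "u \<in> weyl D" "\<mu> \<in> coweights D" shows "u \<mu> \<in> coweights D"
proof -
  obtain v where v: "v \<in> weyl D" "\<And>x y. u x \<bullet> y = x \<bullet> v y" using weyl_inverse[OF assms(1)] by metis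
  then show ?thesis using assms(2) coweight_root weyl_root simple_root unfolding coweights_iff[of "u \<mu>"] by metis
qed

lemma coroot_coweight: "\<beta> \<in> \<Phi> \<Longrightarrow> coroot \<beta> \<in> coweights D"
  unfolding coweights_iff using coroot_integral[of \<beta>] simple_root by (metis inner_commute)

text \<open>A simple reflection moves a coweight by an integer multiple of a coroot. This is why \<open>\<zeta>\<^sub>J\<close> does not see the
  \<open>W\<^sub>J\<close>-part of an element.\<close>

lemma parab_weyl_coweight_diff:
  assumes J: "J \<subseteq> {1..DIM('a)}" and "y \<in> gen_group D J" "\<mu> \<in> coweights D"
  shows "y \<mu> - \<mu> \<in> parab_coroot_lattice D J"
  using assms(2)
proof (induction rule: gen_group_induct)
  case id
  show ?case by (simp add: parab_coroot_lattice_def)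
next
  case (step j y)
  let ?G = "parab_coroot_lattice D J"
  have j: "j \<in> {1..DIM('a)}" using step J by blast
  have base: "coroot (\<alpha> j) \<in> ?G"
    unfolding parab_coroot_lattice_def
    by (intro group_closure.base insertI2 imageI)
      (use simple_root[OF j] step.hyps(1) in \<open>auto simp: parab_root_iff intro: span_base\<close>)
  have "y \<mu> \<in> coweights D" using weyl_coweight assms(3) weyl_sub[OF J] step.hyps(2) by blast
  then obtain k where k: "y \<mu> \<bullet> \<alpha> j = of_int k" using coweights_iff j by (metis Ints_cases)
  have "(srefl D j \<circ> y) \<mu> - \<mu> = (y \<mu> - \<mu>) - of_int k *\<^sub>R coroot (\<alpha> j)"
    using k by (simp add: srefl_simple[OF j] aff_refl_def)
  then show ?case
    using step.IH group_closure_scale_int[OF base[unfolded parab_coroot_lattice_def], of k]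
    unfolding parab_coroot_lattice_def by (metis group_closure.diff)
qed

lemma ext_weylI: "\<mu> \<in> coweights D \<Longrightarrow> u \<in> weyl D \<Longrightarrow> (+) \<mu> \<circ> u \<in> ext_weyl D"
  by (auto simp: ext_weyl_def)

lemma weyl_zero: "u \<in> weyl D \<Longrightarrow> u 0 = 0"
  using weyl_isometry isometry_linear linear_0 by blast

lemma decomp_unique:
  assumes "\<mu> \<in> coweights D" "u \<in> weyl D" "\<nu> \<in> coweights D" "v \<in> weyl D" "(+) \<mu> \<circ> u = (+) \<nu> \<circ> v"
  shows "\<mu> = \<nu>" "u = v"
proof -
  have e: "\<mu> + u x = \<nu> + v x" for x using assms(5) by (metis comp_apply)
  show "\<mu> = \<nu>" using e[of 0] weyl_zero[OF assms(2)] weyl_zero[OF assms(4)] by simp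
  with e show "u = v" by auto
qed

lemma wt_lin_eq:
  assumes "\<mu> \<in> coweights D" "u \<in> weyl D"
  shows "wt D ((+) \<mu> \<circ> u) = \<mu>" "lin D ((+) \<mu> \<circ> u) = u"
proof -
  show "wt D ((+) \<mu> \<circ> u) = \<mu>" unfolding wt_def
  proof (rule the_equality)
    show "\<nu> = \<mu>" if "\<nu> \<in> coweights D \<and> (\<exists>v\<in>weyl D. (+) \<mu> \<circ> u = (+) \<nu> \<circ> v)" for \<nu>
      using that decomp_unique(1)[OF assms] by metis
  qed (use assms in blast)
  show "lin D ((+) \<mu> \<circ> u) = u" unfolding lin_def
  proof (rule the_equality)
    show "v = u" if "v \<in> weyl D \<and> (\<exists>\<nu>\<in>coweights D. (+) \<mu> \<circ> u = (+) \<nu> \<circ> v)" for v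
      using that decomp_unique(2)[OF assms] by metis
  qed (use assms in blast)
qed

lemma ext_decomp:
  assumes "w \<in> ext_weyl D"
  shows "wt D w \<in> coweights D" "lin D w \<in> weyl D" "w x = wt D w + lin D w x"
proof -
  obtain \<mu> u where "\<mu> \<in> coweights D" "u \<in> weyl D" "w = (+) \<mu> \<circ> u" using assms by (auto simp: ext_weyl_def)
  then show "wt D w \<in> coweights D" "lin D w \<in> weyl D" "w x = wt D w + lin D w x"
    using wt_lin_eq[of \<mu> u] by simp_all
qed

lemma ext_comp:
  assumes "w \<in> ext_weyl D" "g \<in> ext_weyl D"
  shows "w \<circ> g \<in> ext_weyl D" "wt D (w \<circ> g) = wt D w + lin D w (wt D g)"
    "lin D (w \<circ> g) = lin D w \<circ> lin D g"
proof -
  note d = ext_decomp[OF assms(1)] ext_decomp[OF assms(2)]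
  have "lin D w (a + b) = lin D w a + lin D w b" for a b
    using d(2) weyl_isometry isometry_linear linear_add by blast
  then have e: "w \<circ> g = (+) (wt D w + lin D w (wt D g)) \<circ> (lin D w \<circ> lin D g)"
    using d by (simp add: fun_eq_iff add.assoc)
  have c: "wt D w + lin D w (wt D g) \<in> coweights D" "lin D w \<circ> lin D g \<in> weyl D"
    using d coweights_add weyl_coweight gen_group_comp by blast+
  show "w \<circ> g \<in> ext_weyl D" unfolding e by (rule ext_weylI[OF c])
  show "wt D (w \<circ> g) = wt D w + lin D w (wt D g)" "lin D (w \<circ> g) = lin D w \<circ> lin D g"
    unfolding e by (rule wt_lin_eq[OF c])+
qed

lemma weyl_ext:
  assumes "u \<in> weyl D" shows "u \<in> ext_weyl D" "wt D u = 0" "lin D u = u"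
proof -
  have e: "u = (+) 0 \<circ> u" by (simp add: fun_eq_iff)
  show "u \<in> ext_weyl D" by (subst e) (rule ext_weylI[OF coweights_0 assms])
  show "wt D u = 0" "lin D u = u" by (subst e, rule wt_lin_eq[OF coweights_0 assms])+
qed

lemma srefl_ext:
  assumes "i \<in> {0..DIM('a)}" shows "srefl D i \<in> ext_weyl D"
proof (cases "i = 0")
  case True
  have "srefl D 0 = (+) (coroot \<phi>) \<circ> aff_refl \<phi> 0"
    by (simp add: srefl_def aff_refl_def fun_eq_iff scaleR_diff_left)
  then show ?thesis using True ext_weylI coroot_coweight reflection_in_weyl highest_root by metis
next
  case False
  then show ?thesis using assms gen_group_srefl weyl_ext(1) by (metis atLeastAtMost_iff less_one linorder_not_less)
qed

lemma ext_id: "id \<in> ext_weyl D"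
  using weyl_ext(1) gen_group_id by blast

lemma affine_weyl_ext: "w \<in> affine_weyl D \<Longrightarrow> w \<in> ext_weyl D"
  by (induction rule: gen_group_induct) (blast intro: ext_comp(1) srefl_ext ext_id)+

lemma weyl_affine: "u \<in> weyl D \<Longrightarrow> u \<in> affine_weyl D"
  using gen_group_mono[of "{1..DIM('a)}" "{0..DIM('a)}" D] by auto

lemma alcove_stab_ext: "\<sigma> \<in> alcove_stab D \<Longrightarrow> \<sigma> \<in> ext_weyl D"
  by (simp add: alcove_stab_def)

text \<open>Translations by coweights shift the level of an affine root by an integer, and linear parts permute \<open>\<Phi>\<close>.\<close>

lemma ext_pullback:
  assumes "w \<in> ext_weyl D" "\<beta> \<in> \<Phi>"
  shows "\<exists>\<gamma>\<in>\<Phi>. \<exists>l::int. lin D w \<gamma> = \<beta> \<and> (\<forall>x. w x \<bullet> \<beta> + of_int k = x \<bullet> \<gamma> + of_int l)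
    \<and> of_int l = wt D w \<bullet> \<beta> + of_int k"
proof -
  note d = ext_decomp[OF assms(1)]
  obtain v where v: "v \<in> weyl D" "\<And>x. lin D w (v x) = x" "\<And>x y. lin D w x \<bullet> y = x \<bullet> v y"
    using weyl_inverse[OF d(2)] by metis
  obtain m where m: "wt D w \<bullet> \<beta> = of_int m" using coweight_root[OF d(1) assms(2)] by (rule Ints_cases)
  have "w x \<bullet> \<beta> + of_int k = x \<bullet> v \<beta> + of_int (k + m)" for x
    using d(3) v(3) m by (simp add: inner_add_left)
  then show ?thesis using v weyl_root assms(2) m
    by (intro bexI[of _ "v \<beta>"] exI[of _ "k + m"]) auto
qed

section \<open>Signs of affine roots\<close>

text \<open>A multiple of the sum of the fundamental coweights, scaled so that every positive root takes a value strictly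
  between \<open>0\<close> and \<open>1\<close>. No affine root vanishes at this point, so the side of a hyperplane on which \<open>w A\<^sub>0\<close> lies is the
  side on which \<open>w x0\<close> lies.\<close>

definition x0 :: 'a where "x0 = (1 / (1 + ht \<phi>)) *\<^sub>R (\<Sum>i\<in>{1..DIM('a)}. \<omega> i)"

lemma x0_inner: "x0 \<bullet> \<beta> = ht \<beta> / (1 + ht \<phi>)"
  by (simp add: x0_def ht_def inner_sum_right inner_commute[of _ \<beta>])

lemma ht_le_highest: assumes "\<beta> \<in> \<Phi>" shows "ht \<beta> \<le> ht \<phi>"
proof -
  have "ht (\<phi> - \<beta>) \<ge> 0"
    using highest_root_ge[OF assms] cone_coord_nonneg unfolding ht_def by (intro sum_nonneg) blast
  then show ?thesis using ht_diff_scale[of \<phi> 1 \<beta>] by simp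
qed

lemma x0_pos:
  assumes "\<beta> \<in> \<Phi>p" shows "0 < x0 \<bullet> \<beta>" "x0 \<bullet> \<beta> < 1"
  using ht_pos_root[OF assms] ht_le_highest[OF pos_rootD(1)[OF assms]] by (simp_all add: x0_inner)

lemma x0_abs: "\<beta> \<in> \<Phi> \<Longrightarrow> x0 \<bullet> \<beta> \<noteq> 0 \<and> \<bar>x0 \<bullet> \<beta>\<bar> < 1"
  using pos_or_neg[of \<beta>] x0_pos[of \<beta>] x0_pos[of "- \<beta>"] by auto

lemma x0_sign: "\<beta> \<in> \<Phi> \<Longrightarrow> 0 < x0 \<bullet> \<beta> \<longleftrightarrow> \<beta> \<in> \<Phi>p"
  using pos_or_neg[of \<beta>] x0_pos(1)[of \<beta>] x0_pos(1)[of "- \<beta>"] by auto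

lemma x0_mem: "x0 \<in> fund_alcove D"
  using x0_pos by (auto simp: fund_alcove_def less_imp_le)

lemma aff_pos_iff:
  assumes "\<beta> \<in> \<Phi>"
  shows "0 < x0 \<bullet> \<beta> + of_int k \<longleftrightarrow> k \<ge> 1 \<or> k = 0 \<and> \<beta> \<in> \<Phi>p"
proof -
  have "of_int k \<ge> (1::real) \<or> k = 0 \<or> of_int k \<le> (-1::real)" by linarith
  then show ?thesis using x0_abs[OF assms] x0_sign[OF assms] by auto
qed

lemma aff_ne0: "\<beta> \<in> \<Phi> \<Longrightarrow> x0 \<bullet> \<beta> + of_int k \<noteq> 0"
proof -
  assume "\<beta> \<in> \<Phi>"
  have "of_int k \<ge> (1::real) \<or> k = 0 \<or> of_int k \<le> (-1::real)" by linarith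
  then show ?thesis using x0_abs[OF \<open>\<beta> \<in> \<Phi>\<close>] by auto
qed

lemma alcove_root_bound:
  assumes "\<beta> \<in> \<Phi>" "x \<in> fund_alcove D" shows "\<bar>x \<bullet> \<beta>\<bar> \<le> 1"
proof -
  have "\<forall>\<gamma>\<in>\<Phi>p. 0 \<le> x \<bullet> \<gamma> \<and> x \<bullet> \<gamma> \<le> 1" using assms(2) by (simp add: fund_alcove_def)
  then show ?thesis using pos_or_neg[OF assms(1)] by (metis abs_minus_cancel abs_of_nonneg inner_minus_right)
qed

lemma aff_nonneg:
  assumes "\<beta> \<in> \<Phi>" "x \<in> fund_alcove D" "0 < x0 \<bullet> \<beta> + of_int k"
  shows "0 \<le> x \<bullet> \<beta> + of_int k"
proof (cases "k \<ge> 1")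
  case True
  then have "of_int k \<ge> (1::real)" by simp
  then show ?thesis using alcove_root_bound[OF assms(1,2)] by linarith
next
  case False
  then show ?thesis using assms aff_pos_iff[OF assms(1)] by (auto simp: fund_alcove_def)
qed

lemma ext_ne0:
  assumes "w \<in> ext_weyl D" "\<beta> \<in> \<Phi>" shows "w x0 \<bullet> \<beta> + of_int k \<noteq> 0"
proof -
  obtain \<gamma> l where g: "\<gamma> \<in> \<Phi>" "lin D w \<gamma> = \<beta>" "\<forall>x. w x \<bullet> \<beta> + of_int k = x \<bullet> \<gamma> + of_int l"
    "of_int l = wt D w \<bullet> \<beta> + of_int k"
    using ext_pullback[OF assms(1,2), of k] by blast
  show ?thesis unfolding g(3)[rule_format] by (rule aff_ne0[OF g(1)])
qed

lemma ext_nonneg: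
  assumes "w \<in> ext_weyl D" "\<beta> \<in> \<Phi>" "x \<in> fund_alcove D" "0 < w x0 \<bullet> \<beta> + of_int k"
  shows "0 \<le> w x \<bullet> \<beta> + of_int k"
proof -
  obtain \<gamma> l where g: "\<gamma> \<in> \<Phi>" "lin D w \<gamma> = \<beta>" "\<forall>x. w x \<bullet> \<beta> + of_int k = x \<bullet> \<gamma> + of_int l"
    "of_int l = wt D w \<bullet> \<beta> + of_int k"
    using ext_pullback[OF assms(1,2), of k] by blast
  show ?thesis using aff_nonneg[OF g(1) assms(3), of l] assms(4) unfolding g(3)[rule_format] .
qed

lemma ext_nonpos:
  assumes "w \<in> ext_weyl D" "\<beta> \<in> \<Phi>" "x \<in> fund_alcove D" "w x0 \<bullet> \<beta> + of_int k < 0"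
  shows "w x \<bullet> \<beta> + of_int k \<le> 0"
  using ext_nonneg[OF assms(1) neg_root[OF assms(2)] assms(3), of "- k"] assms(4) by simp

lemma upper_side_iff:
  assumes "w \<in> ext_weyl D" "\<beta> \<in> \<Phi>"
  shows "w ` fund_alcove D \<subseteq> upper_side \<beta> k \<longleftrightarrow> of_int k < w x0 \<bullet> \<beta>"
proof
  assume "w ` fund_alcove D \<subseteq> upper_side \<beta> k"
  then have "w x0 \<bullet> \<beta> \<ge> of_int k" using x0_mem by (auto simp: upper_side_def)
  then show "of_int k < w x0 \<bullet> \<beta>" using ext_ne0[OF assms, of "- k"] by simp
next
  assume "of_int k < w x0 \<bullet> \<beta>"
  then show "w ` fund_alcove D \<subseteq> upper_side \<beta> k"
    using ext_nonneg[OF assms, of _ "- k"] by (auto simp: upper_side_def)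
qed

lemma lower_side_iff:
  assumes "w \<in> ext_weyl D" "\<beta> \<in> \<Phi>"
  shows "w ` fund_alcove D \<subseteq> lower_side \<beta> k \<longleftrightarrow> w x0 \<bullet> \<beta> < of_int k"
proof
  assume "w ` fund_alcove D \<subseteq> lower_side \<beta> k"
  then have "w x0 \<bullet> \<beta> \<le> of_int k" using x0_mem by (auto simp: lower_side_def)
  then show "w x0 \<bullet> \<beta> < of_int k" using ext_ne0[OF assms, of "- k"] by simp
next
  assume "w x0 \<bullet> \<beta> < of_int k"
  then show "w ` fund_alcove D \<subseteq> lower_side \<beta> k"
    using ext_nonpos[OF assms, of _ "- k"] by (auto simp: lower_side_def)
qed

section \<open>Walls of alcoves\<close>

text \<open>The \<open>i\<close>-th simple affine root is \<open>\<eta>\<^sub>i + \<kappa>\<^sub>i\<delta>\<close>.\<close>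

abbreviation \<eta> :: "nat \<Rightarrow> 'a" where "\<eta> i \<equiv> fst (affine_simple D i)"
abbreviation \<kappa> :: "nat \<Rightarrow> int" where "\<kappa> i \<equiv> snd (affine_simple D i)"

lemma eta_root: "i \<in> {0..DIM('a)} \<Longrightarrow> \<eta> i \<in> \<Phi>"
  using neg_root[OF highest_root] simple_root[of i] by (auto simp: affine_simple_def)

lemma srefl_formula: "srefl D i x = x - (x \<bullet> \<eta> i + of_int (\<kappa> i)) *\<^sub>R coroot (\<eta> i)"
  by (auto simp: srefl_def affine_simple_def aff_refl_def coroot_minus scaleR_diff_left scaleR_add_left)

lemma srefl_eta:
  assumes "i \<in> {0..DIM('a)}"
  shows "srefl D i x \<bullet> \<eta> i + of_int (\<kappa> i) = - (x \<bullet> \<eta> i + of_int (\<kappa> i))"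
proof -
  have "coroot (\<eta> i) \<bullet> \<eta> i = 2" using root_ne0[OF eta_root[OF assms]] by (simp add: coroot_def)
  then show ?thesis by (simp add: srefl_formula inner_diff_left algebra_simps)
qed

lemma eta_pos: "i \<in> {0..DIM('a)} \<Longrightarrow> 0 < x0 \<bullet> \<eta> i + of_int (\<kappa> i)"
  using aff_pos_iff[OF eta_root, of i "\<kappa> i"] simple_pos[of i] by (auto simp: affine_simple_def)

text \<open>The affine form of \<open>refl_simple_pos\<close>; a positive multiple has to be allowed in type \<open>BC\<close>. For \<open>i > 0\<close> the level \<open>k\<close>
  is unchanged by \<open>s\<^sub>i\<close>; a nonzero level would determine the sign, so \<open>k = 0\<close> and the finite case
  applies. For \<open>i = 0\<close> the affine root \<open>\<beta> + k\<delta>\<close> becomes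
  \<open>(\<beta> - M\<phi>) + (k + M)\<delta>\<close>, where \<open>M = \<langle>\<beta>, \<phi>\<^sup>\<or>\<rangle>\<close> is \<open>0\<close> or \<open>\<plusminus>1\<close> unless \<open>\<beta> = \<plusminus>\<phi>\<close>; only \<open>-\<phi> + \<delta>\<close> turns negative.\<close>

lemma simple_wall:
  assumes i: "i \<in> {0..DIM('a)}" and b: "\<beta> \<in> \<Phi>"
    and pos: "0 < x0 \<bullet> \<beta> + of_int k" and neg: "srefl D i x0 \<bullet> \<beta> + of_int k < 0"
  shows "\<exists>t>0. \<beta> = t *\<^sub>R \<eta> i \<and> of_int k = t * of_int (\<kappa> i)"
proof (cases "i = 0")
  case False
  then have iI: "i \<in> {1..DIM('a)}" and e: "\<eta> i = \<alpha> i" "\<kappa> i = 0" using i by (auto simp: affine_simple_def)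
  let ?\<gamma> = "aff_refl (\<alpha> i) 0 \<beta>"
  have g: "?\<gamma> \<in> \<Phi>" using refl_root[OF simple_root[OF iI] b] .
  have "srefl D i x0 \<bullet> \<beta> = x0 \<bullet> ?\<gamma>"
    by (simp add: srefl_simple[OF iI] aff_refl_def coroot_def inner_diff_left inner_diff_right inner_commute)
  then have n: "\<not> (k \<ge> 1 \<or> k = 0 \<and> ?\<gamma> \<in> \<Phi>p)" using neg aff_pos_iff[OF g, of k] by simp
  then have "k = 0" "\<beta> \<in> \<Phi>p" "?\<gamma> \<notin> \<Phi>p" using pos aff_pos_iff[OF b, of k] by auto
  then show ?thesis using refl_simple_pos[OF _ iI, of \<beta>] e by auto
next
  case True
  have e: "\<eta> i = - \<phi>" "\<kappa> i = 1" using True by (auto simp: affine_simple_def)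
  obtain M where M: "\<beta> \<bullet> coroot \<phi> = of_int M" using coroot_integral[OF highest_root b] by (rule Ints_cases)
  let ?\<gamma> = "\<beta> - of_int M *\<^sub>R \<phi>"
  have g: "?\<gamma> \<in> \<Phi>" using refl_root[OF highest_root b] M by (simp add: aff_refl_0)
  have "srefl D i x0 \<bullet> \<beta> + of_int k = x0 \<bullet> ?\<gamma> + of_int (k + M)"
    using M True by (simp add: srefl_def aff_refl_def inner_diff_left inner_diff_right inner_commute algebra_simps)
  then have n: "\<not> (k + M \<ge> 1 \<or> k + M = 0 \<and> ?\<gamma> \<in> \<Phi>p)" using neg aff_pos_iff[OF g, of "k + M"] by simp
  have p: "k \<ge> 1 \<or> k = 0 \<and> \<beta> \<in> \<Phi>p" using pos aff_pos_iff[OF b, of k] by simp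
  have self: "\<phi> \<bullet> coroot \<phi> = 2" using root_ne0[OF highest_root] by (simp add: coroot_def)
  consider "\<beta> = \<phi>" | "\<beta> = - \<phi>" | "\<beta> \<in> \<Phi>p" "\<beta> \<noteq> \<phi>" | "- \<beta> \<in> \<Phi>p" "- \<beta> \<noteq> \<phi>"
    using pos_or_neg[OF b] by (metis minus_minus)
  then show ?thesis
  proof cases
    case 1
    then have "real_of_int M = real_of_int 2" using self M by simp
    then have "M = 2" by (simp only: of_int_eq_iff)
    then show ?thesis using n p by auto
  next
    case 2
    then have "real_of_int M = real_of_int (-2)" using self M by simp
    then have M2: "M = -2" by (simp only: of_int_eq_iff)
    then have "?\<gamma> = \<phi>" using 2 by (simp add: scaleR_2)
    then have "k = 1" using n p M2 highest_root_pos not_both_pos[OF highest_root_pos] 2 by auto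
    then show ?thesis using 2 e by (intro exI[of _ 1]) auto
  next
    case 3
    have "M = 0 \<or> M = 1" using highest_coroot_pairing[OF 3] M by auto
    then show ?thesis using n p by auto
  next
    case 4
    have k: "k \<ge> 1" using p 4 not_both_pos by auto
    have "M = 0 \<or> real_of_int M = real_of_int (-1)" using highest_coroot_pairing[OF 4] M by auto
    then have "M = 0 \<or> M = -1" by (simp only: of_int_eq_iff)
    moreover have "M \<noteq> 0" using n k by auto
    ultimately have "M = -1" by simp
    then have e\<gamma>: "?\<gamma> = \<phi> - - \<beta>" by simp
    have "?\<gamma> \<in> cone" unfolding e\<gamma> by (rule highest_root_ge[OF neg_root[OF b]])
    then have "?\<gamma> \<in> \<Phi>p" using g by (simp only: pos_roots_def Int_iff simp_thms)
    then show ?thesis using n k \<open>M = -1\<close> by auto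
  qed
qed

lemma ext_wall:
  assumes w: "w \<in> ext_weyl D" and i: "i \<in> {0..DIM('a)}" and b: "\<beta> \<in> \<Phi>"
    and pos: "0 < w x0 \<bullet> \<beta> + of_int k" and neg: "(w \<circ> srefl D i) x0 \<bullet> \<beta> + of_int k < 0"
  obtains t where "t > 0" "\<beta> = t *\<^sub>R lin D w (\<eta> i)" "wt D w \<bullet> \<beta> + of_int k = t * of_int (\<kappa> i)"
    "\<And>x. w x \<bullet> \<beta> + of_int k = t * (x \<bullet> \<eta> i + of_int (\<kappa> i))"
proof -
  obtain \<gamma> l where g: "\<gamma> \<in> \<Phi>" "lin D w \<gamma> = \<beta>" "\<forall>x. w x \<bullet> \<beta> + of_int k = x \<bullet> \<gamma> + of_int l"
    "of_int l = wt D w \<bullet> \<beta> + of_int k"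
    using ext_pullback[OF w b, of k] by blast
  obtain t where t: "t > 0" "\<gamma> = t *\<^sub>R \<eta> i" "of_int l = t * of_int (\<kappa> i)"
    using simple_wall[OF i g(1), of l] pos neg unfolding comp_apply g(3)[rule_format] by blast
  have "linear (lin D w)" using ext_decomp(2)[OF w] weyl_isometry isometry_linear by blast
  then have "\<beta> = t *\<^sub>R lin D w (\<eta> i)" using g t by (simp add: linear_scale)
  moreover have "w x \<bullet> \<beta> + of_int k = t * (x \<bullet> \<eta> i + of_int (\<kappa> i))" for x
    using g(3)[rule_format, of x] t by (simp add: algebra_simps)
  ultimately show thesis using that t g(4) by simp
qed

section \<open>The exchange condition and lengths\<close>

lemma sign_change_in_word:
  assumes "js \<in> lists {0..DIM('a)}" "\<beta> \<in> \<Phi>"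
    "0 < x0 \<bullet> \<beta> + of_int k" "word_prod D js x0 \<bullet> \<beta> + of_int k < 0"
  obtains as i bs where "js = as @ i # bs" "0 < word_prod D as x0 \<bullet> \<beta> + of_int k"
    "(word_prod D as \<circ> srefl D i) x0 \<bullet> \<beta> + of_int k < 0"
proof -
  have "\<exists>as i bs. js = as @ i # bs \<and> 0 < word_prod D as x0 \<bullet> \<beta> + of_int k
      \<and> (word_prod D as \<circ> srefl D i) x0 \<bullet> \<beta> + of_int k < 0"
    using assms(1,4)
  proof (induction js rule: rev_induct)
    case Nil
    then show ?case using assms(3) by simp
  next
    case (snoc i js)
    show ?case
    proof (cases "word_prod D js x0 \<bullet> \<beta> + of_int k < 0")
      case True
      then obtain as j bs where "js = as @ j # bs" "0 < word_prod D as x0 \<bullet> \<beta> + of_int k"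
        "(word_prod D as \<circ> srefl D j) x0 \<bullet> \<beta> + of_int k < 0" using snoc by auto
      then show ?thesis by (intro exI[of _ as] exI[of _ j] exI[of _ "bs @ [i]"]) simp
    next
      case False
      have "word_prod D js \<in> ext_weyl D" using snoc.prems gen_group_word affine_weyl_ext by auto
      then have "0 < word_prod D js x0 \<bullet> \<beta> + of_int k" using False ext_ne0[OF _ assms(2)] by (meson linorder_neqE_linordered_idom)
      then show ?thesis using snoc.prems by (intro exI[of _ js] exI[of _ i] exI[of _ "[]"]) (simp add: word_prod_append)
    qed
  qed
  then show thesis using that by blast
qed

text \<open>Both sides composed with \<open>g\<^sup>-\<^sup>1\<close> are the reflection in the common wall of \<open>g A\<^sub>0\<close> and \<open>g s\<^sub>i A\<^sub>0\<close>.\<close>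

lemma conjugate_srefl:
  assumes g: "g \<in> ext_weyl D" and i: "i \<in> {0..DIM('a)}" and j: "j \<in> {0..DIM('a)}"
    and "0 < g x0 \<bullet> \<eta> j + of_int (\<kappa> j)" "(g \<circ> srefl D i) x0 \<bullet> \<eta> j + of_int (\<kappa> j) < 0"
  shows "srefl D j \<circ> g = g \<circ> srefl D i"
proof
  fix x
  obtain t where t: "t > 0" "\<eta> j = t *\<^sub>R lin D g (\<eta> i)"
    "\<And>x. g x \<bullet> \<eta> j + of_int (\<kappa> j) = t * (x \<bullet> \<eta> i + of_int (\<kappa> i))"
    using ext_wall[OF g i eta_root[OF j] assms(4,5)] by metis
  have iso: "isometry (lin D g)" using weyl_isometry ext_decomp(2)[OF g] by blast
  have "coroot (\<eta> j) = (1 / t) *\<^sub>R lin D g (coroot (\<eta> i))"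
    using t(1) unfolding t(2) by (simp add: coroot_scale isometry_coroot[OF iso])
  then have "srefl D j (g x) = g x - (x \<bullet> \<eta> i + of_int (\<kappa> i)) *\<^sub>R lin D g (coroot (\<eta> i))"
    using t(1) by (simp add: srefl_formula t(3))
  also have "\<dots> = g (srefl D i x)"
    using ext_decomp(3)[OF g]
    by (simp add: srefl_formula linear_diff[OF isometry_linear[OF iso]] linear_scale[OF isometry_linear[OF iso]])
  finally show "(srefl D j \<circ> g) x = (g \<circ> srefl D i) x" by simp
qed

text \<open>The gallery of \<open>js\<close> starts on the positive side of the \<open>j\<close>-th wall and ends on the negative side; the letter at
  which it crosses is the one to delete.\<close>

lemma exchange:
  assumes js: "js \<in> lists {0..DIM('a)}" and j: "j \<in> {0..DIM('a)}"
    and neg: "word_prod D js x0 \<bullet> \<eta> j + of_int (\<kappa> j) < 0"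
  obtains ks where "ks \<in> lists {0..DIM('a)}" "length js = Suc (length ks)" "srefl D j \<circ> word_prod D js = word_prod D ks"
proof -
  obtain as i bs where d: "js = as @ i # bs" "0 < word_prod D as x0 \<bullet> \<eta> j + of_int (\<kappa> j)"
    "(word_prod D as \<circ> srefl D i) x0 \<bullet> \<eta> j + of_int (\<kappa> j) < 0"
    using sign_change_in_word[OF js eta_root[OF j] eta_pos[OF j] neg] .
  have i: "i \<in> {0..DIM('a)}" and as: "as \<in> lists {0..DIM('a)}" and bs: "bs \<in> lists {0..DIM('a)}"
    using js d(1) by auto
  have "word_prod D as \<in> ext_weyl D" using as gen_group_word affine_weyl_ext by blast
  then have c: "srefl D j \<circ> word_prod D as = word_prod D as \<circ> srefl D i"
    using conjugate_srefl i j d by blast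
  have "srefl D j \<circ> word_prod D js = (srefl D j \<circ> word_prod D as) \<circ> srefl D i \<circ> word_prod D bs"
    by (simp add: d(1) word_prod_append comp_assoc)
  also have "\<dots> = word_prod D as \<circ> (srefl D i \<circ> srefl D i) \<circ> word_prod D bs"
    by (simp add: c comp_assoc)
  also have "\<dots> = word_prod D (as @ bs)" using srefl_invol[OF i] by (simp add: word_prod_append)
  finally show thesis using that[of "as @ bs"] as bs d(1) by auto
qed

text \<open>A nonempty word whose gallery returns to \<open>A\<^sub>0\<close> has to recross the wall of its first letter, and exchange deletes
  two letters.\<close>

lemma affine_weyl_free:
  assumes "w \<in> affine_weyl D" "w x0 \<in> fund_alcove D" shows "w = id"
proof -
  obtain js where js: "js \<in> lists {0..DIM('a)}" "w = word_prod D js" using assms(1) by (auto simp: gen_group_def)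
  have "word_prod D js x0 \<in> fund_alcove D \<Longrightarrow> word_prod D js = id" using js(1)
  proof (induction js rule: length_induct)
    case (1 js)
    show ?case
    proof (cases js)
      case (Cons i ks)
      then have i: "i \<in> {0..DIM('a)}" and ks: "ks \<in> lists {0..DIM('a)}" using "1.prems" by auto
      have e: "word_prod D js \<in> ext_weyl D" using "1.prems" gen_group_word affine_weyl_ext by blast
      have "0 \<le> word_prod D js x0 \<bullet> \<eta> i + of_int (\<kappa> i)"
        using aff_nonneg[OF eta_root[OF i] "1.prems"(1) eta_pos[OF i]] .
      then have "0 < word_prod D js x0 \<bullet> \<eta> i + of_int (\<kappa> i)" using ext_ne0[OF e eta_root[OF i], of "\<kappa> i"] by linarith
      then have "word_prod D ks x0 \<bullet> \<eta> i + of_int (\<kappa> i) < 0"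
        using srefl_eta[OF i, of "word_prod D ks x0"] Cons by simp
      then obtain ls where ls: "ls \<in> lists {0..DIM('a)}" "length ks = Suc (length ls)"
        "srefl D i \<circ> word_prod D ks = word_prod D ls" using exchange[OF ks i] by metis
      then have "word_prod D js = word_prod D ls" using Cons by simp
      then show ?thesis using "1.IH"[rule_format, of ls] "1.prems"(1) ls Cons by simp
    qed simp
  qed
  then show ?thesis using assms js by simp
qed

text \<open>Freeness of the action makes the factorisation of an element of the extended group unique.\<close>

lemma ext_length_affine:
  assumes w: "w \<in> affine_weyl D" and s: "\<sigma> \<in> alcove_stab D"
  shows "ext_length D (w \<circ> \<sigma>) = coxeter_length D w"
proof -
  have unique: "x = w" if x: "x \<in> affine_weyl D" and "\<tau> \<in> alcove_stab D" "w \<circ> \<sigma> = x \<circ> \<tau>" for x \<tau>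
  proof -
    obtain y where y: "y \<in> affine_weyl D" "x \<circ> y = id" "y \<circ> x = id" using gen_group_inverse[OF subset_refl x] .
    have "(y \<circ> w) ` fund_alcove D = (y \<circ> (w \<circ> \<sigma>)) ` fund_alcove D"
      using s by (simp only: alcove_stab_def image_comp[symmetric] mem_Collect_eq)
    also have "\<dots> = ((y \<circ> x) \<circ> \<tau>) ` fund_alcove D" using that by (simp add: comp_assoc)
    also have "\<dots> = fund_alcove D" using y that by (simp add: alcove_stab_def)
    finally have "(y \<circ> w) x0 \<in> fund_alcove D" using x0_mem by blast
    then have "y \<circ> w = id" using affine_weyl_free gen_group_comp[OF y(1) w] by blast
    then show "x = w" using y(2) by (metis comp_assoc comp_id id_comp)
  qed
  have "(THE x. x \<in> affine_weyl D \<and> (\<exists>\<tau>\<in>alcove_stab D. w \<circ> \<sigma> = x \<circ> \<tau>)) = w"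
  proof (rule the_equality)
    show "w \<in> affine_weyl D \<and> (\<exists>\<tau>\<in>alcove_stab D. w \<circ> \<sigma> = w \<circ> \<tau>)" using w s by blast
  qed (use unique in blast)
  then show ?thesis by (simp add: ext_length_def)
qed

lemma id_alcove_stab: "id \<in> alcove_stab D"
  using ext_id by (simp add: alcove_stab_def)

lemma ext_length_affine': "w \<in> affine_weyl D \<Longrightarrow> ext_length D w = coxeter_length D w"
  using ext_length_affine[OF _ id_alcove_stab] by simp

lemma coxeter_length_le: "js \<in> lists {0..DIM('a)} \<Longrightarrow> coxeter_length D (word_prod D js) \<le> length js"
  unfolding coxeter_length_def by (rule Least_le) blast

lemma reduced_word_exists:
  assumes "w \<in> affine_weyl D"
  obtains js where "js \<in> lists {0..DIM('a)}" "word_prod D js = w" "length js = coxeter_length D w"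
proof -
  have "\<exists>k. \<exists>js\<in>lists {0..DIM('a)}. word_prod D js = w \<and> length js = k"
    using assms by (auto simp: gen_group_def)
  from LeastI_ex[OF this] show thesis using that unfolding coxeter_length_def by blast
qed

definition reduced :: "nat list \<Rightarrow> bool" where
  "reduced js \<longleftrightarrow> js \<in> lists {0..DIM('a)} \<and> coxeter_length D (word_prod D js) = length js"

lemma reduced_append:
  assumes "reduced (as @ bs)" shows "reduced as" "reduced bs"
proof -
  have l: "as \<in> lists {0..DIM('a)}" "bs \<in> lists {0..DIM('a)}" using assms by (auto simp: reduced_def)
  obtain cs where c: "cs \<in> lists {0..DIM('a)}" "word_prod D cs = word_prod D as" "length cs = coxeter_length D (word_prod D as)"
    using reduced_word_exists gen_group_word[OF l(1)] by metis
  obtain ds where d: "ds \<in> lists {0..DIM('a)}" "word_prod D ds = word_prod D bs" "length ds = coxeter_length D (word_prod D bs)"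
    using reduced_word_exists gen_group_word[OF l(2)] by metis
  have "length as + length bs = coxeter_length D (word_prod D (cs @ ds))"
    using assms c d by (simp add: reduced_def word_prod_append)
  also have "\<dots> \<le> length cs + length ds" using coxeter_length_le[of "cs @ ds"] c d by simp
  finally have "length as + length bs \<le> length cs + length ds" .
  then show "reduced as" "reduced bs"
    using coxeter_length_le[OF l(1)] coxeter_length_le[OF l(2)] c(3) d(3) l by (auto simp: reduced_def)
qed

end

section \<open>Minimal coset representatives\<close>

locale parabolic = irr_root_datum D for D :: "'a::euclidean_space root_datum" +
  fixes J :: "nat set"
  assumes J: "J \<subseteq> {1..DIM('a)}"
begin

abbreviation WJ :: "('a \<Rightarrow> 'a) set" where "WJ \<equiv> gen_group D J"
abbreviation \<Phi>J :: "'a set" where "\<Phi>J \<equiv> parab_roots D J"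
abbreviation \<Phi>Jp :: "'a set" where "\<Phi>Jp \<equiv> parab_pos_roots D J"

lemma WJ_weyl: "y \<in> WJ \<Longrightarrow> y \<in> weyl D"
  using weyl_sub J by blast

lemma WJ_inverse_comp: "y \<in> WJ \<Longrightarrow> \<exists>z\<in>WJ. y \<circ> z = id \<and> z \<circ> y = id"
proof -
  assume y: "y \<in> WJ"
  have "J \<subseteq> {0..DIM('a)}" using J by auto
  then obtain z where "z \<in> WJ" "y \<circ> z = id" "z \<circ> y = id" using gen_group_inverse y by metis
  then show ?thesis by blast
qed

lemma WJ_root_iff: assumes "y \<in> WJ" shows "y \<beta> \<in> \<Phi>J \<longleftrightarrow> \<beta> \<in> \<Phi>J"
proof -
  obtain z where z: "z \<in> WJ" "z \<circ> y = id"
    using WJ_inverse_comp[OF assms] by blast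
  then have "z (y \<beta>) = \<beta>" by (metis comp_apply id_apply)
  then show ?thesis using parab_weyl_root[OF J] z(1) assms(1) by metis
qed

lemma WJ_inverse:
  assumes "y \<in> WJ"
  obtains z where "z \<in> WJ" "\<forall>x. y (z x) = x" "\<forall>x. z (y x) = x" "\<forall>a b. y a \<bullet> b = a \<bullet> z b"
proof -
  obtain z where z: "z \<in> WJ" "y \<circ> z = id" "z \<circ> y = id"
    using WJ_inverse_comp[OF assms] by blast
  then have yz: "y (z x) = x" "z (y x) = x" for x by (metis comp_apply id_apply)+
  have "y a \<bullet> b = a \<bullet> z b" for a b
    using isometry_inner[OF weyl_isometry[OF WJ_weyl[OF assms]], of a "z b"] yz by simp
  then show thesis using that z(1) yz by blast
qed

text \<open>A simple reflection \<open>s\<^sub>j\<close> with \<open>j \<in> J\<close> makes only multiples of \<open>\<alpha>\<^sub>j\<close> negative, and these lie in \<open>\<Phi>\<^sub>J\<close>.\<close>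

lemma WJ_preserves_outside:
  assumes "y \<in> WJ" "\<beta> \<in> \<Phi>p" "\<beta> \<notin> \<Phi>J" shows "y \<beta> \<in> \<Phi>p"
  using assms(1)
proof (induction rule: gen_group_induct)
  case id
  then show ?case using assms by simp
next
  case (step j y)
  have j: "j \<in> {1..DIM('a)}" using step J by blast
  have "y \<beta> \<notin> \<Phi>J" using WJ_root_iff[OF step.hyps(2)] assms pos_rootD by blast
  moreover have "t *\<^sub>R \<alpha> j \<in> span (\<alpha> ` J)" for t using step.hyps(1) by (intro span_scale span_base) auto
  ultimately have "y \<beta> \<noteq> t *\<^sub>R \<alpha> j" for t
    using pos_rootD(1)[OF step.IH] parab_root_iff by metis
  then show ?case using refl_simple_pos[OF step.IH j] srefl_simple[OF j] by simp
qed

lemma WJ_outside_pos_iff: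
  assumes "y \<in> WJ" "\<beta> \<in> \<Phi>" "\<beta> \<notin> \<Phi>J" shows "y \<beta> \<in> \<Phi>p \<longleftrightarrow> \<beta> \<in> \<Phi>p"
proof (cases "\<beta> \<in> \<Phi>p")
  case True
  then show ?thesis using WJ_preserves_outside assms by blast
next
  case False
  then have "- \<beta> \<in> \<Phi>p" using pos_or_neg assms(2) by blast
  moreover have "- \<beta> \<notin> \<Phi>J" using parab_neg_root[of "- \<beta>"] assms(3) by auto
  ultimately have "y (- \<beta>) \<in> \<Phi>p" using WJ_preserves_outside assms(1) by blast
  moreover have "y (- \<beta>) = - y \<beta>"
    using linear_neg isometry_linear weyl_isometry WJ_weyl assms(1) by blast
  ultimately show ?thesis using False not_both_pos[of "y \<beta>"] by auto
qed

lemma min_reps_weyl: "u \<in> min_reps D J \<Longrightarrow> u \<in> weyl D"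
  by (simp add: min_reps_def)

text \<open>Otherwise exchange would make \<open>s\<^sub>j u\<close> shorter than \<open>u\<close>.\<close>

lemma min_reps_simple_pos:
  assumes u: "u \<in> min_reps D J" and jJ: "j \<in> J" shows "0 < u x0 \<bullet> \<alpha> j"
proof (rule ccontr)
  assume n: "\<not> 0 < u x0 \<bullet> \<alpha> j"
  have j: "j \<in> {1..DIM('a)}" using jJ J by blast
  have ua: "u \<in> affine_weyl D" using weyl_affine min_reps_weyl u by blast
  obtain js where js: "js \<in> lists {0..DIM('a)}" "word_prod D js = u" "length js = coxeter_length D u"
    using reduced_word_exists[OF ua] .
  have "u x0 \<bullet> \<alpha> j \<noteq> 0" using ext_ne0[OF affine_weyl_ext[OF ua] simple_root[OF j], of 0] by simp
  then have "word_prod D js x0 \<bullet> \<eta> j + of_int (\<kappa> j) < 0" using n j js(2) by (simp add: affine_simple_def)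
  then obtain ks where ks: "ks \<in> lists {0..DIM('a)}" "length js = Suc (length ks)" "srefl D j \<circ> u = word_prod D ks"
    using exchange[OF js(1), of j] j js(2) by auto
  have "ext_length D (srefl D j \<circ> u) = coxeter_length D (word_prod D ks)"
    using ext_length_affine'[OF gen_group_word[OF ks(1)]] ks(3) by simp
  also have "\<dots> < ext_length D u" using coxeter_length_le[OF ks(1)] ks(2) js(3) ext_length_affine'[OF ua] by simp
  finally have "ext_length D (srefl D j \<circ> u) < ext_length D u" .
  moreover have "ext_length D u \<le> ext_length D (srefl D j \<circ> u)"
    using u gen_group_srefl[OF jJ, of D] unfolding min_reps_def by blast
  ultimately show False by simp
qed

lemma min_reps_pos:
  assumes u: "u \<in> min_reps D J" and b: "\<beta> \<in> \<Phi>Jp" shows "0 < u x0 \<bullet> \<beta>"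
proof -
  have b': "\<beta> \<in> \<Phi>p" "\<beta> \<in> span (\<alpha> ` J)" using b parab_pos_root_iff by auto
  have c: "\<And>i. i \<in> {1..DIM('a)} \<Longrightarrow> 0 \<le> \<beta> \<bullet> \<omega> i" using cone_coord_nonneg pos_rootD(2)[OF b'(1)] by blast
  have z: "\<And>i. i \<in> {1..DIM('a)} - J \<Longrightarrow> \<beta> \<bullet> \<omega> i = 0" using span_simple_iff[OF J] b'(2) by blast
  have p: "\<And>i. i \<in> J \<Longrightarrow> 0 < \<alpha> i \<bullet> u x0" using min_reps_simple_pos[OF u] by (simp add: inner_commute)
  have "\<exists>i\<in>{1..DIM('a)}. \<beta> \<bullet> \<omega> i \<noteq> 0"
  proof (rule ccontr)
    assume "\<not> ?thesis"
    then have "\<beta> = 0" using simple_expand[of \<beta>] by simp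
    then show False using b'(1) pos_rootD root_ne0 by blast
  qed
  then obtain i where i: "i \<in> {1..DIM('a)}" "\<beta> \<bullet> \<omega> i \<noteq> 0" by blast
  have "0 < (\<Sum>i\<in>{1..DIM('a)}. (\<beta> \<bullet> \<omega> i) * (\<alpha> i \<bullet> u x0))"
  proof (rule sum_pos2[of _ i])
    have "i \<in> J" using i z by blast
    then show "0 < (\<beta> \<bullet> \<omega> i) * (\<alpha> i \<bullet> u x0)" using c[OF i(1)] i(2) p by simp
    show "0 \<le> (\<beta> \<bullet> \<omega> k) * (\<alpha> k \<bullet> u x0)" if "k \<in> {1..DIM('a)}" for k
      using c[OF that] z[of k] p[of k] that by (cases "k \<in> J") auto
  qed (use i in auto)
  then show ?thesis using inner_simple_expand[of \<beta> "u x0"] by (simp add: inner_commute)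
qed

lemma weyl_x0_abs: "u \<in> weyl D \<Longrightarrow> \<beta> \<in> \<Phi> \<Longrightarrow> \<bar>u x0 \<bullet> \<beta>\<bar> < 1"
proof -
  assume u: "u \<in> weyl D" and b: "\<beta> \<in> \<Phi>"
  obtain v where v: "v \<in> weyl D" "\<And>x y. u x \<bullet> y = x \<bullet> v y" using weyl_inverse[OF u] by metis
  then show ?thesis using x0_abs[OF weyl_root[OF v(1) b]] by simp
qed

lemma alcoves_in_iff:
  "w \<in> alcoves_in D J \<longleftrightarrow> w \<in> ext_weyl D \<and> (\<forall>\<beta>\<in>\<Phi>Jp. 0 < w x0 \<bullet> \<beta> \<and> w x0 \<bullet> \<beta> < 1)"
proof (cases "w \<in> ext_weyl D")
  case True
  have "w ` fund_alcove D \<subseteq> J_alcove D J \<longleftrightarrow>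
      (\<forall>\<beta>\<in>\<Phi>Jp. w ` fund_alcove D \<subseteq> upper_side \<beta> 0 \<and> w ` fund_alcove D \<subseteq> lower_side \<beta> 1)"
    by (fastforce simp: J_alcove_def upper_side_def lower_side_def)
  also have "\<dots> \<longleftrightarrow> (\<forall>\<beta>\<in>\<Phi>Jp. 0 < w x0 \<bullet> \<beta> \<and> w x0 \<bullet> \<beta> < 1)"
    using upper_side_iff[OF True, of _ 0] lower_side_iff[OF True, of _ 1]
    by (simp add: parab_pos_root_iff pos_rootD)
  finally show ?thesis using True by (simp add: alcoves_in_def)
qed (simp add: alcoves_in_def)

lemma alcoves_in_ext: "w \<in> alcoves_in D J \<Longrightarrow> w \<in> ext_weyl D"
  by (simp add: alcoves_in_iff)

lemma min_reps_alcoves_in: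
  assumes "u \<in> min_reps D J" shows "u \<in> alcoves_in D J"
  unfolding alcoves_in_iff
proof (intro conjI ballI)
  show "u \<in> ext_weyl D" using weyl_ext min_reps_weyl assms by blast
  fix \<beta> assume b: "\<beta> \<in> \<Phi>Jp"
  show "0 < u x0 \<bullet> \<beta>" using min_reps_pos assms b by blast
  show "u x0 \<bullet> \<beta> < 1"
    using weyl_x0_abs[OF min_reps_weyl[OF assms], of \<beta>] b parab_pos_root_iff pos_rootD by auto
qed

lemma min_rep_exists:
  assumes "u \<in> weyl D"
  obtains x y where "x \<in> min_reps D J" "y \<in> WJ" "u = y \<circ> x"
proof -
  obtain z where z: "z \<in> WJ" "\<And>y. y \<in> WJ \<Longrightarrow> ext_length D (z \<circ> u) \<le> ext_length D (y \<circ> u)"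
    using ex_has_least_nat[of "\<lambda>z. z \<in> WJ" id "\<lambda>z. ext_length D (z \<circ> u)"] gen_group_id by metis
  have "z \<circ> u \<in> min_reps D J"
    unfolding min_reps_def
  proof (intro CollectI conjI ballI)
    show "z \<circ> u \<in> weyl D" using gen_group_comp[OF WJ_weyl[OF z(1)] assms] .
    show "ext_length D (z \<circ> u) \<le> ext_length D (y \<circ> (z \<circ> u))" if "y \<in> WJ" for y
      using z(2)[OF gen_group_comp[OF that z(1)]] by (simp only: comp_assoc)
  qed
  moreover obtain y where y: "y \<in> WJ" "y \<circ> z = id"
    using WJ_inverse_comp[OF z(1)] by blast
  moreover have "u = y \<circ> (z \<circ> u)" using y(2) by (metis comp_assoc id_comp)
  ultimately show thesis using that by blast
qed

text \<open>Two minimal representatives of a coset differ by an element \<open>z\<close> of \<open>W\<^sub>J\<close> that preserves the positive roots: those of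
  \<open>\<Phi>\<^sub>J\<close> by minimality, the others because \<open>z \<in> W\<^sub>J\<close>. Such a \<open>z\<close> stabilises \<open>A\<^sub>0\<close>, hence is trivial.\<close>

lemma min_rep_unique:
  assumes x: "x \<in> min_reps D J" and x': "x' \<in> min_reps D J" and y: "y \<in> WJ" and y': "y' \<in> WJ"
    and eq: "y \<circ> x = y' \<circ> x'"
  shows "x = x'"
proof -
  obtain w where w: "w \<in> WJ" "w \<circ> y' = id" using WJ_inverse_comp[OF y'] by blast
  define z where "z = w \<circ> y"
  have z: "z \<in> WJ" using w y gen_group_comp by (simp add: z_def)
  have x'z: "x' = z \<circ> x" using w(2) eq unfolding z_def by (metis comp_assoc id_comp)
  obtain v where v: "v \<in> WJ" "\<forall>a b. z a \<bullet> b = a \<bullet> v b" using WJ_inverse[OF z] by metis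
  have vpos: "v \<beta> \<in> \<Phi>p" if b: "\<beta> \<in> \<Phi>p" for \<beta>
  proof (cases "\<beta> \<in> \<Phi>J")
    case False
    then show ?thesis using WJ_preserves_outside v b by blast
  next
    case True
    then have "\<beta> \<in> \<Phi>Jp" using b by (simp add: parab_pos_roots_def)
    then have "0 < x x0 \<bullet> v \<beta>" using min_reps_pos[OF x'] v(2) by (simp add: x'z)
    moreover have "v \<beta> \<in> \<Phi>J" using parab_weyl_root[OF J v(1) True] .
    then have "v \<beta> \<in> \<Phi>Jp \<or> - v \<beta> \<in> \<Phi>Jp" by (rule parab_pos_or_neg)
    ultimately show ?thesis using min_reps_pos[OF x, of "- v \<beta>"] parab_pos_root_iff by auto
  qed
  have "z x0 \<in> fund_alcove D"
    unfolding fund_alcove_def using vpos x0_pos v(2) by (auto simp: less_imp_le)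
  then have "z = id" using affine_weyl_free weyl_affine WJ_weyl z by blast
  then show ?thesis using x'z by simp
qed

lemma finite_min_reps: "finite (min_reps D J)"
  using finite_weyl finite_subset[of "min_reps D J" "weyl D"] min_reps_weyl by blast

lemma theta_up_eq:
  assumes "lin D w = y \<circ> x" "y \<in> WJ" "x \<in> min_reps D J"
  shows "theta_up D J w = x"
  unfolding theta_up_def
proof (rule the_equality)
  show "x \<in> min_reps D J \<and> (\<exists>y\<in>WJ. lin D w = y \<circ> x)" using assms by blast
  show "x' = x" if "x' \<in> min_reps D J \<and> (\<exists>y\<in>WJ. lin D w = y \<circ> x')" for x'
    using that min_rep_unique assms by metis
qed

lemma theta_up_decomp:
  assumes "w \<in> ext_weyl D"
  obtains y where "y \<in> WJ" "lin D w = y \<circ> theta_up D J w" "theta_up D J w \<in> min_reps D J"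
proof -
  obtain x y where xy: "x \<in> min_reps D J" "y \<in> WJ" "lin D w = y \<circ> x"
    using min_rep_exists[OF ext_decomp(2)[OF assms]] .
  then show thesis using that[of y] theta_up_eq by simp
qed

lemma theta_up_min_rep: "u \<in> min_reps D J \<Longrightarrow> theta_up D J u = u"
  by (rule theta_up_eq[of _ id]) (simp_all add: weyl_ext min_reps_weyl gen_group_id)

text \<open>If \<open>yu\<close> is the linear part of \<open>v\<close>, with \<open>y \<in> W\<^sub>J\<close> and \<open>u \<in> W\<^sup>J\<close>, then multiplying \<open>vg\<close> out leaves \<open>y\<close> in two
  places: in the \<open>W\<^sub>J\<close>-part of the linear part, and applied to the weight of \<open>ug\<close>, which it moves by an element of \<open>Q\<^sub>J\<close>.\<close>

lemma theta_up_comp: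
  assumes v: "v \<in> ext_weyl D" and g: "g \<in> ext_weyl D"
  shows "theta_up D J (v \<circ> g) = theta_up D J (theta_up D J v \<circ> g)"
    and "wt D (v \<circ> g) - (wt D v + wt D (theta_up D J v \<circ> g)) \<in> parab_coroot_lattice D J"
proof -
  obtain y where y: "y \<in> WJ" "lin D v = y \<circ> theta_up D J v" "theta_up D J v \<in> min_reps D J"
    using theta_up_decomp[OF v] .
  let ?u = "theta_up D J v"
  note u = weyl_ext[OF min_reps_weyl[OF y(3)]]
  obtain z where z: "z \<in> WJ" "lin D (?u \<circ> g) = z \<circ> theta_up D J (?u \<circ> g)" "theta_up D J (?u \<circ> g) \<in> min_reps D J"
    using theta_up_decomp[OF ext_comp(1)[OF u(1) g]] .
  have "lin D (v \<circ> g) = (y \<circ> z) \<circ> theta_up D J (?u \<circ> g)"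
    using z(2) ext_comp(3)[OF v g] ext_comp(3)[OF u(1) g] u(3) y(2) by (metis comp_assoc)
  then show "theta_up D J (v \<circ> g) = theta_up D J (?u \<circ> g)"
    using theta_up_eq z(3) gen_group_comp[OF y(1) z(1)] by blast
  have "?u (wt D g) \<in> coweights D" using weyl_coweight min_reps_weyl y(3) ext_decomp(1)[OF g] by blast
  then have "y (?u (wt D g)) - ?u (wt D g) \<in> parab_coroot_lattice D J"
    using parab_weyl_coweight_diff[OF J y(1)] by blast
  then show "wt D (v \<circ> g) - (wt D v + wt D (?u \<circ> g)) \<in> parab_coroot_lattice D J"
    using ext_comp(2)[OF v g] ext_comp(2)[OF u(1) g] u y(2) by simp
qed

section \<open>Crossings and bounces\<close>

text \<open>The normal of the wall between \<open>w A\<^sub>0\<close> and \<open>w s\<^sub>i A\<^sub>0\<close>, pointing towards \<open>w A\<^sub>0\<close>.\<close>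

abbreviation dir :: "('a \<Rightarrow> 'a) \<Rightarrow> nat \<Rightarrow> 'a" where "dir w i \<equiv> lin D w (\<eta> i)"

lemma dir_root: "w \<in> ext_weyl D \<Longrightarrow> i \<in> {0..DIM('a)} \<Longrightarrow> dir w i \<in> \<Phi>"
  using weyl_root ext_decomp(2) eta_root by blast

lemma wall_equation:
  assumes w: "w \<in> ext_weyl D" and i: "i \<in> {0..DIM('a)}"
  obtains k :: int where "\<forall>x. w x \<bullet> dir w i + of_int k = x \<bullet> \<eta> i + of_int (\<kappa> i)"
    "wt D w \<bullet> dir w i + of_int k = of_int (\<kappa> i)"
    "0 < w x0 \<bullet> dir w i + of_int k" "(w \<circ> srefl D i) x0 \<bullet> dir w i + of_int k < 0"
proof -
  note d = ext_decomp[OF w]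
  obtain m where m: "wt D w \<bullet> dir w i = of_int m" using coweight_root[OF d(1) dir_root[OF w i]] by (rule Ints_cases)
  have e: "w x \<bullet> dir w i + of_int (\<kappa> i - m) = x \<bullet> \<eta> i + of_int (\<kappa> i)" for x
    using m isometry_inner[OF weyl_isometry[OF d(2)], of x "\<eta> i"] by (simp add: d(3)[of x] inner_add_left)
  have "(w \<circ> srefl D i) x0 \<bullet> dir w i + of_int (\<kappa> i - m) < 0"
    using e[of "srefl D i x0"] srefl_eta[OF i, of x0] eta_pos[OF i] by simp
  moreover have "0 < w x0 \<bullet> dir w i + of_int (\<kappa> i - m)" using e[of x0] eta_pos[OF i] by simp
  ultimately show thesis using that[of "\<kappa> i - m"] e m by simp
qed

lemma ext_srefl: "w \<in> ext_weyl D \<Longrightarrow> i \<in> {0..DIM('a)} \<Longrightarrow> w \<circ> srefl D i \<in> ext_weyl D"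
  using ext_comp(1) srefl_ext by blast

lemma sep_wall_iff:
  assumes "w \<in> ext_weyl D" "i \<in> {0..DIM('a)}" "\<gamma> \<in> \<Phi>p"
  shows "sep_wall D w i \<gamma> l \<and> (w \<circ> srefl D i) ` fund_alcove D \<subseteq> lower_side \<gamma> l
      \<longleftrightarrow> of_int l < w x0 \<bullet> \<gamma> \<and> (w \<circ> srefl D i) x0 \<bullet> \<gamma> < of_int l"
    "sep_wall D w i \<gamma> l \<and> w ` fund_alcove D \<subseteq> upper_side \<gamma> l
      \<longleftrightarrow> of_int l < w x0 \<bullet> \<gamma> \<and> (w \<circ> srefl D i) x0 \<bullet> \<gamma> < of_int l"
    "sep_wall D w i \<gamma> l \<and> (w \<circ> srefl D i) ` fund_alcove D \<subseteq> upper_side \<gamma> l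
      \<longleftrightarrow> w x0 \<bullet> \<gamma> < of_int l \<and> of_int l < (w \<circ> srefl D i) x0 \<bullet> \<gamma>"
    "sep_wall D w i \<gamma> l \<and> w ` fund_alcove D \<subseteq> lower_side \<gamma> l
      \<longleftrightarrow> w x0 \<bullet> \<gamma> < of_int l \<and> of_int l < (w \<circ> srefl D i) x0 \<bullet> \<gamma>"
  using assms pos_rootD(1)[OF assms(3)] ext_srefl[OF assms(1,2)]
  unfolding sep_wall_def separates_def
  by (auto simp only: upper_side_iff lower_side_iff)

lemma wall_direction:
  assumes w: "w \<in> ext_weyl D" and i: "i \<in> {0..DIM('a)}" and g: "\<gamma> \<in> \<Phi>"
    and "0 < w x0 \<bullet> \<gamma> + of_int l" "(w \<circ> srefl D i) x0 \<bullet> \<gamma> + of_int l < 0"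
  obtains t where "t > 0" "\<gamma> = t *\<^sub>R dir w i" "wt D w \<bullet> \<gamma> + of_int l = t * of_int (\<kappa> i)"
  using ext_wall[OF assms] by metis

lemma pos_scale_iff:
  assumes "t > 0" "\<gamma> = t *\<^sub>R \<beta>" "\<beta> \<in> \<Phi>" "\<gamma> \<in> \<Phi>"
  shows "\<gamma> \<in> \<Phi>p \<longleftrightarrow> \<beta> \<in> \<Phi>p"
  using x0_sign[OF assms(3)] x0_sign[OF assms(4)] assms(1,2) by (simp add: zero_less_mult_iff)

lemma neg_crossing_iff:
  assumes w: "w \<in> ext_weyl D" and i: "i \<in> {0..DIM('a)}"
  shows "neg_crossing D w i \<longleftrightarrow> dir w i \<in> \<Phi>p"
proof
  assume "neg_crossing D w i"
  then obtain \<gamma> l where g: "sep_wall D w i \<gamma> l \<and> (w \<circ> srefl D i) ` fund_alcove D \<subseteq> lower_side \<gamma> l"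
    unfolding neg_crossing_def by blast
  then have gp: "\<gamma> \<in> \<Phi>p" by (simp add: sep_wall_def)
  have "of_int l < w x0 \<bullet> \<gamma> \<and> (w \<circ> srefl D i) x0 \<bullet> \<gamma> < of_int l"
    using g sep_wall_iff(1)[OF w i gp] by blast
  then obtain t where "t > 0" "\<gamma> = t *\<^sub>R dir w i"
    using wall_direction[OF w i pos_rootD(1)[OF gp], of "- l"] by auto
  then show "dir w i \<in> \<Phi>p" using pos_scale_iff[OF _ _ dir_root[OF w i]] gp pos_rootD by blast
next
  assume d: "dir w i \<in> \<Phi>p"
  obtain k where "0 < w x0 \<bullet> dir w i + of_int k" "(w \<circ> srefl D i) x0 \<bullet> dir w i + of_int k < 0"
    using wall_equation[OF w i] .
  then have "of_int (- k) < w x0 \<bullet> dir w i \<and> (w \<circ> srefl D i) x0 \<bullet> dir w i < of_int (- k)" by simp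
  then show "neg_crossing D w i" unfolding neg_crossing_def using sep_wall_iff(1)[OF w i d] by blast
qed

lemma pos_crossing_iff:
  assumes w: "w \<in> ext_weyl D" and i: "i \<in> {0..DIM('a)}"
  shows "pos_crossing D w i \<longleftrightarrow> dir w i \<notin> \<Phi>p"
proof
  assume "pos_crossing D w i"
  then obtain \<gamma> l where g: "sep_wall D w i \<gamma> l \<and> (w \<circ> srefl D i) ` fund_alcove D \<subseteq> upper_side \<gamma> l"
    unfolding pos_crossing_def by blast
  then have gp: "\<gamma> \<in> \<Phi>p" by (simp add: sep_wall_def)
  have "w x0 \<bullet> \<gamma> < of_int l \<and> of_int l < (w \<circ> srefl D i) x0 \<bullet> \<gamma>"
    using g sep_wall_iff(3)[OF w i gp] by blast
  then obtain t where "t > 0" "- \<gamma> = t *\<^sub>R dir w i"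
    using wall_direction[OF w i neg_root[OF pos_rootD(1)[OF gp]], of "l"] by auto
  then show "dir w i \<notin> \<Phi>p"
    using pos_scale_iff[OF _ _ dir_root[OF w i] neg_root[OF pos_rootD(1)[OF gp]]] not_both_pos[OF gp] by blast
next
  assume "dir w i \<notin> \<Phi>p"
  then have d: "- dir w i \<in> \<Phi>p" using pos_or_neg dir_root[OF w i] by blast
  obtain k where "0 < w x0 \<bullet> dir w i + of_int k" "(w \<circ> srefl D i) x0 \<bullet> dir w i + of_int k < 0"
    using wall_equation[OF w i] .
  then have "w x0 \<bullet> (- dir w i) < of_int k \<and> of_int k < (w \<circ> srefl D i) x0 \<bullet> (- dir w i)" by simp
  then show "pos_crossing D w i" unfolding pos_crossing_def using sep_wall_iff(3)[OF w i d] by blast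
qed

text \<open>On the interior of the strip the roots of \<open>\<Phi>\<^sub>J\<close> take no integer values, so none of their hyperplanes separates two
  of its alcoves. Conversely, an alcove leaves the strip through a hyperplane of \<open>\<Phi>\<^sub>J\<close>, which is then the wall crossed.\<close>

lemma step_alcoves_in_iff:
  assumes v: "v \<in> alcoves_in D J" and i: "i \<in> {0..DIM('a)}"
  shows "v \<circ> srefl D i \<in> alcoves_in D J \<longleftrightarrow> dir v i \<notin> \<Phi>J"
proof
  assume vs: "v \<circ> srefl D i \<in> alcoves_in D J"
  show "dir v i \<notin> \<Phi>J"
  proof
    assume d: "dir v i \<in> \<Phi>J"
    obtain k where k: "0 < v x0 \<bullet> dir v i + of_int k" "(v \<circ> srefl D i) x0 \<bullet> dir v i + of_int k < 0"
      using wall_equation[OF alcoves_in_ext[OF v] i] .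
    from parab_pos_or_neg[OF d] show False
    proof
      assume "dir v i \<in> \<Phi>Jp"
      then have "v x0 \<bullet> dir v i < 1" "0 < (v \<circ> srefl D i) x0 \<bullet> dir v i" using v vs unfolding alcoves_in_iff by blast+
      then have "real_of_int (- k) < real_of_int 1" "real_of_int 0 < real_of_int (- k)" using k by auto
      then show False unfolding of_int_less_iff by linarith
    next
      assume "- dir v i \<in> \<Phi>Jp"
      then have "0 < v x0 \<bullet> (- dir v i)" "(v \<circ> srefl D i) x0 \<bullet> (- dir v i) < 1" using v vs unfolding alcoves_in_iff by blast+
      then have "real_of_int k < real_of_int 1" "real_of_int 0 < real_of_int k" using k by auto
      then show False unfolding of_int_less_iff by linarith
    qed
  qed
next
  assume d: "dir v i \<notin> \<Phi>J"
  note ve = alcoves_in_ext[OF v]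
  note vse = ext_srefl[OF ve i]
  have no: False if "t > 0" "\<gamma> = t *\<^sub>R dir v i" "\<gamma> \<in> \<Phi>J" for t \<gamma>
    using parab_root_scale[of "1 / t" \<gamma> J] that d dir_root[OF ve i] by simp
  show "v \<circ> srefl D i \<in> alcoves_in D J"
    unfolding alcoves_in_iff
  proof (intro conjI ballI)
    fix \<gamma> assume gJ: "\<gamma> \<in> \<Phi>Jp"
    then have g: "\<gamma> \<in> \<Phi>" "\<gamma> \<in> \<Phi>J" by (auto simp: parab_pos_roots_def parab_roots_def)
    have vg: "0 < v x0 \<bullet> \<gamma>" "v x0 \<bullet> \<gamma> < 1" using v gJ alcoves_in_iff by auto
    show "0 < (v \<circ> srefl D i) x0 \<bullet> \<gamma>"
    proof (rule ccontr)
      assume "\<not> ?thesis"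
      then have "(v \<circ> srefl D i) x0 \<bullet> \<gamma> + of_int 0 < 0" using ext_ne0[OF vse g(1), of 0] by simp
      then obtain t where "t > 0" "\<gamma> = t *\<^sub>R dir v i"
        using wall_direction[OF ve i g(1), of 0] vg by auto
      then show False using no g(2) by blast
    qed
    show "(v \<circ> srefl D i) x0 \<bullet> \<gamma> < 1"
    proof (rule ccontr)
      assume "\<not> ?thesis"
      then have "(v \<circ> srefl D i) x0 \<bullet> (- \<gamma>) + of_int 1 < 0" using ext_ne0[OF vse g(1), of "-1"] by simp
      then obtain t where "t > 0" "- \<gamma> = t *\<^sub>R dir v i"
        using wall_direction[OF ve i neg_root[OF g(1)], of 1] vg by auto
      then show False using no parab_neg_root[OF g(2)] by blast
    qed
  qed (rule vse)
qed

lemma dir_theta: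
  assumes v: "v \<in> ext_weyl D" and i: "i \<in> {0..DIM('a)}"
  obtains y where "y \<in> WJ" "dir v i = y (theta_up D J v (\<eta> i))" "dir (theta_up D J v) i = theta_up D J v (\<eta> i)"
    "theta_up D J v (\<eta> i) \<in> \<Phi>"
proof -
  obtain y where y: "y \<in> WJ" "lin D v = y \<circ> theta_up D J v" "theta_up D J v \<in> min_reps D J"
    using theta_up_decomp[OF v] .
  note u = weyl_ext[OF min_reps_weyl[OF y(3)]]
  show thesis using that[OF y(1)] y u(3) weyl_root[OF min_reps_weyl[OF y(3)] eta_root[OF i]] by simp
qed

text \<open>The normals at \<open>v\<close> and at \<open>\<theta>\<^sup>J(v)\<close> differ by an element of \<open>W\<^sub>J\<close>, which preserves \<open>\<Phi>\<^sub>J\<close> and the sign of the roots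
  outside \<open>\<Phi>\<^sub>J\<close>.\<close>

lemma theta_step:
  assumes v: "v \<in> alcoves_in D J" and i: "i \<in> {0..DIM('a)}"
  shows "theta_up D J v \<circ> srefl D i \<in> alcoves_in D J \<longleftrightarrow> v \<circ> srefl D i \<in> alcoves_in D J"
    and "v \<circ> srefl D i \<in> alcoves_in D J \<Longrightarrow> neg_crossing D (theta_up D J v) i \<longleftrightarrow> neg_crossing D v i"
    and "v \<circ> srefl D i \<in> alcoves_in D J \<Longrightarrow> pos_crossing D (theta_up D J v) i \<longleftrightarrow> \<not> neg_crossing D v i"
proof -
  note ve = alcoves_in_ext[OF v]
  obtain y where y: "y \<in> WJ" "dir v i = y (theta_up D J v (\<eta> i))" "dir (theta_up D J v) i = theta_up D J v (\<eta> i)"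
    "theta_up D J v (\<eta> i) \<in> \<Phi>" using dir_theta[OF ve i] .
  have um: "theta_up D J v \<in> min_reps D J" using theta_up_decomp[OF ve] by metis
  note u = min_reps_alcoves_in[OF um]
  note ue = alcoves_in_ext[OF u]
  have dJ: "dir v i \<in> \<Phi>J \<longleftrightarrow> dir (theta_up D J v) i \<in> \<Phi>J" using WJ_root_iff[OF y(1)] y by simp
  show "theta_up D J v \<circ> srefl D i \<in> alcoves_in D J \<longleftrightarrow> v \<circ> srefl D i \<in> alcoves_in D J"
    using dJ step_alcoves_in_iff[OF v i] step_alcoves_in_iff[OF u i] by blast
  assume "v \<circ> srefl D i \<in> alcoves_in D J"
  then have "dir (theta_up D J v) i \<notin> \<Phi>J" using dJ step_alcoves_in_iff[OF v i] by blast
  then have "dir v i \<in> \<Phi>p \<longleftrightarrow> dir (theta_up D J v) i \<in> \<Phi>p"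
    using WJ_outside_pos_iff[OF y(1,4)] y by simp
  then show "neg_crossing D (theta_up D J v) i \<longleftrightarrow> neg_crossing D v i"
    "pos_crossing D (theta_up D J v) i \<longleftrightarrow> \<not> neg_crossing D v i"
    using neg_crossing_iff[OF ve i] neg_crossing_iff[OF ue i] pos_crossing_iff[OF ue i] by blast+
qed

text \<open>The two ways in which a bounce of type \<open>i\<close> at \<open>v\<close> can occur on a hyperplane counted by \<open>b\<^sub>\<gamma>\<close>; \<open>bounce_mult\<close> is its
  contribution to \<open>b\<^sub>\<gamma>\<close>.\<close>

definition counts_pos :: "('a \<Rightarrow> 'a) \<Rightarrow> nat \<Rightarrow> 'a \<Rightarrow> bool" where
  "counts_pos v i \<gamma> \<longleftrightarrow> sep_wall D v i \<gamma> 0 \<and> v ` fund_alcove D \<subseteq> upper_side \<gamma> 0"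

definition counts_neg :: "('a \<Rightarrow> 'a) \<Rightarrow> nat \<Rightarrow> 'a \<Rightarrow> bool" where
  "counts_neg v i \<gamma> \<longleftrightarrow> sep_wall D v i \<gamma> 1 \<and> v ` fund_alcove D \<subseteq> lower_side \<gamma> 1"

definition bounce_mult :: "('a \<Rightarrow> 'a) \<Rightarrow> nat \<Rightarrow> 'a \<Rightarrow> nat" where
  "bounce_mult v i \<gamma> = (if counts_pos v i \<gamma> then 1 else 0) + (if counts_neg v i \<gamma> then 1 else 0)"

lemma counts_pos_iff:
  assumes "v \<in> ext_weyl D" "i \<in> {0..DIM('a)}" "\<gamma> \<in> \<Phi>p"
  shows "counts_pos v i \<gamma> \<longleftrightarrow> 0 < v x0 \<bullet> \<gamma> \<and> (v \<circ> srefl D i) x0 \<bullet> \<gamma> < 0"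
  unfolding counts_pos_def using sep_wall_iff(2)[OF assms, of 0] by simp

lemma counts_neg_iff:
  assumes "v \<in> ext_weyl D" "i \<in> {0..DIM('a)}" "\<gamma> \<in> \<Phi>p"
  shows "counts_neg v i \<gamma> \<longleftrightarrow> v x0 \<bullet> \<gamma> < 1 \<and> 1 < (v \<circ> srefl D i) x0 \<bullet> \<gamma>"
  unfolding counts_neg_def using sep_wall_iff(4)[OF assms, of 1] by simp

text \<open>A point of \<open>A\<^sub>0\<close> on its \<open>i\<close>-th wall: the origin, or \<open>x0\<close> scaled onto \<open>H\<^bsub>\<phi>,1\<^esub>\<close>. Its image lies in the strip and on the
  wall of a bounce, which restricts the level of that wall.\<close>

lemma wall_point:
  assumes i: "i \<in> {0..DIM('a)}"
  obtains x where "x \<in> fund_alcove D" "x \<bullet> \<eta> i + of_int (\<kappa> i) = 0"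
proof (cases "i = 0")
  case True
  let ?x = "(1 / (x0 \<bullet> \<phi>)) *\<^sub>R x0"
  have p: "0 < x0 \<bullet> \<phi>" using x0_pos highest_root_pos by blast
  have "0 \<le> ?x \<bullet> \<beta> \<and> ?x \<bullet> \<beta> \<le> 1" if b: "\<beta> \<in> \<Phi>p" for \<beta>
  proof -
    have "x0 \<bullet> \<beta> \<le> x0 \<bullet> \<phi>"
      using ht_le_highest[OF pos_rootD(1)[OF b]] ht_pos_root[OF highest_root_pos]
      by (simp add: x0_inner divide_right_mono)
    then show ?thesis using p x0_pos[OF b] by simp
  qed
  then show thesis using that[of ?x] p True by (simp add: fund_alcove_def affine_simple_def)
next
  case False
  then show thesis using that[of 0] by (simp add: fund_alcove_def affine_simple_def)
qed

text \<open>The wall of a bounce touches the strip, where the positive roots of \<open>\<Phi>\<^sub>J\<close> have values between \<open>0\<close> and \<open>1\<close>, so its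
  level is \<open>0\<close> or \<open>1\<close>. At level \<open>1\<close> the double of the normal is not a root, since it would reach the value \<open>2\<close>.\<close>

lemma bounce_wall:
  assumes v: "v \<in> alcoves_in D J" and i: "i \<in> {0..DIM('a)}" and d: "dir v i \<in> \<Phi>J"
  obtains (pos) "dir v i \<in> \<Phi>Jp" "wt D v \<bullet> dir v i = of_int (\<kappa> i)"
      "0 < v x0 \<bullet> dir v i" "(v \<circ> srefl D i) x0 \<bullet> dir v i < 0"
    | (neg) "- dir v i \<in> \<Phi>Jp" "wt D v \<bullet> dir v i + 1 = of_int (\<kappa> i)"
      "0 < v x0 \<bullet> dir v i + 1" "(v \<circ> srefl D i) x0 \<bullet> dir v i + 1 < 0" "2 *\<^sub>R dir v i \<notin> \<Phi>"
proof -
  note ve = alcoves_in_ext[OF v]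
  obtain k where k: "\<forall>x. v x \<bullet> dir v i + of_int k = x \<bullet> \<eta> i + of_int (\<kappa> i)"
    "wt D v \<bullet> dir v i + of_int k = of_int (\<kappa> i)"
    "0 < v x0 \<bullet> dir v i + of_int k" "(v \<circ> srefl D i) x0 \<bullet> dir v i + of_int k < 0"
    using wall_equation[OF ve i] .
  obtain p where p: "p \<in> fund_alcove D" "p \<bullet> \<eta> i + of_int (\<kappa> i) = 0" using wall_point[OF i] .
  have vp: "v p \<bullet> dir v i = - of_int k" using k(1)[rule_format, of p] p(2) by simp
  have "v p \<in> J_alcove D J" using v p(1) by (auto simp: alcoves_in_def)
  then have box: "\<And>\<gamma>. \<gamma> \<in> \<Phi>Jp \<Longrightarrow> 0 \<le> v p \<bullet> \<gamma> \<and> v p \<bullet> \<gamma> \<le> 1" by (simp add: J_alcove_def)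
  have x0box: "\<And>\<gamma>. \<gamma> \<in> \<Phi>Jp \<Longrightarrow> 0 < v x0 \<bullet> \<gamma> \<and> v x0 \<bullet> \<gamma> < 1" using v alcoves_in_iff by blast
  from parab_pos_or_neg[OF d] show thesis
  proof
    assume a: "dir v i \<in> \<Phi>Jp"
    have "0 \<le> - real_of_int k" using box[OF a] vp by simp
    moreover have "real_of_int k > -1" using x0box[OF a] k(3) by linarith
    ultimately have "k = 0" by linarith
    then show thesis using pos[OF a] k by simp
  next
    assume a: "- dir v i \<in> \<Phi>Jp"
    have "real_of_int k \<le> 1" using box[OF a] vp by simp
    moreover have "0 < real_of_int k" using x0box[OF a] k(3) by simp
    ultimately have k1: "k = 1" by linarith
    have "2 *\<^sub>R dir v i \<notin> \<Phi>"
    proof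
      assume "2 *\<^sub>R dir v i \<in> \<Phi>"
      then have r: "- (2 *\<^sub>R dir v i) \<in> \<Phi>" using neg_root by blast
      have "- (2 *\<^sub>R dir v i) = 2 *\<^sub>R (- dir v i)" by simp
      then have "- (2 *\<^sub>R dir v i) \<in> \<Phi>Jp"
        using pos_scale_iff[of 2 "- (2 *\<^sub>R dir v i)" "- dir v i"] r a pos_rootD(1)
        unfolding parab_pos_root_iff by (metis span_scale zero_less_numeral)
      from box[OF this] show False using vp k1 by simp
    qed
    then show thesis using neg[OF a] k k1 by simp
  qed
qed

text \<open>For \<open>i > 0\<close> the half of a simple root would be a root. For \<open>i = 0\<close> the half of the normal would take the value \<open>1/2\<close>
  at a coweight.\<close>

lemma half_dir_not_root:
  assumes v: "v \<in> ext_weyl D" and i: "i \<in> {0..DIM('a)}" and k: "wt D v \<bullet> dir v i = of_int (\<kappa> i)"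
  shows "(1/2) *\<^sub>R dir v i \<notin> \<Phi>"
proof
  assume h: "(1/2) *\<^sub>R dir v i \<in> \<Phi>"
  show False
  proof (cases "i = 0")
    case True
    have "wt D v \<bullet> ((1/2) *\<^sub>R dir v i) \<in> \<int>" using coweight_root[OF ext_decomp(1)[OF v] h] .
    then show False using k True half_not_Ints by (simp add: affine_simple_def)
  next
    case False
    then have iI: "i \<in> {1..DIM('a)}" using i by auto
    note u = ext_decomp(2)[OF v]
    obtain z where z: "z \<in> weyl D" "\<And>x. z (lin D v x) = x" using weyl_inverse[OF u] by metis
    have "z ((1/2) *\<^sub>R dir v i) = (1/2) *\<^sub>R \<eta> i"
      using z(2) linear_scale[OF isometry_linear[OF weyl_isometry[OF z(1)]]] by simp
    then have "(1/2) *\<^sub>R \<alpha> i \<in> \<Phi>" using weyl_root[OF z(1) h] False by (simp add: affine_simple_def)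
    then show False using half_simple_not_root[OF iI] by blast
  qed
qed

text \<open>The counted roots are positive multiples of the normal or of its negative. At level \<open>0\<close> these are the normal and,
  if it is a root, its double, since the two have the same hyperplane at level \<open>0\<close>. At level \<open>1\<close> the negative of
  the normal is the only one, and the double is not a root. In both cases the product is the scalar of the bounce.\<close>

lemma bounce_product:
  fixes c :: "'a \<Rightarrow> 'r::comm_monoid_mult"
  assumes v: "v \<in> alcoves_in D J" and i: "i \<in> {0..DIM('a)}" and d: "dir v i \<in> \<Phi>J"
    and inv: "\<And>\<beta> y. \<beta> \<in> \<Phi>J \<Longrightarrow> y \<in> WJ \<Longrightarrow> c (y \<beta>) = c \<beta>"
  shows "(\<Prod>\<gamma>\<in>\<Phi>Jp. c \<gamma> ^ bounce_mult v i \<gamma>)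
    = c (dir v i) * (if 2 *\<^sub>R dir v i \<in> \<Phi>J then c (2 *\<^sub>R dir v i) else 1)"
proof -
  note ve = alcoves_in_ext[OF v]
  let ?d = "dir v i"
  have fin: "finite \<Phi>Jp" using finite_roots by (auto simp: parab_pos_roots_def parab_roots_def)
  have pd: "\<gamma> \<in> \<Phi>p \<and> \<gamma> \<in> \<Phi>" if "\<gamma> \<in> \<Phi>Jp" for \<gamma> using that pos_rootD by (auto simp: parab_pos_root_iff)
  have x0box: "\<And>\<gamma>. \<gamma> \<in> \<Phi>Jp \<Longrightarrow> 0 < v x0 \<bullet> \<gamma> \<and> v x0 \<bullet> \<gamma> < 1" using v alcoves_in_iff by blast
  \<comment> \<open>a counted root is a positive multiple of the direction of the wall\<close>
  have cp: "\<exists>t>0. \<gamma> = t *\<^sub>R ?d" if "\<gamma> \<in> \<Phi>Jp" "counts_pos v i \<gamma>" for \<gamma>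
    using that counts_pos_iff[OF ve i, of \<gamma>] pd[of \<gamma>] wall_direction[OF ve i, of \<gamma> 0] by (metis add.right_neutral of_int_0)
  have cn: "\<exists>t>0. - \<gamma> = t *\<^sub>R ?d \<and> wt D v \<bullet> (- \<gamma>) + 1 = t * of_int (\<kappa> i)" if "\<gamma> \<in> \<Phi>Jp" "counts_neg v i \<gamma>" for \<gamma>
  proof -
    have "0 < v x0 \<bullet> (- \<gamma>) + of_int 1" "(v \<circ> srefl D i) x0 \<bullet> (- \<gamma>) + of_int 1 < 0"
      using that counts_neg_iff[OF ve i, of \<gamma>] pd[of \<gamma>] by auto
    from wall_direction[OF ve i neg_root this] pd[OF that(1)] show ?thesis by (metis of_int_1)
  qed
  show ?thesis
  proof (rule bounce_wall[OF v i d])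
    assume a: "?d \<in> \<Phi>Jp" "wt D v \<bullet> ?d = of_int (\<kappa> i)" "0 < v x0 \<bullet> ?d" "(v \<circ> srefl D i) x0 \<bullet> ?d < 0"
    have no_neg: "\<not> counts_neg v i \<gamma>" if g: "\<gamma> \<in> \<Phi>Jp" for \<gamma>
    proof
      assume "counts_neg v i \<gamma>"
      then obtain t where t: "t > 0" "- \<gamma> = t *\<^sub>R ?d" using cn g by blast
      then have "- \<gamma> \<in> \<Phi>p" using pos_scale_iff[of t "- \<gamma>" ?d] pd[OF a(1)] neg_root pd[OF g] by blast
      then show False using not_both_pos pd[OF g] by blast
    qed
    have pos_iff: "counts_pos v i \<gamma> \<longleftrightarrow> \<gamma> = ?d \<or> \<gamma> = 2 *\<^sub>R ?d" if g: "\<gamma> \<in> \<Phi>Jp" for \<gamma>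
    proof
      assume "counts_pos v i \<gamma>"
      then obtain t where t: "t > 0" "\<gamma> = t *\<^sub>R ?d" using cp g by blast
      have "t = 1/2 \<or> t = 1 \<or> t = 2" using root_multiple[of ?d t] pd[OF a(1)] pd[OF g] t by blast
      moreover have "t \<noteq> 1/2" using half_dir_not_root[OF ve i a(2)] pd[OF g] t(2) by blast
      ultimately show "\<gamma> = ?d \<or> \<gamma> = 2 *\<^sub>R ?d" using t(2) by auto
    next
      assume "\<gamma> = ?d \<or> \<gamma> = 2 *\<^sub>R ?d"
      then show "counts_pos v i \<gamma>" using a(3,4) counts_pos_iff[OF ve i, of \<gamma>] pd[OF g] by auto
    qed
    let ?S = "{?d} \<union> (if 2 *\<^sub>R ?d \<in> \<Phi>J then {2 *\<^sub>R ?d} else {})"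
    have twoJ: "2 *\<^sub>R ?d \<in> \<Phi>Jp \<longleftrightarrow> 2 *\<^sub>R ?d \<in> \<Phi>J"
      using pos_scale_iff[of 2 "2 *\<^sub>R ?d" ?d] pd[OF a(1)] by (auto simp: parab_pos_roots_def parab_roots_def)
    have ne: "?d \<noteq> 2 *\<^sub>R ?d" using root_ne0 pd[OF a(1)] by (simp add: scaleR_2)
    have "(\<Prod>\<gamma>\<in>\<Phi>Jp. c \<gamma> ^ bounce_mult v i \<gamma>) = (\<Prod>\<gamma>\<in>?S. c \<gamma> ^ bounce_mult v i \<gamma>)"
      using a(1) twoJ pos_iff no_neg fin by (intro prod.mono_neutral_right) (auto simp: bounce_mult_def split: if_splits)
    also have "\<dots> = (\<Prod>\<gamma>\<in>?S. c \<gamma>)"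
      using a(1) twoJ pos_iff no_neg by (intro prod.cong) (auto simp: bounce_mult_def split: if_splits)
    also have "\<dots> = c ?d * (if 2 *\<^sub>R ?d \<in> \<Phi>J then c (2 *\<^sub>R ?d) else 1)" using ne by auto
    finally show ?thesis .
  next
    assume a: "- ?d \<in> \<Phi>Jp" "wt D v \<bullet> ?d + 1 = of_int (\<kappa> i)" "0 < v x0 \<bullet> ?d + 1"
      "(v \<circ> srefl D i) x0 \<bullet> ?d + 1 < 0" "2 *\<^sub>R ?d \<notin> \<Phi>"
    have dr: "?d \<in> \<Phi>" "?d \<notin> \<Phi>p" using dir_root[OF ve i] not_both_pos pd[OF a(1)] by auto
    have no_pos: "\<not> counts_pos v i \<gamma>" if g: "\<gamma> \<in> \<Phi>Jp" for \<gamma>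
      using cp[OF g] pos_scale_iff[of _ \<gamma> ?d] dr pd[OF g] by blast
    have neg_iff: "counts_neg v i \<gamma> \<longleftrightarrow> \<gamma> = - ?d" if g: "\<gamma> \<in> \<Phi>Jp" for \<gamma>
    proof
      assume "counts_neg v i \<gamma>"
      then obtain t where t: "t > 0" "- \<gamma> = t *\<^sub>R ?d" "wt D v \<bullet> (- \<gamma>) + 1 = t * of_int (\<kappa> i)" using cn g by blast
      have "t * (wt D v \<bullet> ?d) + 1 = t * (wt D v \<bullet> ?d + 1)" using t(3) unfolding t(2) a(2) by simp
      then have "t = 1" by (simp add: algebra_simps)
      then show "\<gamma> = - ?d" using t(2) by (metis minus_minus scaleR_one)
    next
      assume "\<gamma> = - ?d"
      then show "counts_neg v i \<gamma>" using a(3,4) counts_neg_iff[OF ve i, of \<gamma>] pd[OF g] by auto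
    qed
    have "(\<Prod>\<gamma>\<in>\<Phi>Jp. c \<gamma> ^ bounce_mult v i \<gamma>) = (\<Prod>\<gamma>\<in>{- ?d}. c \<gamma> ^ bounce_mult v i \<gamma>)"
      using a(1) neg_iff no_pos fin by (intro prod.mono_neutral_right) (auto simp: bounce_mult_def split: if_splits)
    also have "\<dots> = c (- ?d)" using neg_iff[OF a(1)] no_pos[OF a(1)] by (simp add: bounce_mult_def)
    also have "\<dots> = c ?d"
      using inv[OF d reflection_in_parab[OF J d]] aff_refl_self[OF root_ne0[OF dr(1)]] by simp
    also have "\<dots> = c ?d * (if 2 *\<^sub>R ?d \<in> \<Phi>J then c (2 *\<^sub>R ?d) else 1)" using a(5) by (simp add: parab_roots_def)
    finally show ?thesis .
  qed
qed

end

section \<open>The coefficient rings\<close>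

text \<open>The Laurent rings are carriers inside a ring type. Describing them as subrings of that type lets finite products
  and powers be computed with the operations of the type.\<close>

definition subring_set :: "'r::comm_ring_1 set \<Rightarrow> bool" where
  "subring_set A \<longleftrightarrow> 0 \<in> A \<and> 1 \<in> A \<and> (\<forall>a\<in>A. \<forall>b\<in>A. a + b \<in> A \<and> a * b \<in> A) \<and> (\<forall>a\<in>A. - a \<in> A)"

lemma subring_set_sum: "subring_set A \<Longrightarrow> (\<And>i. i \<in> S \<Longrightarrow> f i \<in> A) \<Longrightarrow> sum f S \<in> A"
  by (induction S rule: infinite_finite_induct) (auto simp: subring_set_def)

lemma subring_set_Sum_any: "subring_set A \<Longrightarrow> (\<And>i. f i \<in> A) \<Longrightarrow> Sum_any f \<in> A"
  unfolding Sum_any.expand_set by (rule subring_set_sum) auto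

lemma laurent_carrier:
  "p \<in> carrier (laurent_ring A X) \<longleftrightarrow>
    (\<forall>k. Poly_Mapping.lookup p k \<in> A) \<and> (\<forall>a\<in>Poly_Mapping.keys p. Poly_Mapping.keys a \<subseteq> X)"
  by (auto simp: laurent_ring_def)

lemma laurent_ring_simps:
  "x \<otimes>\<^bsub>laurent_ring A X\<^esub> y = x * y" "\<one>\<^bsub>laurent_ring A X\<^esub> = 1"
  "\<zero>\<^bsub>laurent_ring A X\<^esub> = 0" "x \<oplus>\<^bsub>laurent_ring A X\<^esub> y = x + y"
  by (simp_all add: laurent_ring_def)

lemma subring_set_laurent:
  assumes A: "subring_set A" shows "subring_set (carrier (laurent_ring A X))"
proof -
  let ?C = "carrier (laurent_ring A X)"
  have "0 \<in> ?C" "1 \<in> ?C" using A by (auto simp: laurent_carrier subring_set_def lookup_one when_def)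
  moreover have "- p \<in> ?C" if "p \<in> ?C" for p
    using that A by (auto simp: laurent_carrier subring_set_def)
  moreover have "p + q \<in> ?C" if "p \<in> ?C" "q \<in> ?C" for p q
    using that A keys_add[of p q] by (fastforce simp: laurent_carrier subring_set_def lookup_add)
  moreover have "p * q \<in> ?C" if pq: "p \<in> ?C" "q \<in> ?C" for p q
  proof -
    have "Poly_Mapping.lookup (p * q) k \<in> A" for k
      unfolding lookup_mult
    proof (rule subring_set_Sum_any[OF A])
      fix l
      have "(\<Sum>r. Poly_Mapping.lookup q r when k = l + r) \<in> A"
        using pq A by (intro subring_set_Sum_any[OF A]) (auto simp: laurent_carrier when_def subring_set_def)
      then show "Poly_Mapping.lookup p l * (\<Sum>r. Poly_Mapping.lookup q r when k = l + r) \<in> A"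
        using pq A by (auto simp: laurent_carrier subring_set_def)
    qed
    moreover have "Poly_Mapping.keys a \<subseteq> X" if "a \<in> Poly_Mapping.keys (p * q)" for a
    proof -
      obtain b d where "a = b + d" "b \<in> Poly_Mapping.keys p" "d \<in> Poly_Mapping.keys q"
        using keys_mult[of p q] \<open>a \<in> _\<close> by blast
      then show ?thesis using pq keys_add[of b d] unfolding laurent_carrier by blast
    qed
    ultimately show ?thesis by (simp add: laurent_carrier)
  qed
  ultimately show ?thesis by (simp add: subring_set_def)
qed

lemma cring_laurent:
  assumes A: "subring_set A" shows "cring (laurent_ring A X)"
proof -
  have C: "subring_set (carrier (laurent_ring A X))" by (rule subring_set_laurent[OF A])
  note C' = C[unfolded subring_set_def]
  show ?thesis
  proof (rule cringI)
    show "abelian_group (laurent_ring A X)"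
    proof (rule abelian_groupI)
      fix x assume "x \<in> carrier (laurent_ring A X)"
      then show "\<exists>y\<in>carrier (laurent_ring A X). y \<oplus>\<^bsub>laurent_ring A X\<^esub> x = \<zero>\<^bsub>laurent_ring A X\<^esub>"
        using C' by (intro bexI[of _ "- x"]) (auto simp: laurent_ring_simps)
    qed (use C' in \<open>auto simp: laurent_ring_simps algebra_simps\<close>)
    show "Group.comm_monoid (laurent_ring A X)"
      by (rule comm_monoidI) (use C' in \<open>auto simp: laurent_ring_simps algebra_simps\<close>)
  qed (auto simp: laurent_ring_simps algebra_simps)
qed

lemma finprod_laurent:
  assumes A: "subring_set A" and "finite S" "\<And>i. i \<in> S \<Longrightarrow> f i \<in> carrier (laurent_ring A X)"
  shows "(\<Otimes>\<^bsub>laurent_ring A X\<^esub>i\<in>S. f i) = (\<Prod>i\<in>S. f i)"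
proof -
  interpret cring "laurent_ring A X" by (rule cring_laurent[OF A])
  show ?thesis using assms(2,3)
  proof (induction S rule: finite_induct)
    case empty
    then show ?case by (simp add: laurent_ring_simps)
  next
    case (insert i S)
    have "f \<in> S \<rightarrow> carrier (laurent_ring A X)" using insert by auto
    then show ?case using insert by (simp add: finprod_insert laurent_ring_simps)
  qed
qed

lemma pow_laurent: "x [^]\<^bsub>laurent_ring A X\<^esub> (k::nat) = x ^ k"
  by (induction k) (simp_all add: nat_pow_def laurent_ring_simps mult.commute)

lemma subring_UNIV: "subring_set UNIV"
  by (simp add: subring_set_def)

lemma cring_R: "cring (R_ring D)"
  unfolding R_ring_def by (rule cring_laurent[OF subring_UNIV])

lemma subring_R: "subring_set (carrier (R_ring D))"
  unfolding R_ring_def by (rule subring_set_laurent[OF subring_UNIV])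

lemma cring_zeta: "cring (zeta_ring D)"
  unfolding zeta_ring_def by (rule cring_laurent[OF subring_R])

lemma R_ring_simps:
  "x \<otimes>\<^bsub>R_ring D\<^esub> y = x * y" "\<one>\<^bsub>R_ring D\<^esub> = 1" "\<zero>\<^bsub>R_ring D\<^esub> = 0" "x \<oplus>\<^bsub>R_ring D\<^esub> y = x + y"
  by (simp_all add: R_ring_def laurent_ring_simps)

lemma zeta_ring_simps:
  "x \<otimes>\<^bsub>zeta_ring D\<^esub> y = x * y" "\<one>\<^bsub>zeta_ring D\<^esub> = 1" "\<zero>\<^bsub>zeta_ring D\<^esub> = 0" "x \<oplus>\<^bsub>zeta_ring D\<^esub> y = x + y"
  by (simp_all add: zeta_ring_def laurent_ring_simps)

lemma qdiff_carrier:
  fixes D :: "'a::euclidean_space root_datum"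
  assumes "i \<in> {0..DIM('a)}" shows "qdiff D i \<in> carrier (R_ring D)"
proof -
  interpret cring "R_ring D" by (rule cring_R)
  have "class_rep D i \<in> class_rep D ` {0..DIM('a)}" using assms by blast
  then have mem: "Poly_Mapping.single (Poly_Mapping.single (class_rep D i) k) 1 \<in> carrier (R_ring D)" for k
    by (auto simp: R_ring_def laurent_carrier)
  define p :: "int laurent" where "p = Poly_Mapping.single (Poly_Mapping.single (class_rep D i) (-1)) 1"
  have "p * qvar D i = 1"
    by (simp add: p_def qvar_def mult_single flip: single_add)
  moreover have "p \<in> carrier (R_ring D)" "qvar D i \<in> carrier (R_ring D)"
    unfolding p_def qvar_def by (rule mem)+
  ultimately have "qvar D i \<in> Units (R_ring D)"
    unfolding Units_def R_ring_simps by (auto simp: mult.commute)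
  then have "qvar D i \<in> carrier (R_ring D)" "inv\<^bsub>R_ring D\<^esub> qvar D i \<in> carrier (R_ring D)" by auto
  then show ?thesis by (simp add: qdiff_def)
qed

context parabolic
begin

definition expo :: "'a \<Rightarrow> nat \<Rightarrow>\<^sub>0 int" where
  "expo \<mu> = (\<Sum>i\<in>{1..DIM('a)}. Poly_Mapping.single i \<lfloor>\<mu> \<bullet> \<alpha> i\<rfloor>)"

lemma lookup_expo: "Poly_Mapping.lookup (expo \<mu>) i = (if i \<in> {1..DIM('a)} then \<lfloor>\<mu> \<bullet> \<alpha> i\<rfloor> else 0)"
  unfolding expo_def lookup_sum by (simp add: lookup_single when_def)

lemma zeta_eq:
  assumes "\<mu> \<in> coweights D" shows "zeta D \<mu> = Poly_Mapping.single (expo \<mu>) 1"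
proof -
  have int: "of_int \<lfloor>\<mu> \<bullet> \<alpha> i\<rfloor> = \<mu> \<bullet> \<alpha> i" if "i \<in> {1..DIM('a)}" for i
    using assms coweights_iff that by (metis Ints_cases floor_of_int)
  have "(THE a. Poly_Mapping.keys a \<subseteq> {1..DIM('a)} \<and>
        \<mu> = (\<Sum>i\<in>{1..DIM('a)}. of_int (Poly_Mapping.lookup a i) *\<^sub>R \<omega> i)) = expo \<mu>"
  proof (rule the_equality, intro conjI)
    show "Poly_Mapping.keys (expo \<mu>) \<subseteq> {1..DIM('a)}"
      by (auto simp: in_keys_iff lookup_expo split: if_splits)
    have "(\<Sum>i\<in>{1..DIM('a)}. of_int (Poly_Mapping.lookup (expo \<mu>) i) *\<^sub>R \<omega> i) = (\<Sum>i\<in>{1..DIM('a)}. (\<mu> \<bullet> \<alpha> i) *\<^sub>R \<omega> i)"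
      using int by (intro sum.cong) (auto simp: lookup_expo)
    then show "\<mu> = (\<Sum>i\<in>{1..DIM('a)}. of_int (Poly_Mapping.lookup (expo \<mu>) i) *\<^sub>R \<omega> i)"
      using coweight_expand[of \<mu>] by simp
  next
    fix a :: "nat \<Rightarrow>\<^sub>0 int"
    assume a: "Poly_Mapping.keys a \<subseteq> {1..DIM('a)} \<and>
        \<mu> = (\<Sum>i\<in>{1..DIM('a)}. of_int (Poly_Mapping.lookup a i) *\<^sub>R \<omega> i)"
    have "Poly_Mapping.lookup a j = Poly_Mapping.lookup (expo \<mu>) j" for j
    proof (cases "j \<in> {1..DIM('a)}")
      case True
      have "\<mu> \<bullet> \<alpha> j = (\<Sum>i\<in>{1..DIM('a)}. of_int (Poly_Mapping.lookup a i) *\<^sub>R \<omega> i) \<bullet> \<alpha> j"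
        using a by simp
      also have "\<dots> = of_int (Poly_Mapping.lookup a j)"
        using True by (simp add: inner_sum_left fund_coweight_simple if_distrib cong: if_cong)
      finally show ?thesis using True by (simp add: lookup_expo)
    next
      case False
      then show ?thesis using a by (auto simp: lookup_expo in_keys_iff)
    qed
    then show "a = expo \<mu>" by (rule poly_mapping_eqI)
  qed
  then show ?thesis by (simp add: zeta_def)
qed

lemma zeta_carrier: assumes "\<mu> \<in> coweights D" shows "zeta D \<mu> \<in> carrier (zeta_ring D)"
proof -
  have k: "Poly_Mapping.keys (expo \<mu>) \<subseteq> {1..DIM('a)}"
    by (auto simp: in_keys_iff lookup_expo split: if_splits)
  have "0 \<in> carrier (R_ring D)" "1 \<in> carrier (R_ring D)" using subring_R[of D] by (auto simp: subring_set_def)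
  then show ?thesis using k
    by (auto simp: zeta_eq[OF assms] zeta_ring_def laurent_carrier lookup_single when_def)
qed

lemma expo_add:
  assumes "\<mu> \<in> coweights D" "\<nu> \<in> coweights D" shows "expo (\<mu> + \<nu>) = expo \<mu> + expo \<nu>"
proof (rule poly_mapping_eqI)
  fix i
  show "Poly_Mapping.lookup (expo (\<mu> + \<nu>)) i = Poly_Mapping.lookup (expo \<mu> + expo \<nu>) i"
  proof (cases "i \<in> {1..DIM('a)}")
    case True
    obtain a b where "\<mu> \<bullet> \<alpha> i = of_int a" "\<nu> \<bullet> \<alpha> i = of_int b"
      using assms coweights_iff True by (metis Ints_cases)
    then show ?thesis using True by (simp add: lookup_expo lookup_add inner_add_left flip: of_int_add)
  qed (auto simp: lookup_expo lookup_add)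
qed

lemma zeta_add:
  "\<mu> \<in> coweights D \<Longrightarrow> \<nu> \<in> coweights D \<Longrightarrow> zeta D (\<mu> + \<nu>) = zeta D \<mu> * zeta D \<nu>"
  by (simp add: zeta_eq coweights_add expo_add mult_single)

lemma zeta_zero: "zeta D 0 = 1"
proof -
  have "expo 0 = 0" by (rule poly_mapping_eqI) (simp add: lookup_expo)
  then show ?thesis by (simp add: zeta_eq coweights_0)
qed

abbreviation RJ :: "int laurent laurent set ring" where "RJ \<equiv> zetaJ_ring D J"

lemma lattice_coweights: "\<gamma> \<in> parab_coroot_lattice D J \<Longrightarrow> \<gamma> \<in> coweights D"
  unfolding parab_coroot_lattice_def
proof (induction rule: group_closure.induct)
  case (base s)
  then show ?case using coroot_coweight coweights_0 by (auto simp: parab_roots_def)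
next
  case (diff s t)
  then show ?case unfolding coweights_def by (rule_tac group_closure.diff)
qed

lemma zeta_gen_carrier:
  assumes "\<gamma> \<in> parab_coroot_lattice D J"
  shows "zeta D \<gamma> \<ominus>\<^bsub>zeta_ring D\<^esub> \<one>\<^bsub>zeta_ring D\<^esub> \<in> carrier (zeta_ring D)"
proof -
  interpret cring "zeta_ring D" by (rule cring_zeta)
  show ?thesis using zeta_carrier lattice_coweights assms by simp
qed

lemma ideal_zeta: "ideal (zeta_ideal D J) (zeta_ring D)"
proof -
  interpret cring "zeta_ring D" by (rule cring_zeta)
  show ?thesis unfolding zeta_ideal_def using zeta_gen_carrier by (intro genideal_ideal) blast
qed

lemma cring_RJ: "cring RJ"
  unfolding zetaJ_ring_def by (rule ideal.quotient_is_cring[OF ideal_zeta cring_zeta])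

abbreviation proj :: "int laurent laurent \<Rightarrow> int laurent laurent set" where
  "proj p \<equiv> zeta_ideal D J +>\<^bsub>zeta_ring D\<^esub> p"

lemma proj_hom: "proj \<in> ring_hom (zeta_ring D) RJ"
  unfolding zetaJ_ring_def by (rule ideal.rcos_ring_hom[OF ideal_zeta])

lemma zetaJ_carrier: "\<mu> \<in> coweights D \<Longrightarrow> zetaJ D J \<mu> \<in> carrier RJ"
  unfolding zetaJ_def using ring_hom_closed[OF proj_hom] zeta_carrier by blast

lemma zetaJ_add:
  "\<mu> \<in> coweights D \<Longrightarrow> \<nu> \<in> coweights D \<Longrightarrow> zetaJ D J (\<mu> + \<nu>) = zetaJ D J \<mu> \<otimes>\<^bsub>RJ\<^esub> zetaJ D J \<nu>"
  unfolding zetaJ_def using ring_hom_mult[OF proj_hom, of "zeta D \<mu>" "zeta D \<nu>"] zeta_carrier zeta_add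
  by (simp add: zeta_ring_simps)

lemma zetaJ_zero: "zetaJ D J 0 = \<one>\<^bsub>RJ\<^esub>"
  unfolding zetaJ_def using ring_hom_one[OF proj_hom] zeta_zero by (simp add: zeta_ring_simps)

lemma zetaJ_lattice:
  assumes g: "\<gamma> \<in> parab_coroot_lattice D J" shows "zetaJ D J \<gamma> = \<one>\<^bsub>RJ\<^esub>"
proof -
  interpret Z: cring "zeta_ring D" by (rule cring_zeta)
  interpret Q: cring RJ by (rule cring_RJ)
  let ?a = "zeta D \<gamma> \<ominus>\<^bsub>zeta_ring D\<^esub> \<one>\<^bsub>zeta_ring D\<^esub>"
  have z: "zeta D \<gamma> \<in> carrier (zeta_ring D)" using zeta_carrier lattice_coweights g by blast
  have "?a \<in> zeta_ideal D J"
    unfolding zeta_ideal_def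
    by (rule subsetD[OF Z.genideal_self]) (use zeta_gen_carrier g in auto)
  then have "proj ?a = zeta_ideal D J" by (rule Z.a_rcos_zero[OF ideal_zeta])
  then have a0: "proj ?a = \<zero>\<^bsub>RJ\<^esub>" by (simp add: zetaJ_ring_def FactRing_def)
  have "zeta D \<gamma> = ?a \<oplus>\<^bsub>zeta_ring D\<^esub> \<one>\<^bsub>zeta_ring D\<^esub>" using z by algebra
  then have "proj (zeta D \<gamma>) = proj ?a \<oplus>\<^bsub>RJ\<^esub> proj \<one>\<^bsub>zeta_ring D\<^esub>"
    using ring_hom_add[OF proj_hom, of ?a "\<one>\<^bsub>zeta_ring D\<^esub>"] z by simp
  then show ?thesis using a0 ring_hom_one[OF proj_hom] by (simp add: zetaJ_def)
qed

lemma zetaJ_cong: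
  assumes "\<mu> \<in> coweights D" "\<nu> \<in> coweights D" "\<mu> - \<nu> \<in> parab_coroot_lattice D J"
  shows "zetaJ D J \<mu> = zetaJ D J \<nu>"
proof -
  interpret Q: cring RJ by (rule cring_RJ)
  have "zetaJ D J (\<nu> + (\<mu> - \<nu>)) = zetaJ D J \<nu> \<otimes>\<^bsub>RJ\<^esub> \<one>\<^bsub>RJ\<^esub>"
    using zetaJ_add[OF assms(2) lattice_coweights[OF assms(3)]] zetaJ_lattice[OF assms(3)] by simp
  then show ?thesis using zetaJ_carrier[OF assms(2)] by simp
qed

lemma const_carrier: "r \<in> carrier (R_ring D) \<Longrightarrow> Poly_Mapping.single 0 r \<in> carrier (zeta_ring D)"
  using subring_R[of D] by (auto simp: zeta_ring_def laurent_carrier lookup_single when_def subring_set_def)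

lemma R_to_zetaJ_hom: "R_to_zetaJ D J \<in> ring_hom (R_ring D) RJ"
proof (rule ring_hom_memI)
  fix r s assume rs: "r \<in> carrier (R_ring D)" "s \<in> carrier (R_ring D)"
  note c = const_carrier[OF rs(1)] const_carrier[OF rs(2)]
  show "R_to_zetaJ D J r \<in> carrier RJ"
    unfolding R_to_zetaJ_def using ring_hom_closed[OF proj_hom c(1)] .
  show "R_to_zetaJ D J (r \<otimes>\<^bsub>R_ring D\<^esub> s) = R_to_zetaJ D J r \<otimes>\<^bsub>RJ\<^esub> R_to_zetaJ D J s"
    unfolding R_to_zetaJ_def using ring_hom_mult[OF proj_hom c] by (simp add: R_ring_simps zeta_ring_simps mult_single)
  show "R_to_zetaJ D J (r \<oplus>\<^bsub>R_ring D\<^esub> s) = R_to_zetaJ D J r \<oplus>\<^bsub>RJ\<^esub> R_to_zetaJ D J s"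
    unfolding R_to_zetaJ_def using ring_hom_add[OF proj_hom c] by (simp add: R_ring_simps zeta_ring_simps single_add)
next
  show "R_to_zetaJ D J \<one>\<^bsub>R_ring D\<^esub> = \<one>\<^bsub>RJ\<^esub>"
    unfolding R_to_zetaJ_def using ring_hom_one[OF proj_hom] by (simp add: R_ring_simps zeta_ring_simps)
qed

end

section \<open>Positively folded paths\<close>

lemma card_split_first:
  assumes "finite {k. P k}"
  shows "card {k. P k} = (if P 0 then 1 else 0) + card {k. P (Suc k)}"
proof -
  have e: "{k. P k} = (if P 0 then {0} else {}) \<union> Suc ` {k. P (Suc k)}"
    by (auto simp: image_iff) (metis not0_implies_Suc)+
  have "finite (Suc ` {k. P (Suc k)})" by (rule finite_subset[OF _ assms]) auto
  then have "card {k. P k} = card (if P 0 then {0::nat} else {}) + card (Suc ` {k. P (Suc k)})"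
    by (subst e, intro card_Un_disjoint) auto
  then show ?thesis by (simp add: card_image)
qed

context parabolic
begin

abbreviation A :: "('a \<Rightarrow> 'a) set" where "A \<equiv> alcoves_in D J"

lemma folded_paths_Nil:
  assumes "v \<in> A" "\<sigma> \<in> alcove_stab D"
  shows "folded_paths D J [] \<sigma> v = {[v, v \<circ> \<sigma>]}"
proof -
  have "(v \<circ> \<sigma>) ` fund_alcove D = v ` fund_alcove D"
    using assms(2) by (simp only: alcove_stab_def image_comp[symmetric] mem_Collect_eq)
  moreover have "v \<circ> \<sigma> \<in> ext_weyl D"
    using ext_comp(1)[OF alcoves_in_ext[OF assms(1)] alcove_stab_ext[OF assms(2)]] .
  ultimately have "v \<circ> \<sigma> \<in> A" using assms(1) by (simp only: alcoves_in_def mem_Collect_eq)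
  then have "p \<in> folded_paths D J [] \<sigma> v \<longleftrightarrow> length p = 2 \<and> p ! 0 = v \<and> p ! 1 = v \<circ> \<sigma>" for p
    using assms(1) by (auto simp: folded_paths_def One_nat_def le_Suc_eq)
  moreover have "length p = 2 \<and> p ! 0 = v \<and> p ! 1 = v \<circ> \<sigma> \<longleftrightarrow> p = [v, v \<circ> \<sigma>]" for p
    by (auto simp: numeral_2_eq_2 length_Suc_conv One_nat_def)
  ultimately show ?thesis by blast
qed

definition may_stay :: "('a \<Rightarrow> 'a) \<Rightarrow> nat \<Rightarrow> bool" where
  "may_stay v i \<longleftrightarrow> (v \<circ> srefl D i \<in> A \<longrightarrow> neg_crossing D v i)"

lemma all_le_Suc: "(\<forall>k \<le> Suc n. P k) \<longleftrightarrow> P 0 \<and> (\<forall>k \<le> n. P (Suc k))"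
  by (metis Suc_le_mono le0 not0_implies_Suc)

lemma all_less_Suc: "(\<forall>k < Suc n. P k) \<longleftrightarrow> P 0 \<and> (\<forall>k < n. P (Suc k))"
  by (metis Suc_less_eq zero_less_Suc not0_implies_Suc)

lemma folded_paths_start: "q \<in> folded_paths D J js \<sigma> x \<longleftrightarrow> q \<in> folded_paths D J js \<sigma> (q ! 0) \<and> q ! 0 = x"
  by (auto simp: folded_paths_def)

lemma folded_paths_length: "q \<in> folded_paths D J js \<sigma> x \<Longrightarrow> length q = length js + 2"
  by (simp add: folded_paths_def)

lemma folded_paths_mem: "q \<in> folded_paths D J js \<sigma> x \<Longrightarrow> k \<le> length js + 1 \<Longrightarrow> q ! k \<in> A"
  by (simp add: folded_paths_def)

lemma folded_paths_first: "q \<in> folded_paths D J js \<sigma> x \<Longrightarrow> q ! 0 = x"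
  by (simp add: folded_paths_def)

lemma folded_paths_last: "q \<in> folded_paths D J js \<sigma> x \<Longrightarrow> last q \<in> A"
proof -
  assume q: "q \<in> folded_paths D J js \<sigma> x"
  then have "last q = q ! (length js + 1)" using folded_paths_length[OF q] by (subst last_conv_nth) (auto simp: One_nat_def)
  then show ?thesis using folded_paths_mem[OF q] by simp
qed

lemma srefl_moves:
  assumes "v \<in> A" "i \<in> {0..DIM('a)}" shows "v \<circ> srefl D i \<noteq> v"
proof
  assume e: "v \<circ> srefl D i = v"
  obtain k where "0 < v x0 \<bullet> dir v i + of_int k" "(v \<circ> srefl D i) x0 \<bullet> dir v i + of_int k < 0"
    using wall_equation[OF alcoves_in_ext[OF assms(1)] assms(2)] .
  then show False unfolding e by linarith
qed

lemma folded_paths_Cons_iff: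
  assumes v: "v \<in> A"
  shows "v # q \<in> folded_paths D J (i # js) \<sigma> v \<longleftrightarrow>
      q \<in> folded_paths D J js \<sigma> (q ! 0) \<and> (q ! 0 = v \<or> q ! 0 = v \<circ> srefl D i)
      \<and> (q ! 0 = v \<and> v \<circ> srefl D i \<in> A \<longrightarrow> neg_crossing D v i)"
proof -
  have "v # q \<in> folded_paths D J (i # js) \<sigma> v \<longleftrightarrow>
      length q = length js + 2 \<and> q ! (length js + 1) = q ! length js \<circ> \<sigma>
      \<and> (\<forall>k \<le> length js + 1. q ! k \<in> A)
      \<and> ((q ! 0 = v \<or> q ! 0 = v \<circ> srefl D i) \<and> (\<forall>k < length js. q ! Suc k \<in> {q ! k, q ! k \<circ> srefl D (js ! k)}))
      \<and> ((q ! 0 = v \<and> v \<circ> srefl D i \<in> A \<longrightarrow> neg_crossing D v i)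
        \<and> (\<forall>k < length js. q ! Suc k = q ! k \<and> q ! k \<circ> srefl D (js ! k) \<in> A \<longrightarrow> neg_crossing D (q ! k) (js ! k)))"
    unfolding folded_paths_def mem_Collect_eq length_Cons add_Suc nat.inject nth_Cons_0 nth_Cons_Suc
      all_le_Suc all_less_Suc insert_iff empty_iff
    using v by simp
  moreover have "q \<in> folded_paths D J js \<sigma> (q ! 0) \<longleftrightarrow>
      length q = length js + 2 \<and> q ! (length js + 1) = q ! length js \<circ> \<sigma>
      \<and> (\<forall>k \<le> length js + 1. q ! k \<in> A)
      \<and> (\<forall>k < length js. q ! Suc k \<in> {q ! k, q ! k \<circ> srefl D (js ! k)})
      \<and> (\<forall>k < length js. q ! Suc k = q ! k \<and> q ! k \<circ> srefl D (js ! k) \<in> A \<longrightarrow> neg_crossing D (q ! k) (js ! k))"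
    by (simp add: folded_paths_def)
  ultimately show ?thesis by argo
qed

text \<open>A path is its first alcove followed by a path of the remaining type, which starts at the neighbour after a
  crossing and at \<open>v\<close> itself after a fold or a bounce.\<close>

lemma folded_paths_Cons:
  assumes v: "v \<in> A" and i: "i \<in> {0..DIM('a)}"
  shows "folded_paths D J (i # js) \<sigma> v =
    (#) v ` ((if v \<circ> srefl D i \<in> A then folded_paths D J js \<sigma> (v \<circ> srefl D i) else {})
      \<union> (if may_stay v i then folded_paths D J js \<sigma> v else {}))" (is "?L = (#) v ` (?M \<union> ?S)")
proof -
  have tail: "v # q \<in> ?L \<longleftrightarrow> q \<in> ?M \<union> ?S" for q
  proof -
    have mM: "q \<in> ?M \<longleftrightarrow> q \<in> folded_paths D J js \<sigma> (q ! 0) \<and> q ! 0 = v \<circ> srefl D i"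
      using folded_paths_start[of q js \<sigma> "v \<circ> srefl D i"] folded_paths_mem[of q js \<sigma> "q ! 0" 0] by auto
    have mS: "q \<in> ?S \<longleftrightarrow> may_stay v i \<and> q \<in> folded_paths D J js \<sigma> (q ! 0) \<and> q ! 0 = v"
      using folded_paths_start[of q js \<sigma> v] by auto
    show ?thesis
      unfolding folded_paths_Cons_iff[OF v] Un_iff mM mS unfolding may_stay_def
      using srefl_moves[OF v i] by (cases "q ! 0 = v") auto
  qed
  have "\<exists>q. p = v # q" if "p \<in> ?L" for p
    using folded_paths_length[OF that] folded_paths_first[OF that] by (cases p) auto
  then show ?thesis using tail by blast
qed

lemma finite_folded_paths:
  assumes "js \<in> lists {0..DIM('a)}" "v \<in> A" "\<sigma> \<in> alcove_stab D"
  shows "finite (folded_paths D J js \<sigma> v)"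
  using assms(1,2)
proof (induction js arbitrary: v)
  case Nil
  then show ?case using folded_paths_Nil assms(3) by simp
next
  case (Cons i js)
  then show ?case by (subst folded_paths_Cons) auto
qed

lemma bounce_count_Cons:
  "bounce_count D J (i # js) (v # q) \<gamma> =
    (if q ! 0 = v \<and> v \<circ> srefl D i \<notin> A then bounce_mult v i \<gamma> else 0) + bounce_count D J js q \<gamma>"
proof -
  let ?P = "\<lambda>k. pos_bounce_on D J (i # js) (v # q) k \<gamma> 0" and ?N = "\<lambda>k. neg_bounce_on D J (i # js) (v # q) k \<gamma> 1"
  have "{k. ?P k} \<subseteq> {..<length (i # js)}" "{k. ?N k} \<subseteq> {..<length (i # js)}"
    by (auto simp: pos_bounce_on_def neg_bounce_on_def bounce_at_def)
  then have fin: "finite {k. ?P k}" "finite {k. ?N k}" using finite_subset by blast+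
  have "?P 0 \<longleftrightarrow> q ! 0 = v \<and> v \<circ> srefl D i \<notin> A \<and> counts_pos v i \<gamma>"
    "?N 0 \<longleftrightarrow> q ! 0 = v \<and> v \<circ> srefl D i \<notin> A \<and> counts_neg v i \<gamma>"
    by (auto simp: pos_bounce_on_def neg_bounce_on_def bounce_at_def counts_pos_def counts_neg_def)
  moreover have "?P (Suc k) = pos_bounce_on D J js q k \<gamma> 0" "?N (Suc k) = neg_bounce_on D J js q k \<gamma> 1" for k
    by (simp_all add: pos_bounce_on_def neg_bounce_on_def bounce_at_def)
  ultimately show ?thesis
    using card_split_first[OF fin(1)] card_split_first[OF fin(2)] by (simp add: bounce_count_def bounce_mult_def)
qed

lemma fold_count_Cons:
  "fold_count D J (i # js) (v # q) j =
    (if j = i \<and> q ! 0 = v \<and> v \<circ> srefl D i \<in> A then 1 else 0) + fold_count D J js q j"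
proof -
  let ?P = "\<lambda>k. k < length (i # js) \<and> (i # js) ! k = j \<and> (v # q) ! Suc k = (v # q) ! k \<and> (v # q) ! k \<circ> srefl D j \<in> A"
  have "finite {k. ?P k}" by (rule finite_subset[of _ "{..<length (i # js)}"]) auto
  from card_split_first[OF this] show ?thesis by (simp add: fold_count_def eq_commute conj_commute cong: conj_cong)
qed

end

section \<open>Masses of paths\<close>

lemma subring_set_prod: "subring_set A \<Longrightarrow> (\<And>i. i \<in> S \<Longrightarrow> f i \<in> A) \<Longrightarrow> prod f S \<in> A"
  by (induction S rule: infinite_finite_induct) (auto simp: subring_set_def)

lemma subring_set_power: "subring_set A \<Longrightarrow> a \<in> A \<Longrightarrow> a ^ k \<in> A"
  by (induction k) (auto simp: subring_set_def)

text \<open>The parameter family is called \<open>c\<close>, since \<open>v\<close> denotes alcoves.\<close>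

locale hecke_module = parabolic D J for D :: "'a::euclidean_space root_datum" and J +
  fixes c :: "'a \<Rightarrow> int laurent"
    and H :: "(int laurent, 'h) module"
    and T :: "('a \<Rightarrow> 'a) \<Rightarrow> 'h"
    and M :: "(int laurent laurent set, 'm) module"
    and act :: "'m \<Rightarrow> 'h \<Rightarrow> 'm"
    and m :: "('a \<Rightarrow> 'a) \<Rightarrow> 'm"
  assumes params: "parameter_system D J c"
    and hecke: "hecke_algebra D H T"
    and standard: "standard_module D J c H T M act m"
begin

lemma finite_Phi_Jp: "finite \<Phi>Jp"
  using finite_roots by (auto simp: parab_pos_roots_def parab_roots_def)

lemma c_carrier: "\<beta> \<in> \<Phi>J \<Longrightarrow> c \<beta> \<in> carrier (R_ring D)"
  using params by (auto simp: parameter_system_def Units_def)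

lemma c_invariant: "\<beta> \<in> \<Phi>J \<Longrightarrow> y \<in> WJ \<Longrightarrow> c (y \<beta>) = c \<beta>"
  using params by (auto simp: parameter_system_def)

lemma c_pos_carrier: "\<beta> \<in> \<Phi>Jp \<Longrightarrow> c \<beta> \<in> carrier (R_ring D)"
  using c_carrier by (auto simp: parab_pos_roots_def)

lemma mass_eq:
  "mass D J c js p = (\<Prod>\<gamma>\<in>\<Phi>Jp. c \<gamma> ^ bounce_count D J js p \<gamma>) * (\<Prod>i\<in>{0..DIM('a)}. qdiff D i ^ fold_count D J js p i)"
proof -
  have "c \<gamma> ^ k \<in> carrier (R_ring D)" if "\<gamma> \<in> \<Phi>Jp" for \<gamma> k
    using subring_set_power[OF subring_R c_pos_carrier[OF that]] .
  moreover have "qdiff D i ^ k \<in> carrier (R_ring D)" if "i \<in> {0..DIM('a)}" for i k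
    using subring_set_power[OF subring_R qdiff_carrier[OF that]] .
  ultimately show ?thesis
    unfolding mass_def R_ring_def pow_laurent laurent_ring_simps
    by (subst (1 2) finprod_laurent[OF subring_UNIV]) (simp_all add: finite_Phi_Jp)
qed

lemma mass_carrier: "mass D J c js p \<in> carrier (R_ring D)"
proof -
  have "(\<Prod>\<gamma>\<in>\<Phi>Jp. c \<gamma> ^ bounce_count D J js p \<gamma>) \<in> carrier (R_ring D)"
    by (intro subring_set_prod[OF subring_R] subring_set_power[OF subring_R] c_pos_carrier)
  moreover have "(\<Prod>i\<in>{0..DIM('a)}. qdiff D i ^ fold_count D J js p i) \<in> carrier (R_ring D)"
    by (intro subring_set_prod[OF subring_R] subring_set_power[OF subring_R] qdiff_carrier)
  ultimately show ?thesis using subring_R[of D] unfolding mass_eq by (simp add: subring_set_def)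
qed

lemma bounce_scalar_eq:
  assumes v: "v \<in> A" and i: "i \<in> {0..DIM('a)}" and d: "dir v i \<in> \<Phi>J"
  shows "bounce_scalar D J c (theta_up D J v) i
    = c (dir v i) * (if 2 *\<^sub>R dir v i \<in> \<Phi>J then c (2 *\<^sub>R dir v i) else 1)"
proof -
  obtain y where y: "y \<in> WJ" "dir v i = y (theta_up D J v (\<eta> i))"
    using dir_theta[OF alcoves_in_ext[OF v] i] by metis
  let ?b = "theta_up D J v (\<eta> i)"
  have two: "2 *\<^sub>R dir v i = y (2 *\<^sub>R ?b)"
    using y linear_scale[OF isometry_linear[OF weyl_isometry[OF WJ_weyl[OF y(1)]]]] by simp
  have "bounce_scalar D J c (theta_up D J v) i
      = (if ?b \<in> \<Phi>J then c ?b else 1) * (if 2 *\<^sub>R ?b \<in> \<Phi>J then c (2 *\<^sub>R ?b) else 1)"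
    by (simp add: bounce_scalar_def affine_param_def case_prod_beta R_ring_simps)
  moreover have "?b \<in> \<Phi>J" using d WJ_root_iff[OF y(1), of ?b] y(2) by simp
  ultimately show ?thesis
    using c_invariant[OF _ y(1), of ?b] c_invariant[OF _ y(1), of "2 *\<^sub>R ?b"] WJ_root_iff[OF y(1), of "2 *\<^sub>R ?b"]
    unfolding two unfolding y(2) by simp
qed

lemma bounce_scalar_carrier:
  assumes v: "v \<in> A" and i: "i \<in> {0..DIM('a)}" and d: "dir v i \<in> \<Phi>J"
  shows "bounce_scalar D J c (theta_up D J v) i \<in> carrier (R_ring D)"
  using bounce_scalar_eq[OF assms] subring_R[of D] c_carrier[OF d] c_carrier[of "2 *\<^sub>R dir v i"]
  by (auto simp: subring_set_def)

definition stay_weight :: "('a \<Rightarrow> 'a) \<Rightarrow> nat \<Rightarrow> int laurent" where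
  "stay_weight v i = (if v \<circ> srefl D i \<in> A then qdiff D i else bounce_scalar D J c (theta_up D J v) i)"

lemma stay_weight_carrier:
  "v \<in> A \<Longrightarrow> i \<in> {0..DIM('a)} \<Longrightarrow> stay_weight v i \<in> carrier (R_ring D)"
  using bounce_scalar_carrier[of v i] qdiff_carrier[of i D] step_alcoves_in_iff[of v i]
  by (simp add: stay_weight_def)

text \<open>A fold contributes \<open>q\<^sub>i - q\<^sub>i\<^sup>-\<^sup>1\<close>; a bounce contributes the product of parameters in \<open>bounce_product\<close>.\<close>

lemma mass_stay:
  assumes v: "v \<in> A" and i: "i \<in> {0..DIM('a)}" and q: "q ! 0 = v"
  shows "mass D J c (i # js) (v # q) = stay_weight v i * mass D J c js q"
proof (cases "v \<circ> srefl D i \<in> A")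
  case True
  have "(\<Prod>j\<in>{0..DIM('a)}. qdiff D j ^ fold_count D J (i # js) (v # q) j)
      = (\<Prod>j\<in>{0..DIM('a)}. (if j = i then qdiff D j else 1) * qdiff D j ^ fold_count D J js q j)"
    using True q by (intro prod.cong) (auto simp: fold_count_Cons power_add)
  also have "\<dots> = qdiff D i * (\<Prod>j\<in>{0..DIM('a)}. qdiff D j ^ fold_count D J js q j)"
    using i by (simp add: prod.distrib)
  finally show ?thesis using True q by (simp add: mass_eq bounce_count_Cons stay_weight_def mult_ac)
next
  case False
  then have d: "dir v i \<in> \<Phi>J" using step_alcoves_in_iff[OF v i] by blast
  have "(\<Prod>\<gamma>\<in>\<Phi>Jp. c \<gamma> ^ bounce_count D J (i # js) (v # q) \<gamma>)
      = (\<Prod>\<gamma>\<in>\<Phi>Jp. c \<gamma> ^ bounce_mult v i \<gamma>) * (\<Prod>\<gamma>\<in>\<Phi>Jp. c \<gamma> ^ bounce_count D J js q \<gamma>)"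
    using False q by (simp add: bounce_count_Cons power_add prod.distrib)
  also have "(\<Prod>\<gamma>\<in>\<Phi>Jp. c \<gamma> ^ bounce_mult v i \<gamma>) = stay_weight v i"
    using False bounce_product[OF v i d, of c] c_invariant bounce_scalar_eq[OF v i d] by (simp add: stay_weight_def)
  finally show ?thesis using False by (simp add: mass_eq fold_count_Cons mult_ac)
qed

lemma mass_move: "q ! 0 \<noteq> v \<Longrightarrow> mass D J c (i # js) (v # q) = mass D J c js q"
  by (simp add: mass_eq bounce_count_Cons fold_count_Cons)

lemma mass_Nil: "mass D J c [] p = 1"
  by (simp add: mass_eq bounce_count_def fold_count_def pos_bounce_on_def neg_bounce_on_def bounce_at_def)

section \<open>The action of the Hecke algebra as a sum over paths\<close>

lemma module_M: "module RJ M"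
  using standard by (simp add: standard_module_def right_hecke_module_def)

lemma act_closed: "z \<in> carrier M \<Longrightarrow> h \<in> carrier H \<Longrightarrow> act z h \<in> carrier M"
  and act_add: "z \<in> carrier M \<Longrightarrow> z' \<in> carrier M \<Longrightarrow> h \<in> carrier H \<Longrightarrow>
    act (z \<oplus>\<^bsub>M\<^esub> z') h = act z h \<oplus>\<^bsub>M\<^esub> act z' h"
  and act_smult: "r \<in> carrier RJ \<Longrightarrow> z \<in> carrier M \<Longrightarrow> h \<in> carrier H \<Longrightarrow>
    act (r \<odot>\<^bsub>M\<^esub> z) h = r \<odot>\<^bsub>M\<^esub> act z h"
  and act_mult: "z \<in> carrier M \<Longrightarrow> g \<in> carrier H \<Longrightarrow> h \<in> carrier H \<Longrightarrow>
    act z (g \<otimes>\<^bsub>H\<^esub> h) = act (act z g) h"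
  using standard by (simp_all add: standard_module_def right_hecke_module_def)

lemma T_closed: "w \<in> ext_weyl D \<Longrightarrow> T w \<in> carrier H"
  using hecke by (auto simp: hecke_algebra_def)

lemma T_mult:
  "w \<in> ext_weyl D \<Longrightarrow> w' \<in> ext_weyl D \<Longrightarrow> ext_length D (w \<circ> w') = ext_length D w + ext_length D w' \<Longrightarrow>
    T w \<otimes>\<^bsub>H\<^esub> T w' = T (w \<circ> w')"
  using hecke by (simp add: hecke_algebra_def)

lemma m_closed: "u \<in> min_reps D J \<Longrightarrow> m u \<in> carrier M"
  using standard by (auto simp: standard_module_def)

text \<open>Letters are split off at the front, so that \<open>T\<^sub>\<sigma>\<close> alone remains for the empty word.\<close>

lemma T_word_Cons:
  assumes "reduced (i # js)" "\<sigma> \<in> alcove_stab D"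
  shows "T (word_prod D (i # js) \<circ> \<sigma>) = T (srefl D i) \<otimes>\<^bsub>H\<^esub> T (word_prod D js \<circ> \<sigma>)"
proof -
  have r: "reduced [i]" "reduced js" using reduced_append[of "[i]" js] assms(1) by simp_all
  have a: "word_prod D js \<in> affine_weyl D" "word_prod D (i # js) \<in> affine_weyl D" "word_prod D [i] \<in> affine_weyl D"
    using r assms(1) gen_group_word unfolding reduced_def by blast+
  have "ext_length D (word_prod D (i # js) \<circ> \<sigma>) = Suc (length js)"
    using ext_length_affine[OF a(2) assms(2)] assms(1) by (simp only: reduced_def length_Cons)
  moreover have "ext_length D (word_prod D js \<circ> \<sigma>) = length js"
    using ext_length_affine[OF a(1) assms(2)] r(2) by (simp only: reduced_def)
  moreover have "ext_length D (srefl D i) = 1"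
    using ext_length_affine'[OF a(3)] r(1) by (simp add: reduced_def)
  ultimately have "ext_length D (srefl D i \<circ> (word_prod D js \<circ> \<sigma>))
      = ext_length D (srefl D i) + ext_length D (word_prod D js \<circ> \<sigma>)"
    by (simp add: comp_assoc)
  moreover have "srefl D i \<in> ext_weyl D" using affine_weyl_ext[OF a(3)] by simp
  moreover have "word_prod D js \<circ> \<sigma> \<in> ext_weyl D"
    using ext_comp(1)[OF affine_weyl_ext[OF a(1)] alcove_stab_ext[OF assms(2)]] .
  ultimately show ?thesis using T_mult by (simp add: comp_assoc)
qed

definition mvec :: "('a \<Rightarrow> 'a) \<Rightarrow> 'm" where
  "mvec v = zetaJ D J (wt D v) \<odot>\<^bsub>M\<^esub> m (theta_up D J v)"

lemma theta_up_mem: "v \<in> ext_weyl D \<Longrightarrow> theta_up D J v \<in> min_reps D J"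
  using theta_up_decomp by metis

lemma mvec_closed: "v \<in> ext_weyl D \<Longrightarrow> mvec v \<in> carrier M"
proof -
  assume v: "v \<in> ext_weyl D"
  interpret Mod: module RJ M by (rule module_M)
  show ?thesis unfolding mvec_def
    using zetaJ_carrier[OF ext_decomp(1)[OF v]] m_closed[OF theta_up_mem[OF v]] by simp
qed

lemma mvec_comp:
  assumes v: "v \<in> ext_weyl D" and g: "g \<in> ext_weyl D"
  shows "zetaJ D J (wt D v) \<odot>\<^bsub>M\<^esub> (zetaJ D J (wt D (theta_up D J v \<circ> g)) \<odot>\<^bsub>M\<^esub> m (theta_up D J (theta_up D J v \<circ> g)))
    = mvec (v \<circ> g)"
proof -
  interpret Mod: module RJ M by (rule module_M)
  have u: "theta_up D J v \<circ> g \<in> ext_weyl D"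
    using ext_comp(1)[OF weyl_ext(1)[OF min_reps_weyl[OF theta_up_mem[OF v]]] g] .
  have vg: "v \<circ> g \<in> ext_weyl D" using ext_comp(1)[OF v g] .
  note cw = ext_decomp(1)[OF v] ext_decomp(1)[OF u] ext_decomp(1)[OF vg]
  have "zetaJ D J (wt D (v \<circ> g)) = zetaJ D J (wt D v) \<otimes>\<^bsub>RJ\<^esub> zetaJ D J (wt D (theta_up D J v \<circ> g))"
    using zetaJ_cong[OF cw(3) coweights_add[OF cw(1,2)] theta_up_comp(2)[OF v g]] zetaJ_add[OF cw(1,2)] by simp
  then show ?thesis
    using Mod.smult_assoc1[OF zetaJ_carrier[OF cw(1)] zetaJ_carrier[OF cw(2)] m_closed[OF theta_up_mem[OF u]]]
      theta_up_comp(1)[OF v g] by (simp add: mvec_def)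
qed

lemma act_T_stab:
  assumes v: "v \<in> ext_weyl D" and s: "\<sigma> \<in> alcove_stab D"
  shows "act (mvec v) (T \<sigma>) = mvec (v \<circ> \<sigma>)"
proof -
  have se: "\<sigma> \<in> ext_weyl D" using alcove_stab_ext s by blast
  have "act (mvec v) (T \<sigma>) = zetaJ D J (wt D v) \<odot>\<^bsub>M\<^esub> act (m (theta_up D J v)) (T \<sigma>)"
    unfolding mvec_def using act_smult zetaJ_carrier ext_decomp(1)[OF v] m_closed theta_up_mem[OF v] T_closed[OF se] by blast
  also have "act (m (theta_up D J v)) (T \<sigma>)
      = zetaJ D J (wt D (theta_up D J v \<circ> \<sigma>)) \<odot>\<^bsub>M\<^esub> m (theta_up D J (theta_up D J v \<circ> \<sigma>))"
    using standard theta_up_mem[OF v] s unfolding standard_module_def by blast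
  finally show ?thesis using mvec_comp[OF v se] by simp
qed

text \<open>The defining formulas for \<open>m\<^sub>u \<cdot> T\<^sub>i\<close>, \<open>u \<in> W\<^sup>J\<close>, extend to all alcoves of the strip, since the step at \<open>v\<close> is of the same
  kind as the step at \<open>\<theta>\<^sup>J(v)\<close> and the weights agree modulo \<open>Q\<^sub>J\<close>.\<close>

lemma act_T_srefl:
  assumes v: "v \<in> A" and i: "i \<in> {0..DIM('a)}"
  shows "act (mvec v) (T (srefl D i)) =
    (if v \<circ> srefl D i \<in> A then mvec (v \<circ> srefl D i) else \<zero>\<^bsub>M\<^esub>) \<oplus>\<^bsub>M\<^esub>
    (if may_stay v i then R_to_zetaJ D J (stay_weight v i) \<odot>\<^bsub>M\<^esub> mvec v else \<zero>\<^bsub>M\<^esub>)"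
proof -
  interpret Mod: module RJ M by (rule module_M)
  note ve = alcoves_in_ext[OF v]
  let ?u = "theta_up D J v" and ?z = "zetaJ D J (wt D v)" and ?r = "R_to_zetaJ D J (stay_weight v i)"
  have u: "?u \<in> min_reps D J" by (rule theta_up_mem[OF ve])
  have mu: "m ?u \<in> carrier M" by (rule m_closed[OF u])
  have z: "?z \<in> carrier RJ" by (rule zetaJ_carrier[OF ext_decomp(1)[OF ve]])
  have r: "?r \<in> carrier RJ" by (rule ring_hom_closed[OF R_to_zetaJ_hom stay_weight_carrier[OF v i]])
  note se = srefl_ext[OF i]
  let ?n = "zetaJ D J (wt D (?u \<circ> srefl D i)) \<odot>\<^bsub>M\<^esub> m (theta_up D J (?u \<circ> srefl D i))"
  have ue: "?u \<circ> srefl D i \<in> ext_weyl D"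
    by (rule ext_comp(1)[OF weyl_ext(1)[OF min_reps_weyl[OF u]] se])
  have n: "?n \<in> carrier M"
    using zetaJ_carrier[OF ext_decomp(1)[OF ue]] m_closed[OF theta_up_mem[OF ue]] by simp
  have zn: "?z \<odot>\<^bsub>M\<^esub> ?n = mvec (v \<circ> srefl D i)" by (rule mvec_comp[OF ve se])
  have mvs: "mvec (v \<circ> srefl D i) \<in> carrier M" by (rule mvec_closed[OF ext_srefl[OF ve i]])
  have zr: "?z \<odot>\<^bsub>M\<^esub> (?r \<odot>\<^bsub>M\<^esub> m ?u) = ?r \<odot>\<^bsub>M\<^esub> mvec v"
    unfolding mvec_def using z r mu by (metis Mod.smult_assoc1 Mod.R.m_comm)
  have rmv: "?r \<odot>\<^bsub>M\<^esub> mvec v \<in> carrier M" using r mvec_closed[OF ve] by simp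
  have a: "act (mvec v) (T (srefl D i)) = ?z \<odot>\<^bsub>M\<^esub> act (m ?u) (T (srefl D i))"
    unfolding mvec_def by (rule act_smult[OF z mu T_closed[OF se]])
  note step = theta_step[OF v i]
  note formulas = standard[unfolded standard_module_def, THEN conjunct2, THEN conjunct2, THEN conjunct2,
      THEN conjunct2, THEN bspec, OF u, THEN bspec, OF i]
  consider "v \<circ> srefl D i \<notin> A" | "v \<circ> srefl D i \<in> A" "neg_crossing D v i" | "v \<circ> srefl D i \<in> A" "\<not> neg_crossing D v i"
    by blast
  then show ?thesis
  proof cases
    case 1
    then have "act (m ?u) (T (srefl D i)) = ?r \<odot>\<^bsub>M\<^esub> m ?u"
      using formulas step(1) by (simp add: stay_weight_def)
    then show ?thesis using 1 a zr rmv by (simp add: may_stay_def)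
  next
    case 2
    then have "act (m ?u) (T (srefl D i)) = ?n \<oplus>\<^bsub>M\<^esub> ?r \<odot>\<^bsub>M\<^esub> m ?u"
      using formulas step by (simp add: stay_weight_def)
    then have "act (mvec v) (T (srefl D i)) = ?z \<odot>\<^bsub>M\<^esub> ?n \<oplus>\<^bsub>M\<^esub> ?z \<odot>\<^bsub>M\<^esub> (?r \<odot>\<^bsub>M\<^esub> m ?u)"
      using a Mod.smult_r_distr[OF z n] r mu by simp
    then show ?thesis using 2 zn zr by (simp add: may_stay_def)
  next
    case 3
    then have "act (m ?u) (T (srefl D i)) = ?n" using formulas step by simp
    then show ?thesis using 3 a zn mvs by (simp add: may_stay_def)
  qed
qed

definition path_term :: "nat list \<Rightarrow> ('a \<Rightarrow> 'a) list \<Rightarrow> 'm" where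
  "path_term js p = R_to_zetaJ D J (mass D J c js p) \<odot>\<^bsub>M\<^esub> mvec (last p)"

lemma path_term_closed:
  assumes "p \<in> folded_paths D J js \<sigma> v" shows "path_term js p \<in> carrier M"
proof -
  interpret Mod: module RJ M by (rule module_M)
  show ?thesis unfolding path_term_def
    using ring_hom_closed[OF R_to_zetaJ_hom mass_carrier] mvec_closed[OF alcoves_in_ext[OF folded_paths_last[OF assms]]] by simp
qed

text \<open>The two summands of \<open>act_T_srefl\<close> match the two parts of \<open>folded_paths_Cons\<close>, and the scalar of the second one is
  the factor by which the first step changes the mass.\<close>

lemma act_path_sum:
  assumes "reduced js" "\<sigma> \<in> alcove_stab D" "v \<in> A"
  shows "act (mvec v) (T (word_prod D js \<circ> \<sigma>)) = (\<Oplus>\<^bsub>M\<^esub>p\<in>folded_paths D J js \<sigma> v. path_term js p)"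
  using assms(1,3)
proof (induction js arbitrary: v)
  case Nil
  interpret Mod: module RJ M by (rule module_M)
  have "v \<circ> \<sigma> \<in> ext_weyl D" using ext_comp(1)[OF alcoves_in_ext[OF Nil.prems(2)] alcove_stab_ext[OF assms(2)]] .
  note mvc = mvec_closed[OF this]
  have "path_term [] [v, v \<circ> \<sigma>] = mvec (v \<circ> \<sigma>)"
    using mvc ring_hom_one[OF R_to_zetaJ_hom] by (simp add: path_term_def mass_Nil R_ring_simps)
  then show ?case
    using act_T_stab[OF alcoves_in_ext[OF Nil.prems(2)] assms(2)] mvc
    by (simp add: folded_paths_Nil[OF Nil.prems(2) assms(2)])
next
  case (Cons i js)
  interpret Mod: module RJ M by (rule module_M)
  note v = Cons.prems(2)
  have i: "i \<in> {0..DIM('a)}" and js: "js \<in> lists {0..DIM('a)}" using Cons.prems(1) by (auto simp: reduced_def)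
  have r: "reduced js" using reduced_append(2)[of "[i]" js] Cons.prems(1) by simp
  let ?P = "folded_paths D J js \<sigma>" and ?vs = "v \<circ> srefl D i" and ?h = "T (word_prod D js \<circ> \<sigma>)"
  let ?Mv = "if ?vs \<in> A then ?P ?vs else {}" and ?St = "if may_stay v i then ?P v else {}"
  let ?r = "R_to_zetaJ D J (stay_weight v i)"
  have hext: "word_prod D js \<circ> \<sigma> \<in> ext_weyl D"
    using ext_comp(1)[OF affine_weyl_ext[OF gen_group_word[OF js]] alcove_stab_ext[OF assms(2)]] .
  have h: "?h \<in> carrier H" by (rule T_closed[OF hext])
  have rc: "?r \<in> carrier RJ" by (rule ring_hom_closed[OF R_to_zetaJ_hom stay_weight_carrier[OF v i]])
  have mvv: "mvec v \<in> carrier M" by (rule mvec_closed[OF alcoves_in_ext[OF v]])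
  have mvs: "mvec ?vs \<in> carrier M" by (rule mvec_closed[OF ext_srefl[OF alcoves_in_ext[OF v] i]])
  have fin: "finite ?Mv" "finite ?St" using finite_folded_paths[OF js _ assms(2)] v by auto
  have disj: "?Mv \<inter> ?St = {}"
  proof -
    have "q \<notin> ?P ?vs \<inter> ?P v" for q
      using folded_paths_first[of q js \<sigma> v] folded_paths_first[of q js \<sigma> ?vs] srefl_moves[OF v i] by auto
    then show ?thesis by (auto split: if_splits)
  qed
  have act0: "act \<zero>\<^bsub>M\<^esub> ?h = \<zero>\<^bsub>M\<^esub>"
    using act_smult[OF Mod.R.zero_closed Mod.M.zero_closed h] act_closed[OF Mod.M.zero_closed h] by simp
  \<comment> \<open>the terms that leave \<open>v\<close> in the first step\<close>
  have move: "act (if ?vs \<in> A then mvec ?vs else \<zero>\<^bsub>M\<^esub>) ?h = (\<Oplus>\<^bsub>M\<^esub>q\<in>?Mv. path_term (i # js) (v # q))"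
  proof (cases "?vs \<in> A")
    case True
    have "path_term (i # js) (v # q) = path_term js q" if q: "q \<in> ?P ?vs" for q
    proof -
      have "q \<noteq> []" using folded_paths_length[OF q] by auto
      moreover have "q ! 0 \<noteq> v" using folded_paths_first[OF q] srefl_moves[OF v i] by simp
      ultimately show ?thesis using mass_move by (simp add: path_term_def)
    qed
    then have e: "(\<Oplus>\<^bsub>M\<^esub>q\<in>?P ?vs. path_term (i # js) (v # q)) = (\<Oplus>\<^bsub>M\<^esub>q\<in>?P ?vs. path_term js q)"
      using path_term_closed by (intro Mod.M.finsum_cong') auto
    show ?thesis unfolding if_P[OF True] e by (rule Cons.IH[OF r True])
  qed (use act0 in simp)
  \<comment> \<open>the terms that fold or bounce in the first step\<close>
  have stay: "act (if may_stay v i then ?r \<odot>\<^bsub>M\<^esub> mvec v else \<zero>\<^bsub>M\<^esub>) ?h = (\<Oplus>\<^bsub>M\<^esub>q\<in>?St. path_term (i # js) (v # q))"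
  proof (cases "may_stay v i")
    case True
    have "path_term (i # js) (v # q) = ?r \<odot>\<^bsub>M\<^esub> path_term js q" if q: "q \<in> ?P v" for q
    proof -
      have "q \<noteq> []" using folded_paths_length[OF q] by auto
      moreover have "R_to_zetaJ D J (mass D J c (i # js) (v # q)) = ?r \<otimes>\<^bsub>RJ\<^esub> R_to_zetaJ D J (mass D J c js q)"
        using ring_hom_mult[OF R_to_zetaJ_hom stay_weight_carrier[OF v i] mass_carrier[of js q]]
          mass_stay[OF v i folded_paths_first[OF q]] by (simp add: R_ring_simps)
      ultimately show ?thesis
        using Mod.smult_assoc1[OF rc ring_hom_closed[OF R_to_zetaJ_hom mass_carrier[of js q]]
            mvec_closed[OF alcoves_in_ext[OF folded_paths_last[OF q]]]] by (simp add: path_term_def)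
    qed
    then have "(\<Oplus>\<^bsub>M\<^esub>q\<in>?P v. path_term (i # js) (v # q)) = (\<Oplus>\<^bsub>M\<^esub>q\<in>?P v. ?r \<odot>\<^bsub>M\<^esub> path_term js q)"
      using path_term_closed rc by (intro Mod.M.finsum_cong') auto
    also have "\<dots> = ?r \<odot>\<^bsub>M\<^esub> (\<Oplus>\<^bsub>M\<^esub>q\<in>?P v. path_term js q)"
      using Mod.finsum_smult_ldistr[of "?P v" ?r "path_term js"] finite_folded_paths[OF js v assms(2)] rc path_term_closed
      by auto
    also have "\<dots> = act (?r \<odot>\<^bsub>M\<^esub> mvec v) ?h" by (simp only: act_smult[OF rc mvv h] Cons.IH[OF r v])
    finally show ?thesis using True by simp
  qed (use act0 in simp)
  have cl: "path_term (i # js) (v # q) \<in> carrier M" if "q \<in> ?Mv \<union> ?St" for q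
  proof (rule path_term_closed)
    show "v # q \<in> folded_paths D J (i # js) \<sigma> v" using that folded_paths_Cons[OF v i] by blast
  qed
  have "act (mvec v) (T (word_prod D (i # js) \<circ> \<sigma>)) = act (act (mvec v) (T (srefl D i))) ?h"
    using T_word_Cons[OF Cons.prems(1) assms(2)] act_mult[OF mvv T_closed[OF srefl_ext[OF i]] h] by simp
  also have "\<dots> = (\<Oplus>\<^bsub>M\<^esub>q\<in>?Mv. path_term (i # js) (v # q)) \<oplus>\<^bsub>M\<^esub> (\<Oplus>\<^bsub>M\<^esub>q\<in>?St. path_term (i # js) (v # q))"
    unfolding act_T_srefl[OF v i] move[symmetric] stay[symmetric]
    by (rule act_add[OF _ _ h]) (use mvs mvv rc in auto)
  also have "\<dots> = (\<Oplus>\<^bsub>M\<^esub>q\<in>?Mv \<union> ?St. path_term (i # js) (v # q))"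
    using Mod.M.finsum_Un_disjoint[OF fin disj] cl by auto
  also have "\<dots> = (\<Oplus>\<^bsub>M\<^esub>p\<in>folded_paths D J (i # js) \<sigma> v. path_term (i # js) p)"
    unfolding folded_paths_Cons[OF v i] using cl by (subst Mod.M.finsum_reindex) auto
  finally show ?case .
qed

lemma matrix_entry_eq:
  assumes "f \<in> min_reps D J \<rightarrow> carrier RJ" "u \<in> min_reps D J" "h \<in> carrier H"
    "act (m u) h = lin_comb D J M m f" "x \<in> min_reps D J"
  shows "matrix_entry D J M act m h u x = f x"
proof -
  interpret Mod: module RJ M by (rule module_M)
  let ?Q = "\<lambda>g. g \<in> min_reps D J \<rightarrow>\<^sub>E carrier RJ \<and> act (m u) h = lin_comb D J M m g"
  have "lin_comb D J M m (restrict f (min_reps D J)) = lin_comb D J M m f"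
    unfolding lin_comb_def using assms(1) m_closed by (intro Mod.M.finsum_cong') auto
  then have q: "?Q (restrict f (min_reps D J))" using assms(1,4) by auto
  have ex1: "\<exists>!g. ?Q g"
    using standard act_closed[OF m_closed[OF assms(2)] assms(3)] unfolding standard_module_def by blast
  have "(THE g. ?Q g) = restrict f (min_reps D J)" by (rule the1_equality[of ?Q, OF ex1 q])
  then show ?thesis using assms(5) by (simp add: matrix_entry_def)
qed

lemma finsum_smult_rdistr:
  assumes "finite S" "f \<in> S \<rightarrow> carrier RJ" "z \<in> carrier M"
  shows "(\<Oplus>\<^bsub>RJ\<^esub>p\<in>S. f p) \<odot>\<^bsub>M\<^esub> z = (\<Oplus>\<^bsub>M\<^esub>p\<in>S. f p \<odot>\<^bsub>M\<^esub> z)"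
proof -
  interpret Mod: module RJ M by (rule module_M)
  show ?thesis using assms(1,2)
  proof (induction S rule: finite_induct)
    case empty
    then show ?case using assms(3) by simp
  next
    case (insert p S)
    then have "f \<in> S \<rightarrow> carrier RJ" "f p \<in> carrier RJ" by auto
    moreover have "(\<lambda>p. f p \<odot>\<^bsub>M\<^esub> z) \<in> S \<rightarrow> carrier M" "f p \<odot>\<^bsub>M\<^esub> z \<in> carrier M"
      using calculation assms(3) by auto
    ultimately show ?case using insert assms(3) by (simp add: Mod.smult_l_distr)
  qed
qed

lemma mvec_min_rep: "u \<in> min_reps D J \<Longrightarrow> mvec u = m u"
proof -
  assume u: "u \<in> min_reps D J"
  interpret Mod: module RJ M by (rule module_M)
  show ?thesis using weyl_ext(2)[OF min_reps_weyl[OF u]] theta_up_min_rep[OF u] m_closed[OF u]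
    by (simp add: mvec_def zetaJ_zero)
qed

text \<open>The vector at the end of a path \<open>p\<close> is a multiple of \<open>m\<^sub>y\<close> with \<open>y = \<theta>\<^sup>J(p)\<close>, so the sum over all paths splits along
  the fibres of \<open>\<theta>\<^sup>J\<close> into a linear combination of the basis.\<close>

lemma matrix_entry_path_sum:
  assumes js: "reduced js" and s: "\<sigma> \<in> alcove_stab D" and x: "x \<in> min_reps D J" and y: "y \<in> min_reps D J"
  shows "matrix_entry D J M act m (T (word_prod D js \<circ> \<sigma>)) x y =
    (\<Oplus>\<^bsub>RJ\<^esub>p\<in>{p \<in> folded_paths D J js \<sigma> x. theta_up D J (last p) = y}.
       R_to_zetaJ D J (mass D J c js p) \<otimes>\<^bsub>RJ\<^esub> zetaJ D J (wt D (last p)))"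
proof -
  interpret Mod: module RJ M by (rule module_M)
  let ?P = "folded_paths D J js \<sigma> x"
  let ?Py = "\<lambda>y. {p \<in> ?P. theta_up D J (last p) = y}"
  define a where "a p = R_to_zetaJ D J (mass D J c js p) \<otimes>\<^bsub>RJ\<^esub> zetaJ D J (wt D (last p))" for p
  let ?f = "\<lambda>y. \<Oplus>\<^bsub>RJ\<^esub>p\<in>?Py y. a p"
  have xA: "x \<in> A" by (rule min_reps_alcoves_in[OF x])
  have jsl: "js \<in> lists {0..DIM('a)}" using js by (simp add: reduced_def)
  have fin: "finite ?P" by (rule finite_folded_paths[OF jsl xA s])
  have lastp: "last p \<in> ext_weyl D" if "p \<in> ?P" for p using alcoves_in_ext[OF folded_paths_last[OF that]] .
  have ac: "a p \<in> carrier RJ" if "p \<in> ?P" for p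
    unfolding a_def using ring_hom_closed[OF R_to_zetaJ_hom mass_carrier] zetaJ_carrier ext_decomp(1)[OF lastp[OF that]]
    by (intro Mod.R.m_closed) auto
  have ap: "path_term js p = a p \<odot>\<^bsub>M\<^esub> m (theta_up D J (last p))" if "p \<in> ?P" for p
    unfolding path_term_def mvec_def a_def
    using Mod.smult_assoc1 ring_hom_closed[OF R_to_zetaJ_hom mass_carrier] zetaJ_carrier[OF ext_decomp(1)[OF lastp[OF that]]]
      m_closed[OF theta_up_mem[OF lastp[OF that]]] by simp
  have hext: "word_prod D js \<circ> \<sigma> \<in> ext_weyl D"
    using ext_comp(1)[OF affine_weyl_ext[OF gen_group_word[OF jsl]] alcove_stab_ext[OF s]] .
  have "act (m x) (T (word_prod D js \<circ> \<sigma>)) = (\<Oplus>\<^bsub>M\<^esub>p\<in>?P. path_term js p)"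
    using act_path_sum[OF js s xA] mvec_min_rep[OF x] by simp
  also have "?P = (\<Union>y\<in>min_reps D J. ?Py y)" using theta_up_mem lastp by auto
  also have "(\<Oplus>\<^bsub>M\<^esub>p\<in>(\<Union>y\<in>min_reps D J. ?Py y). path_term js p)
      = (\<Oplus>\<^bsub>M\<^esub>y\<in>min_reps D J. \<Oplus>\<^bsub>M\<^esub>p\<in>?Py y. path_term js p)"
    using finite_min_reps fin path_term_closed
    by (intro Mod.M.add.finprod_UN_disjoint) (auto simp: pairwise_def disjnt_def)
  also have "\<dots> = (\<Oplus>\<^bsub>M\<^esub>y\<in>min_reps D J. ?f y \<odot>\<^bsub>M\<^esub> m y)"
  proof (intro Mod.M.finsum_cong')
    fix y assume y: "y \<in> min_reps D J"
    have "(\<Oplus>\<^bsub>M\<^esub>p\<in>?Py y. path_term js p) = (\<Oplus>\<^bsub>M\<^esub>p\<in>?Py y. a p \<odot>\<^bsub>M\<^esub> m y)"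
      using ap ac m_closed[OF y] by (intro Mod.M.finsum_cong') auto
    also have "\<dots> = ?f y \<odot>\<^bsub>M\<^esub> m y"
      using finsum_smult_rdistr[of "?Py y" a "m y"] fin ac m_closed[OF y] by auto
    finally show "(\<Oplus>\<^bsub>M\<^esub>p\<in>?Py y. path_term js p) = ?f y \<odot>\<^bsub>M\<^esub> m y" .
  next
    show "(\<lambda>y. ?f y \<odot>\<^bsub>M\<^esub> m y) \<in> min_reps D J \<rightarrow> carrier M"
      using ac m_closed by (auto intro!: Mod.smult_closed Mod.R.finsum_closed)
  qed simp
  finally have "act (m x) (T (word_prod D js \<circ> \<sigma>)) = lin_comb D J M m ?f" unfolding lin_comb_def .
  moreover have "?f \<in> min_reps D J \<rightarrow> carrier RJ" using ac by (auto intro!: Mod.R.finsum_closed)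
  ultimately show ?thesis using matrix_entry_eq[of ?f x "T (word_prod D js \<circ> \<sigma>)" y] x y T_closed[OF hext]
    by (simp add: a_def)
qed

end

theorem theorem5p12:
  fixes D :: "'a::euclidean_space root_datum"
    and J :: "nat set"
    and v :: "'a \<Rightarrow> int laurent"
    and H :: "(int laurent, 'h) module"
    and T :: "('a \<Rightarrow> 'a) \<Rightarrow> 'h"
    and M :: "(int laurent laurent set, 'm) module"
    and act :: "'m \<Rightarrow> 'h \<Rightarrow> 'm"
    and m :: "('a \<Rightarrow> 'a) \<Rightarrow> 'm"
    and w \<sigma> x y :: "'a \<Rightarrow> 'a"
    and js :: "nat list"
  assumes "irreducible_root_datum D"
    and "J \<subseteq> {1..DIM('a)}"
    and "parameter_system D J v"
    and "hecke_algebra D H T"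
    and "standard_module D J v H T M act m"
    and "w \<in> ext_weyl D"
    and "reduced_expression D w js \<sigma>"
    and "x \<in> min_reps D J"
    and "y \<in> min_reps D J"
  shows "matrix_entry D J M act m (T w) x y =
    (\<Oplus>\<^bsub>zetaJ_ring D J\<^esub>p\<in>{p \<in> folded_paths D J js \<sigma> x. theta_up D J (last p) = y}.
       R_to_zetaJ D J (mass D J v js p) \<otimes>\<^bsub>zetaJ_ring D J\<^esub> zetaJ D J (wt D (last p)))"
proof -
  interpret hecke_module D J v H T M act m
    using assms(1-5)
    by (simp add: hecke_module_def hecke_module_axioms_def parabolic_def parabolic_axioms_def irr_root_datum_def)
  have js: "js \<in> lists {0..DIM('a)}" and s: "\<sigma> \<in> alcove_stab D" and w: "w = word_prod D js \<circ> \<sigma>"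
    and l: "length js = ext_length D w"
    using assms(7) by (auto simp: reduced_expression_def)
  have "reduced js"
    using js l ext_length_affine[OF gen_group_word[OF js] s] unfolding reduced_def w by simp
  from matrix_entry_path_sum[OF this s assms(8,9)] show ?thesis unfolding w .
qed

end
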